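(* Let $n\ge 1$ and let $\Omega\subset\mathbb{R}^n$ be a bounded domain with Lipschitz boundary. Let $V=|\Omega|$ be its volume, let $\delta$ be its packing constant, and let $\lambda_k$ denote its $k$-th Dirichlet eigenvalue. Then for all $k\in\mathbb{N}=\{1,2,\dots\}$, $$\lambda_k \ge C_n\left(\delta\,\frac{k}{V}\right)^{2/n},$$ where $C_n = (2\pi)^2/\omega_n^{2/n}$ and $\omega_n$ is the volume of the unit ball in $\mathbb{R}^n$.
   Context: A domain is a nonempty connected open set, and $|\cdot|$ denotes $n$-dimensional Lebesgue measure. The Dirichlet eigenvalues $0<\lambda_1<\lambda_2\le\cdots$ of $\Omega$ are the eigenvalues, listed in nondecreasing order with multiplicity, of the Laplace operator $\Delta=-\sum_{i=1}^n\partial_i^2$ in $\Omega$ with Dirichlet boundary conditions. Packing constant. A packing $\mathcal{P}$ of $\mathbb{R}^n$ by $\Omega$ is a collection of pairwise disjoint congruent copies of $\Omega$ (images of $\Omega$ under isometries of $\mathbb{R}^n$). A gauge is a pair $(G,o)$, where $G\subset\mathbb{R}^n$ is a compact convex set with nonempty interior and $o$ is a point in the interior of $G$. For $\lambda>0$, $\lambda G$ denotes the image of $G$ under the homothety of scale $\lambda$ fixing $o$. The outer density of $\mathcal{P}$ with respect to a set $G$ is $$d_{\mathrm{out}}(\mathcal{P}|G)=\frac{1}{|G|}\sum_{A\in\mathcal{P},\,A\cap G\ne\emptyset}|A|,$$ and the outer density of $\mathcal{P}$ with respect to the gauge $(G,o)$ is $$d_+(\mathcal{P},G,o)=\limsup_{\lambda\to\infty}d_{\mathrm{out}}(\mathcal{P}|\lambda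 G).$$ The packing constant (packing density) $\delta$ of $\Omega$ is the supremum of $d_+(\mathcal{P},G,o)$ over all packings $\mathcal{P}$ by $\Omega$ and all gauges $(G,o)$. *)

theory Defs
  imports "HOL-Analysis.Analysis"
begin

section \<open>Lipschitz boundary\<close>

text \<open>
  Near each boundary point, after a rotation taking the last coordinate axis to the unit
  vector \<open>e\<close>, the set is the region strictly above the graph of a Lipschitz function \<open>\<gamma>\<close> defined
  on the hyperplane orthogonal to \<open>e\<close>; \<open>x - (x \<bullet> e) *\<^sub>R e\<close> is the projection onto that hyperplane.
\<close>

definition lipschitz_boundary :: "'a::euclidean_space set \<Rightarrow> bool" where
  "lipschitz_boundary \<Omega> \<longleftrightarrow>
    (\<forall>p\<in>frontier \<Omega>. \<exists>r>0. \<exists>e \<gamma> L. norm e = 1 \<and> L-lipschitz_on {y. y \<bullet> e = 0} (\<gamma> :: 'a \<Rightarrow> real) \<and>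
       \<Omega> \<inter> ball p r = {x \<in> ball p r. x \<bullet> e > \<gamma> (x - (x \<bullet> e) *\<^sub>R e)})"


section \<open>Dirichlet eigenvalues\<close>

primrec C_k :: "nat \<Rightarrow> ('a::euclidean_space \<Rightarrow> real) \<Rightarrow> bool" where
  "C_k 0 f \<longleftrightarrow> continuous_on UNIV f"
| "C_k (Suc k) f \<longleftrightarrow> (\<exists>g. (\<forall>x. GDERIV f x :> g x) \<and> (\<forall>i\<in>Basis. C_k k (\<lambda>x. g x \<bullet> i)))"

definition gradient :: "('a::euclidean_space \<Rightarrow> real) \<Rightarrow> 'a \<Rightarrow> 'a" where
  "gradient f x = (THE D. GDERIV f x :> D)"

text \<open>The space \<open>C\<^sub>c\<^sup>\<infinity>(\<Omega>)\<close>, its elements extended by zero to the whole space.\<close>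

definition test_functions :: "'a::euclidean_space set \<Rightarrow> ('a \<Rightarrow> real) set" where
  "test_functions \<Omega> = {\<phi>. (\<forall>k. C_k k \<phi>) \<and>
     compact (closure {x. \<phi> x \<noteq> 0}) \<and> closure {x. \<phi> x \<noteq> 0} \<subseteq> \<Omega>}"

definition L2_on :: "'a::euclidean_space set \<Rightarrow> ('a \<Rightarrow> 'b::euclidean_space) \<Rightarrow> bool" where
  "L2_on \<Omega> f \<longleftrightarrow> f \<in> borel_measurable (lebesgue_on \<Omega>) \<and>
     integrable (lebesgue_on \<Omega>) (\<lambda>x. (norm (f x))\<^sup>2)"

text \<open>
  \<open>H10_gradient \<Omega> u g\<close>: the function \<open>u\<close> lies in the Sobolev space \<open>H\<^sub>0\<^sup>1(\<Omega>)\<close>, the closure of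
  \<open>C\<^sub>c\<^sup>\<infinity>(\<Omega>)\<close> in the \<open>H\<^sup>1\<close> norm, and \<open>g\<close> is its weak gradient. For open \<open>\<Omega>\<close> the field \<open>g\<close> is
  determined by \<open>u\<close> up to a null set.
\<close>

definition H10_gradient ::
    "'a::euclidean_space set \<Rightarrow> ('a \<Rightarrow> real) \<Rightarrow> ('a \<Rightarrow> 'a) \<Rightarrow> bool" where
  "H10_gradient \<Omega> u g \<longleftrightarrow> L2_on \<Omega> u \<and> L2_on \<Omega> g \<and>
     (\<exists>\<phi>. (\<forall>j::nat. \<phi> j \<in> test_functions \<Omega>) \<and>
       (\<lambda>j. \<integral>x. (\<phi> j x - u x)\<^sup>2 \<partial>lebesgue_on \<Omega>) \<longlonglongrightarrow> 0 \<and>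
       (\<lambda>j. \<integral>x. (norm (gradient (\<phi> j) x - g x))\<^sup>2 \<partial>lebesgue_on \<Omega>) \<longlonglongrightarrow> 0)"

text \<open>
  The weak solutions \<open>u \<in> H\<^sub>0\<^sup>1(\<Omega>)\<close> of \<open>\<Delta> u = \<mu> u\<close>, where \<open>\<Delta> = - \<Sum>\<^sub>i \<partial>\<^sub>i\<^sup>2\<close>. The zero solution
  is included, so this is \<open>{0}\<close> (modulo null sets) when \<open>\<mu>\<close> is not an eigenvalue.
\<close>

definition dirichlet_eigenspace :: "'a::euclidean_space set \<Rightarrow> real \<Rightarrow> ('a \<Rightarrow> real) set" where
  "dirichlet_eigenspace \<Omega> \<mu> = {u. \<exists>g. H10_gradient \<Omega> u g \<and>
     (\<forall>\<phi>\<in>test_functions \<Omega>.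
        (\<integral>x. g x \<bullet> gradient \<phi> x \<partial>lebesgue_on \<Omega>) = \<mu> * (\<integral>x. u x * \<phi> x \<partial>lebesgue_on \<Omega>))}"

text \<open>
  \<open>\<mu>\<close> has multiplicity \<open>m\<close>: the eigenspace, with functions identified when they agree almost
  everywhere on \<open>\<Omega>\<close>, has a basis of \<open>m\<close> elements. Multiplicity \<open>0\<close> means that \<open>\<mu>\<close> is not an
  eigenvalue.
\<close>

definition dirichlet_multiplicity :: "'a::euclidean_space set \<Rightarrow> real \<Rightarrow> nat \<Rightarrow> bool" where
  "dirichlet_multiplicity \<Omega> \<mu> m \<longleftrightarrow>
     (\<exists>u. (\<forall>i<m. u i \<in> dirichlet_eigenspace \<Omega> \<mu>) \<and>
       (\<forall>c::nat \<Rightarrow> real. (AE x in lebesgue_on \<Omega>. (\<Sum>i<m. c i * u i x) = 0) \<longrightarrow> (\<forall>i<m. c i = 0)) \<and>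
       (\<forall>v\<in>dirichlet_eigenspace \<Omega> \<mu>. \<exists>c::nat \<Rightarrow> real.
          AE x in lebesgue_on \<Omega>. v x = (\<Sum>i<m. c i * u i x)))"

text \<open>
  \<open>ev 1 \<le> ev 2 \<le> \<dots>\<close> are the Dirichlet eigenvalues of \<open>\<Omega>\<close>, each listed as often as its
  multiplicity. The value \<open>ev 0\<close> is irrelevant; \<open>ev k\<close> for \<open>k \<ge> 1\<close> is determined by \<open>\<Omega>\<close>.
\<close>

definition dirichlet_eigenvalues :: "'a::euclidean_space set \<Rightarrow> (nat \<Rightarrow> real) \<Rightarrow> bool" where
  "dirichlet_eigenvalues \<Omega> ev \<longleftrightarrow> mono_on {1..} ev \<and>
     (\<forall>\<mu>. finite {k. k \<ge> 1 \<and> ev k = \<mu>} \<and>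
          dirichlet_multiplicity \<Omega> \<mu> (card {k. k \<ge> 1 \<and> ev k = \<mu>}))"


section \<open>Packing constant\<close>

definition congruent_copy :: "'a::euclidean_space set \<Rightarrow> 'a set \<Rightarrow> bool" where
  "congruent_copy \<Omega> A \<longleftrightarrow> (\<exists>f. (\<forall>x y. dist (f x) (f y) = dist x y) \<and> A = f ` \<Omega>)"

definition packing :: "'a::euclidean_space set \<Rightarrow> 'a set set \<Rightarrow> bool" where
  "packing \<Omega> P \<longleftrightarrow> (\<forall>A\<in>P. congruent_copy \<Omega> A) \<and> pairwise disjnt P"

definition gauge_body :: "'a::euclidean_space set \<Rightarrow> 'a \<Rightarrow> bool" where
  "gauge_body G p \<longleftrightarrow> compact G \<and> convex G \<and> p \<in> interior G"

definition homothety :: "'a::euclidean_space \<Rightarrow> real \<Rightarrow> 'a \<Rightarrow> 'a" where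
  "homothety p t x = p + t *\<^sub>R (x - p)"

definition outer_density :: "'a::euclidean_space set set \<Rightarrow> 'a set \<Rightarrow> ennreal" where
  "outer_density P G =
     infsum (emeasure lebesgue) {A \<in> P. A \<inter> G \<noteq> {}} / emeasure lebesgue G"

definition gauge_density :: "'a::euclidean_space set set \<Rightarrow> 'a set \<Rightarrow> 'a \<Rightarrow> ennreal" where
  "gauge_density P G p = Limsup at_top (\<lambda>t::real. outer_density P (homothety p t ` G))"

text \<open>
  The supremum is formed in \<open>ennreal\<close>. For a bounded domain it lies between \<open>0\<close> and \<open>1\<close>, so that
  the conversion to a real number loses nothing.
\<close>

definition packing_constant :: "'a::euclidean_space set \<Rightarrow> real" where
  "packing_constant \<Omega> =
     enn2real (SUP (P, G, p) \<in> {(P, G, p). packing \<Omega> P \<and> gauge_body G p}. gauge_density P G p)"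

end

theory Submission
  imports Defs
begin

text \<open>
  A packing of density close to \<open>\<delta>\<close> has, by averaging over translates of a large cube, a cube \<open>Q\<close> of
  side \<open>s + 2D\<close> containing \<open>N \<ge> \<eta> s\<^sup>n / V\<close> disjoint copies of \<open>\<Omega>\<close>, for any \<open>\<eta> < \<delta>\<close>, where \<open>D\<close> exceeds
  the diameter of \<open>\<Omega>\<close>. The first \<open>k\<close> eigenfunctions, transplanted to the copies, span a space of
  dimension \<open>N k\<close> in \<open>H\<^sub>0\<^sup>1(Q)\<close> on which the Rayleigh quotient is at most \<open>\<lambda>\<^sub>k\<close>. So for \<open>L > \<lambda>\<^sub>k\<close> the
  number of Dirichlet eigenvalues of \<open>Q\<close> below \<open>L\<close> is at least \<open>N k\<close>. These eigenvalues are
  explicit, and counting lattice points bounds their number by \<open>\<omega>\<^sub>n (s + 2D)\<^sup>n L\<^bsup>n/2\<^esup> / (2\<pi>)\<^sup>n\<close>. Now let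
  \<open>s \<rightarrow> \<infinity>\<close>, \<open>\<eta> \<rightarrow> \<delta>\<close> and \<open>L \<rightarrow> \<lambda>\<^sub>k\<close>.
\<close>

section \<open>Isometries preserve Lebesgue measure\<close>

text \<open>The density is measured with arbitrary convex gauges, whereas explicit eigenvalues are
  available for cubes; the averaging step trades one for the other. The lattice count behind C_n is
  an upper bound without error term, valid for every L > 0, because each counted cell lies inside
  the ball. Hence the only loss is the collar of width D around the cube. The role of the min-max
  principle is played by \<open>spectral_inequality\<close>, a statement about C^1 functions of
  compact support in the cube, which rests on Bessel's inequality for the gradient and completeness
  of the sine modes for the function. The obstacle is that eigenfunctions are only H^1 limits of
  test functions: orthogonality to the low modes can be imposed on the eigenfunctions, but fails for
  their approximants. The inequality therefore keeps the low Fourier coefficients as an explicit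
  term, which tends to zero along the approximation. The eigenfunctions are not orthonormalised;
  Gram forms on coefficient vectors take the place of an orthonormal basis.\<close>

lemma isometry_orthogonal:
  fixes f :: "'a::euclidean_space \<Rightarrow> 'a"
  assumes "\<And>x y. dist (f x) (f y) = dist x y"
  shows "orthogonal_transformation (\<lambda>x. f x - f 0)"
  unfolding orthogonal_transformation_isometry using assms by (simp add: dist_norm)

lemma isometry_bij:
  fixes f :: "'a::euclidean_space \<Rightarrow> 'a"
  assumes "\<And>x y. dist (f x) (f y) = dist x y"
  shows "bij f"
proof -
  have "bij (\<lambda>x. f x - f 0)"
    using isometry_orthogonal[OF assms] by (rule orthogonal_transformation_bij)
  then have "bij ((\<lambda>y. y + f 0) \<circ> (\<lambda>x. f x - f 0))"
    by (intro bij_comp) (auto intro!: bijI' exI[of _ "_ - f 0"])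
  then show ?thesis by (simp add: comp_def)
qed

lemma isometry_inv:
  fixes f :: "'a::euclidean_space \<Rightarrow> 'a"
  assumes "\<And>x y. dist (f x) (f y) = dist x y"
  shows "dist (inv f x) (inv f y) = dist x y"
  by (metis assms bij_inv_eq_iff isometry_bij)

lemma isometry_continuous:
  fixes f :: "'a::metric_space \<Rightarrow> 'b::metric_space"
  assumes "\<And>x y. dist (f x) (f y) = dist x y"
  shows "continuous_on A f"
  unfolding continuous_on_iff using assms by auto

lemma isometry_ball:
  fixes f :: "'a::euclidean_space \<Rightarrow> 'a"
  assumes "\<And>x y. dist (f x) (f y) = dist x y"
  shows "f ` ball a r = ball (f a) r"
proof -
  have "surj f" using isometry_bij[OF assms] by (rule bij_is_surj)
  show ?thesis
  proof (intro set_eqI iffI)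
    fix y assume "y \<in> ball (f a) r"
    moreover obtain x where "y = f x" using \<open>surj f\<close> by (auto simp: surj_def)
    ultimately show "y \<in> f ` ball a r" by (auto simp: assms)
  qed (auto simp: assms)
qed

text \<open>By Vitali covering, an open set is a countable disjoint union of balls up to a null set.
  An isometry takes balls to balls of the same radius, and it preserves null sets because it is
  1-Lipschitz.\<close>

lemma isometry_emeasure_open:
  fixes f :: "'a::euclidean_space \<Rightarrow> 'a"
  assumes f: "\<And>x y. dist (f x) (f y) = dist x y" and "open U"
  shows "emeasure lebesgue (f ` U) = emeasure lebesgue U"
proof -
  let ?K = "{(x::'a, r::real). ball x r \<subseteq> U}"
  obtain C where C: "countable C" "C \<subseteq> ?K"
    and pw: "pairwise (\<lambda>i j. disjnt (ball (fst i) (snd i)) (ball (fst j) (snd j))) C"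
    and neg: "negligible (U - (\<Union>i\<in>C. ball (fst i) (snd i)))"
  proof (rule Vitali_covering_theorem_balls[of U ?K fst snd])
    fix x and d :: real assume "x \<in> U" "0 < d"
    then obtain e where "e > 0" "ball x e \<subseteq> U" using \<open>open U\<close> openE by blast
    then show "\<exists>i. i \<in> ?K \<and> x \<in> ball (fst i) (snd i) \<and> snd i < d"
      using \<open>0 < d\<close> by (intro exI[of _ "(x, min e (d/2))"]) auto
  qed
  let ?B = "\<Union>i\<in>C. ball (fst i) (snd i)"
  have inj: "inj f" using isometry_bij[OF f] by (rule bij_is_inj)
  have sub: "?B \<subseteq> U" using C by (fastforce simp: subset_eq)
  have negf: "negligible (f ` (U - ?B))"
  proof (rule negligible_locally_Lipschitz_image[OF _ neg])
    fix x
    show "\<exists>T B. open T \<and> x \<in> T \<and> (\<forall>y\<in>(U - ?B) \<inter> T. norm (f y - f x) \<le> B * norm (y - x))"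
      by (intro exI[of _ UNIV] exI[of _ 1]) (auto simp: dist_norm[symmetric] f)
  qed simp
  have split: "emeasure lebesgue W = emeasure lebesgue W'"
    if "W' \<in> sets lebesgue" "W' \<subseteq> W" "negligible (W - W')" for W W' :: "'a set"
  proof -
    have "W - W' \<in> null_sets lebesgue" using that negligible_iff_null_sets by blast
    then have "emeasure lebesgue (W' \<union> (W - W')) = emeasure lebesgue W'"
      using that emeasure_Un_null_set by blast
    moreover have "W' \<union> (W - W') = W" using that by auto
    ultimately show ?thesis by simp
  qed
  have imf: "f ` ?B = (\<Union>i\<in>C. ball (f (fst i)) (snd i))"
    by (auto simp: image_UN isometry_ball[OF f])
  have "emeasure lebesgue (f ` U) = emeasure lebesgue (f ` ?B)"
  proof (rule split)
    have "open (f ` ?B)" unfolding imf by blast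
    then show "f ` ?B \<in> sets lebesgue" by (simp add: borel_open)
    show "negligible (f ` U - f ` ?B)" using negf inj by (simp add: image_set_diff)
  qed (use sub in blast)
  also have "\<dots> = (\<integral>\<^sup>+i. emeasure lebesgue (ball (f (fst i)) (snd i)) \<partial>count_space C)"
    unfolding imf
  proof (rule emeasure_UN_countable)
    show "disjoint_family_on (\<lambda>i. ball (f (fst i)) (snd i)) C"
      unfolding disjoint_family_on_def
    proof (intro ballI impI)
      fix i j assume "i \<in> C" "j \<in> C" "i \<noteq> j"
      then have "disjnt (ball (fst i) (snd i)) (ball (fst j) (snd j))"
        using pw by (auto simp: pairwise_def)
      then have "f ` ball (fst i) (snd i) \<inter> f ` ball (fst j) (snd j) = {}"
        using inj by (simp add: disjnt_def image_Int[symmetric])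
      then show "ball (f (fst i)) (snd i) \<inter> ball (f (fst j)) (snd j) = {}"
        by (simp add: isometry_ball[OF f])
    qed
  qed (use C in auto)
  also have "\<dots> = (\<integral>\<^sup>+i. emeasure lebesgue (ball (fst i) (snd i)) \<partial>count_space C)"
  proof (rule nn_integral_cong)
    fix i :: "'a \<times> real"
    show "emeasure lebesgue (ball (f (fst i)) (snd i)) = emeasure lebesgue (ball (fst i) (snd i))"
      by (cases "snd i \<ge> 0") (auto simp: emeasure_ball ball_empty)
  qed
  also have "\<dots> = emeasure lebesgue ?B"
    by (rule emeasure_UN_countable[symmetric])
      (use C pw in \<open>auto simp: disjoint_family_on_def pairwise_def disjnt_def\<close>)
  also have "\<dots> = emeasure lebesgue U"
  proof (rule split[symmetric])
    have "open ?B" by blast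
    then show "?B \<in> sets lebesgue" by (simp add: borel_open)
  qed (use neg sub in auto)
  finally show ?thesis .
qed

text \<open>A measure with the right values on boxes is \<open>lborel\<close>. The preimage of an
  open box is open, so the preceding lemma applied to that preimage gives the value.\<close>

lemma isometry_distr_lborel:
  fixes f :: "'a::euclidean_space \<Rightarrow> 'a"
  assumes f: "\<And>x y. dist (f x) (f y) = dist x y"
  shows "distr lborel borel f = lborel"
proof (rule lborel_eqI[symmetric])
  have [measurable]: "f \<in> borel_measurable borel"
    using isometry_continuous[OF f] by (rule borel_measurable_continuous_onI)
  fix l u :: 'a assume le: "\<And>b. b \<in> Basis \<Longrightarrow> l \<bullet> b \<le> u \<bullet> b"
  have "open (f -` box l u)"
    using isometry_continuous[OF f, of UNIV] by (intro open_vimage) auto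
  have "f ` (f -` box l u) = box l u"
    using isometry_bij[OF f] by (intro surj_image_vimage_eq bij_is_surj)
  then have "emeasure lborel (f -` box l u) = emeasure lborel (box l u)"
    using isometry_emeasure_open[OF f \<open>open (f -` box l u)\<close>] \<open>open (f -` box l u)\<close>
    by (simp add: borel_open)
  then show "emeasure (distr lborel borel f) (box l u) = (\<Prod>b\<in>Basis. (u - l) \<bullet> b)"
    using le by (simp add: emeasure_distr emeasure_lborel_box)
qed simp

lemma isometry_integral:
  fixes f :: "'a::euclidean_space \<Rightarrow> 'a" and g :: "'a \<Rightarrow> real"
  assumes f: "\<And>x y. dist (f x) (f y) = dist x y" and g: "g \<in> borel_measurable borel"
  shows "(\<integral>x. g (f x) \<partial>lborel) = (\<integral>x. g x \<partial>lborel)"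
proof -
  have [measurable]: "f \<in> borel_measurable borel"
    using isometry_continuous[OF f] by (rule borel_measurable_continuous_onI)
  have "(\<integral>x. g x \<partial>lborel) = (\<integral>x. g x \<partial>distr lborel borel f)"
    by (simp add: isometry_distr_lborel[OF f])
  also have "\<dots> = (\<integral>x. g (f x) \<partial>lborel)"
    by (rule integral_distr) (use g in auto)
  finally show ?thesis by simp
qed

section \<open>Many copies in a cube\<close>

lemma homothety_eq_affine: "homothety p t ` G = (\<lambda>x. t *\<^sub>R x + (p - t *\<^sub>R p)) ` G"
  by (simp add: homothety_def algebra_simps)

text \<open>By convexity, scaling \<open>G\<close> about \<open>p\<close> by t + c covers the sum of
  its copies scaled by t and by c. With c = R/r the latter contains a ball of radius
  \<open>R\<close>. The change of scale is additive, hence negligible for large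
  \<open>t\<close>.\<close>

lemma homothety_mono_translate:
  fixes G :: "'a::euclidean_space set"
  assumes G: "convex G" and r: "r > 0" "cball p r \<subseteq> G" and t: "t > 0"
    and x: "x \<in> homothety p t ` G" and w: "norm w \<le> R" and R: "R > 0"
  shows "x - w \<in> homothety p (t + R / r) ` G"
proof -
  obtain g where g: "g \<in> G" "x = p + t *\<^sub>R (g - p)" using x by (auto simp: homothety_def)
  define c where "c = R / r"
  have c: "c > 0" using R r by (simp add: c_def)
  have "norm ((1 / c) *\<^sub>R w) \<le> r" using w r R by (simp add: c_def field_simps)
  then have "p - (1 / c) *\<^sub>R w \<in> G" using r by (auto simp: dist_norm subset_eq)
  then have "(t / (t + c)) *\<^sub>R g + (c / (t + c)) *\<^sub>R (p - (1 / c) *\<^sub>R w) \<in> G" (is "?y \<in> G")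
    using G g c t by (intro convexD) (auto simp: add_divide_distrib[symmetric])
  moreover have "homothety p (t + c) ?y = x - w"
  proof -
    have "t + c \<noteq> 0" using t c by simp
    have "(t + c) *\<^sub>R ?y = t *\<^sub>R g + c *\<^sub>R (p - (1 / c) *\<^sub>R w)"
      using \<open>t + c \<noteq> 0\<close> by (simp add: scaleR_add_right)
    also have "\<dots> = t *\<^sub>R g + c *\<^sub>R p - w" using c by (simp add: scaleR_diff_right)
    finally have "(t + c) *\<^sub>R ?y = t *\<^sub>R g + c *\<^sub>R p - w" .
    then show ?thesis by (simp add: homothety_def g scaleR_diff_right) (simp add: algebra_simps)
  qed
  ultimately show ?thesis unfolding c_def[symmetric] by (metis image_eqI)
qed

lemma emeasure_homothety:
  fixes G :: "'a::euclidean_space set"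
  assumes "compact G" "t > 0"
  shows "emeasure lebesgue (homothety p t ` G) = ennreal (t ^ DIM('a) * measure lebesgue G)"
proof -
  have "emeasure lebesgue G = ennreal (measure lebesgue G)"
    using assms(1) by (intro emeasure_eq_measure2 fmeasurableD2 ) (auto simp: lmeasurable_compact)
  then show ?thesis
    unfolding homothety_eq_affine using assms(2) emeasure_lebesgue_affine[of t "p - t *\<^sub>R p" G]
    by (simp add: ennreal_mult)
qed

text \<open>A sum of nonnegative terms is the supremum of its finite partial sums, so finitely many
  copies already exceed a strict lower bound. All copies have the same volume \<open>V\<close>,
  which turns the sum into a cardinality.\<close>

lemma finite_sum_outer_density:
  fixes \<Omega> :: "'a::euclidean_space set"
  assumes "open \<Omega>" and P: "packing \<Omega> P" and b: "0 < emeasure lebesgue B" "0 \<le> \<eta>"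
    and less: "ennreal \<eta> < outer_density P B" and v: "emeasure lebesgue \<Omega> = ennreal V" "V \<ge> 0"
  obtains F where "finite F" "F \<subseteq> {A \<in> P. A \<inter> B \<noteq> {}}" "ennreal \<eta> * emeasure lebesgue B < ennreal (real (card F) * V)"
proof -
  have "emeasure lebesgue B * ennreal \<eta> < infsum (emeasure lebesgue) {A \<in> P. A \<inter> B \<noteq> {}}"
  proof (rule ccontr)
    assume "\<not> ?thesis"
    then have "outer_density P B \<le> ennreal \<eta>"
      unfolding outer_density_def using b by (intro divide_le_posI_ennreal) auto
    then show False using less by simp
  qed
  also have "\<dots> = (SUP F\<in>{F. finite F \<and> F \<subseteq> {A \<in> P. A \<inter> B \<noteq> {}}}. sum (emeasure lebesgue) F)"
    by (rule nonneg_infsum_complete) simp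
  finally obtain F where F: "finite F" "F \<subseteq> {A \<in> P. A \<inter> B \<noteq> {}}" "emeasure lebesgue B * ennreal \<eta> < sum (emeasure lebesgue) F"
    unfolding less_SUP_iff by auto
  have "emeasure lebesgue A = ennreal V" if A: "A \<in> F" for A
  proof -
    have "congruent_copy \<Omega> A" using A F P by (auto simp: packing_def)
    then obtain f where "\<And>x y. dist (f x) (f y) = dist x y" "A = f ` \<Omega>" unfolding congruent_copy_def by blast
    then show ?thesis using isometry_emeasure_open[OF _ \<open>open \<Omega>\<close>, of f] v by simp
  qed
  then have "sum (emeasure lebesgue) F = ennreal (real (card F) * V)"
    using v by (simp add: ennreal_mult ennreal_of_nat_eq_real_of_nat)
  with F show ?thesis by (intro that[of F]) (auto simp: mult.commute)
qed

text \<open>Integrates the number of points in a translate of the cube over all translates.\<close>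

lemma translate_with_many_points:
  fixes x :: "'i \<Rightarrow> 'a::euclidean_space"
  assumes F: "finite F" and s: "s > 0" and H: "H \<in> sets lebesgue" "emeasure lebesgue H = ennreal h" "h \<ge> 0"
    and sub: "\<And>i. i \<in> F \<Longrightarrow> cbox (x i - s *\<^sub>R One) (x i) \<subseteq> H"
  shows "\<exists>y. real (card F) * s ^ DIM('a) \<le> real (card {i \<in> F. x i \<in> cbox y (y + s *\<^sub>R One)}) * h"
proof -
  let ?N = "\<lambda>y. card {i \<in> F. x i \<in> cbox y (y + s *\<^sub>R One)}"
  let ?C = "\<lambda>i. cbox (x i - s *\<^sub>R One) (x i)"
  \<comment> \<open>Seen from a fixed point, the corners \<open>y\<close> of the cubes containing it
    fill a cube of volume s^n.\<close>
  have mem: "x i \<in> cbox y (y + s *\<^sub>R One) \<longleftrightarrow> y \<in> ?C i" for i y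
    by (auto simp: mem_box algebra_simps)
  have "?N y < Suc (card F)" for y using F by (intro le_imp_less_Suc card_mono) auto
  \<comment> \<open>The counts are bounded by \<open>card F\<close>, so a maximum exists; it
    dominates the average over \<open>H\<close>.\<close>
  then obtain y where y: "\<And>z. ?N z \<le> ?N y" 
    using ex_has_greatest_nat[of "\<lambda>_. True" undefined ?N "Suc (card F)"] by auto
  have vol: "emeasure lebesgue (?C i) = ennreal (s ^ DIM('a))" for i
    using s by (simp add: emeasure_lborel_cbox_eq inner_diff_left)
  have "ennreal (real (card F) * s ^ DIM('a)) = (\<Sum>i\<in>F. emeasure lebesgue (?C i))"
    unfolding vol using s by (simp add: ennreal_mult ennreal_of_nat_eq_real_of_nat)
  also have "\<dots> = (\<Sum>i\<in>F. \<integral>\<^sup>+z. indicator (?C i) z \<partial>lebesgue)"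
    by simp
  also have "\<dots> = (\<integral>\<^sup>+z. (\<Sum>i\<in>F. indicator (?C i) z) \<partial>lebesgue)"
    by (rule nn_integral_sum[symmetric]) (intro borel_measurable_indicator, simp)
  also have "\<dots> \<le> (\<integral>\<^sup>+z. of_nat (?N y) * indicator H z \<partial>lebesgue)"
  proof (rule nn_integral_mono)
    fix z
    have "(\<Sum>i\<in>F. indicator (?C i) z) = (of_nat (?N z) :: ennreal)"
      unfolding mem using F by (simp add: indicator_def sum.If_cases Int_def)
    also have "\<dots> \<le> of_nat (?N y) * indicator H z"
    proof (cases "z \<in> H")
      case True then show ?thesis using y[of z] by simp
    next
      case False
      then have "{i \<in> F. x i \<in> cbox z (z + s *\<^sub>R One)} = {}" unfolding mem using sub by blast
      then have "?N z = 0" by (simp only: card.empty)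
      then show ?thesis by simp
    qed
    finally show "(\<Sum>i\<in>F. indicator (?C i) z) \<le> (of_nat (?N y) * indicator H z :: ennreal)" .
  qed
  also have "\<dots> = of_nat (?N y) * ennreal h"
    using H by (simp add: nn_integral_cmult_indicator)
  also have "\<dots> = ennreal (real (?N y) * h)"
    using H by (simp add: ennreal_mult ennreal_of_nat_eq_real_of_nat)
  finally show ?thesis using H by (intro exI[of _ y]) (subst (asm) ennreal_le_iff, auto)
qed

text \<open>The density counts every copy that merely meets the gauge, so one point common to copy
  and gauge is chosen for each, and these points are averaged over cubes of side \<open>s\<close>. A
  copy whose point lies in such a cube extends less than \<open>D\<close> beyond it; hence the side
  \<open>s + 2 * D\<close> against \<open>s\<close> in the count.\<close>

lemma packing_constant_cube:
  fixes \<Omega> :: "'a::euclidean_space set"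
  assumes \<Omega>: "open \<Omega>" "bounded \<Omega>" and D: "\<And>x y. x \<in> \<Omega> \<Longrightarrow> y \<in> \<Omega> \<Longrightarrow> dist x y < D"
    and \<eta>: "0 < \<eta>" "\<eta> < packing_constant \<Omega>" and s: "s > 0"
  obtains F z where "finite F" "\<And>A. A \<in> F \<Longrightarrow> congruent_copy \<Omega> A" "pairwise disjnt F"
    "\<And>A. A \<in> F \<Longrightarrow> A \<subseteq> box z (z + (s + 2 * D) *\<^sub>R One)" "\<eta> * s ^ DIM('a) \<le> real (card F) * measure lebesgue \<Omega>"
proof -
  define V where "V = measure lebesgue \<Omega>"
  have V: "emeasure lebesgue \<Omega> = ennreal V" "V \<ge> 0"
    unfolding V_def using emeasure_eq_measure2[OF lmeasurable_open[OF \<Omega>(2,1)]] by auto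
  let ?X = "SUP (P, G, p) \<in> {(P, G, p). packing \<Omega> P \<and> gauge_body G p}. gauge_density P G p"
  have "ennreal \<eta> < ?X"
  proof (rule ccontr)
    assume "\<not> ?thesis"
    then have "enn2real ?X \<le> \<eta>" using \<eta> by (intro enn2real_leI) auto
    then show False using \<eta> by (simp add: packing_constant_def)
  qed
  then obtain P G p where P: "packing \<Omega> P" and G: "gauge_body G p" and "ennreal \<eta> < gauge_density P G p"
    unfolding less_SUP_iff by auto
  \<comment> \<open>A second value strictly between \<open>\<eta>\<close> and the density leaves
    room for the factor (1 + c/t)^n paid when the gauge is enlarged.\<close>
  then obtain e' where e': "ennreal \<eta> < e'" "e' < gauge_density P G p" using dense by blast
  define \<eta>' where "\<eta>' = enn2real e'"
  have "e' < top" by (rule less_le_trans[OF e'(2) top_greatest])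
  then have e'eq: "e' = ennreal \<eta>'" by (simp add: \<eta>'_def)
  then have \<eta>': "\<eta> < \<eta>'" using e'(1) \<eta> by (metis ennreal_less_iff less_imp_le)
  have G1: "compact G" "convex G" "p \<in> interior G" using G by (auto simp: gauge_body_def)
  obtain r where r: "r > 0" "cball p r \<subseteq> G" using G1(3) mem_interior_cball by blast
  define \<gamma> where "\<gamma> = measure lebesgue G"
  have \<gamma>: "\<gamma> > 0"
  proof -
    have "0 < measure lebesgue (ball p r)" using r(1) content_ball_pos by (simp add: measure_completion)
    also have "\<dots> \<le> \<gamma>"
      unfolding \<gamma>_def using r G1(1) by (intro measure_mono_fmeasurable lmeasurable_compact) auto
    finally show ?thesis .
  qed
  \<comment> \<open>The l1 diameter of a cube of side \<open>s\<close>; it bounds the shift from a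
    chosen point to the corner of any such cube containing it.\<close>
  define R where "R = s * real DIM('a)"
  have R: "R > 0" using s by (simp add: R_def)
  define c where "c = R / r"
  have "((\<lambda>t. \<eta> * (1 + c / t) ^ DIM('a)) \<longlongrightarrow> \<eta> * (1 + 0) ^ DIM('a)) at_top"
    by (intro tendsto_intros tendsto_divide_0[OF tendsto_const] filterlim_at_top_imp_at_infinity filterlim_ident)
  then have "eventually (\<lambda>t. \<eta> * (1 + c / t) ^ DIM('a) < \<eta>') at_top"
    using \<eta>' by (intro order_tendstoD(2)) auto
  then have ev: "eventually (\<lambda>t. \<eta> * (1 + c / t) ^ DIM('a) < \<eta>' \<and> t > 0) at_top"
    using eventually_gt_at_top[of 0] by (rule eventually_conj)
  \<comment> \<open>A limsup above \<open>e'\<close> provides large values only at arbitrarily large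
    scales, not at all of them. One scale at which the enlargement factor is also small enough
    suffices.\<close>
  have "\<not> eventually (\<lambda>t. outer_density P (homothety p t ` G) \<le> e') at_top"
    using Limsup_bounded[of "\<lambda>t. outer_density P (homothety p t ` G)" e' at_top] e'(2)
    unfolding gauge_density_def by (auto simp: not_le)
  with ev obtain t where t: "t > 0" "\<eta> * (1 + c / t) ^ DIM('a) < \<eta>'" "e' < outer_density P (homothety p t ` G)"
    using eventually_mono[OF ev, of "\<lambda>t. outer_density P (homothety p t ` G) \<le> e'"] by (meson not_le)
  let ?B = "homothety p t ` G"
  have mB: "emeasure lebesgue ?B = ennreal (t ^ DIM('a) * \<gamma>)"
    unfolding \<gamma>_def by (rule emeasure_homothety[OF G1(1) t(1)])
  obtain F where F: "finite F" "F \<subseteq> {A \<in> P. A \<inter> ?B \<noteq> {}}"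
    "ennreal \<eta>' * emeasure lebesgue ?B < ennreal (real (card F) * V)"
  proof (rule finite_sum_outer_density[OF \<Omega>(1) P _ _ _ V, of ?B \<eta>'])
    show "0 < emeasure lebesgue ?B" unfolding mB using t \<gamma> by simp
  qed (use t e'eq \<eta> \<eta>' in auto)
  have F3: "\<eta>' * (t ^ DIM('a) * \<gamma>) < real (card F) * V"
    using F(3) \<eta> \<eta>' t \<gamma> unfolding mB by (simp add: ennreal_mult[symmetric] ennreal_less_iff)
  have "\<forall>A\<in>F. \<exists>x. x \<in> A \<and> x \<in> ?B" using F(2) by blast
  then obtain x where x: "\<And>A. A \<in> F \<Longrightarrow> x A \<in> A" "\<And>A. A \<in> F \<Longrightarrow> x A \<in> ?B" by metis
  let ?H = "homothety p (t + c) ` G"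
  have "c > 0" using R r by (simp add: c_def)
  have "\<exists>y. real (card F) * s ^ DIM('a) \<le> real (card {A \<in> F. x A \<in> cbox y (y + s *\<^sub>R One)}) * ((t + c) ^ DIM('a) * \<gamma>)"
  proof (rule translate_with_many_points[OF F(1) s])
    show "emeasure lebesgue ?H = ennreal ((t + c) ^ DIM('a) * \<gamma>)"
      unfolding \<gamma>_def using t \<open>c > 0\<close> by (intro emeasure_homothety[OF G1(1)]) simp
    have "compact ?H" unfolding homothety_def[abs_def] by (intro compact_continuous_image continuous_intros G1)
    then show "?H \<in> sets lebesgue" by (simp add: borel_compact)
    show "0 \<le> (t + c) ^ DIM('a) * \<gamma>" using t \<open>c > 0\<close> \<gamma> by simp
    fix A assume A: "A \<in> F"
    show "cbox (x A - s *\<^sub>R One) (x A) \<subseteq> ?H"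
    proof
      fix y assume y: "y \<in> cbox (x A - s *\<^sub>R One) (x A)"
      have "norm (x A - y) \<le> (\<Sum>b\<in>Basis. \<bar>(x A - y) \<bullet> b\<bar>)" by (rule norm_le_l1)
      also have "\<dots> \<le> (\<Sum>b\<in>(Basis::'a set). s)"
        using y by (intro sum_mono) (auto simp: mem_box inner_diff_left)
      finally have "norm (x A - y) \<le> R" by (simp add: R_def mult.commute)
      from homothety_mono_translate[OF G1(2) r t(1) x(2)[OF A] this R]
      show "y \<in> ?H" by (simp add: c_def)
    qed
  qed
  then obtain y where y: "real (card F) * s ^ DIM('a) \<le> real (card {A \<in> F. x A \<in> cbox y (y + s *\<^sub>R One)}) * ((t + c) ^ DIM('a) * \<gamma>)" ..
  define F' where "F' = {A \<in> F. x A \<in> cbox y (y + s *\<^sub>R One)}"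
  define z where "z = y - D *\<^sub>R One"
  show ?thesis
  proof (rule that[of F' z])
    show "finite F'" using F by (simp add: F'_def)
    show cc: "congruent_copy \<Omega> A" if "A \<in> F'" for A
      using that F P by (auto simp: F'_def packing_def)
    have "F' \<subseteq> P" using F by (auto simp: F'_def)
    then show "pairwise disjnt F'" using P unfolding packing_def by (metis pairwise_subset)
    show "A \<subseteq> box z (z + (s + 2 * D) *\<^sub>R One)" if A: "A \<in> F'" for A
    proof
      fix w assume w: "w \<in> A"
      have xA: "x A \<in> A" "x A \<in> cbox y (y + s *\<^sub>R One)" using A x by (auto simp: F'_def)
      obtain f where f: "\<And>x y. dist (f x) (f y) = dist x y" "A = f ` \<Omega>"
        using cc[OF A] unfolding congruent_copy_def by blast
      have "dist w (x A) < D" using w xA(1) D unfolding f(2) by (auto simp: f(1))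
      then have b: "\<bar>w \<bullet> b - x A \<bullet> b\<bar> < D" if "b \<in> Basis" for b
        using Basis_le_norm[OF that, of "w - x A"] by (simp add: dist_norm inner_diff_left)
      show "w \<in> box z (z + (s + 2 * D) *\<^sub>R One)"
        unfolding mem_box
      proof
        fix b :: 'a assume bB: "b \<in> Basis"
        have "y \<bullet> b \<le> x A \<bullet> b" "x A \<bullet> b \<le> y \<bullet> b + s" using xA(2) bB by (auto simp: mem_box inner_add_left)
        then show "z \<bullet> b < w \<bullet> b \<and> w \<bullet> b < (z + (s + 2 * D) *\<^sub>R One) \<bullet> b"
          using b[OF bB] bB by (auto simp: z_def inner_diff_left inner_add_left abs_less_iff)
      qed
    qed
    have tc: "(t + c) ^ DIM('a) = t ^ DIM('a) * (1 + c / t) ^ DIM('a)"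
      using t by (simp add: power_mult_distrib[symmetric] distrib_left)
    define q where "q = (1 + c / t) ^ DIM('a)"
    have q: "q > 0" using t \<open>c > 0\<close> by (simp add: q_def add_pos_pos)
    define a where "a = t ^ DIM('a) * \<gamma>"
    have a: "a > 0" using t \<gamma> by (simp add: a_def)
    \<comment> \<open>\<open>q * a\<close> is the volume of the enlarged gauge \<open>?H\<close>.
      The density estimate and the averaging estimate are chained, and this volume cancels.\<close>
    have "\<eta> * q * a * s ^ DIM('a) \<le> \<eta>' * a * s ^ DIM('a)"
      using t(2) a s by (intro mult_right_mono) (auto simp: q_def)
    also have "\<dots> \<le> real (card F) * V * s ^ DIM('a)"
      using F3 s by (intro mult_right_mono) (auto simp: a_def)
    also have "\<dots> = real (card F) * s ^ DIM('a) * V" by simp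
    also have "\<dots> \<le> real (card F') * (q * a) * V"
      using y V by (intro mult_right_mono) (auto simp: F'_def tc q_def a_def mult_ac)
    finally have "(\<eta> * s ^ DIM('a)) * (q * a) \<le> (real (card F') * V) * (q * a)" by (simp add: mult_ac)
    then show "\<eta> * s ^ DIM('a) \<le> real (card F') * measure lebesgue \<Omega>"
      using q a by (simp add: V_def)
  qed
qed

section \<open>Dirichlet spectrum of a cube\<close>

lemma integrable_compact_support:
  fixes F :: "'a::euclidean_space \<Rightarrow> real"
  assumes "continuous_on UNIV F" "compact K" "\<And>x. x \<notin> K \<Longrightarrow> F x = 0"
  shows "integrable lborel F"
proof -
  have "integrable lborel (\<lambda>x. indicator K x *\<^sub>R F x)"
    using assms by (intro borel_integrable_compact) (auto intro: continuous_on_subset)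
  moreover have "(\<lambda>x. indicator K x *\<^sub>R F x) = F"
    using assms(3) by (auto simp: indicator_def fun_eq_iff)
  ultimately show ?thesis by simp
qed

lemma lborel_integral_translate:
  fixes F :: "'a::euclidean_space \<Rightarrow> real"
  assumes "F \<in> borel_measurable borel"
  shows "(\<integral>x. F (c + x) \<partial>lborel) = (\<integral>x. F x \<partial>lborel)"
proof -
  have "(\<integral>x. F x \<partial>lborel) = (\<integral>x. F x \<partial>distr lborel borel ((+) c))"
    by (simp add: lborel_distr_plus)
  also have "\<dots> = (\<integral>x. F (c + x) \<partial>lborel)"
    by (rule integral_distr) (use assms in auto)
  finally show ?thesis by simp
qed

text \<open>Difference quotients have integral zero by translation invariance.\<close>

lemma integral_directional_derivative_0:
  fixes F F' :: "'a::euclidean_space \<Rightarrow> real"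
  assumes cF: "continuous_on UNIV F" and cF': "continuous_on UNIV F'" and K: "compact K"
    and F0: "\<And>x. x \<notin> K \<Longrightarrow> F x = 0" and F'0: "\<And>x. x \<notin> K \<Longrightarrow> F' x = 0"
    and deriv: "\<And>x. ((\<lambda>t. F (x + t *\<^sub>R b)) has_real_derivative F' x) (at 0)"
  shows "(\<integral>x. F' x \<partial>lborel) = 0"
proof -
  define h where "h n = 1 / (real n + 1)" for n
  have h: "h n > 0" "h n \<le> 1" for n by (auto simp: h_def)
  have h0: "h \<longlonglongrightarrow> 0" unfolding h_def by real_asymp
  obtain R where R: "\<And>x. x \<in> K \<Longrightarrow> norm x \<le> R"
    using compact_imp_bounded[OF K] by (auto simp: bounded_iff)
  have "bounded (F' ` K)"
    using K cF' by (intro compact_imp_bounded compact_continuous_image) (auto intro: continuous_on_subset)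
  then obtain C0 where C0: "\<And>x. x \<in> K \<Longrightarrow> \<bar>F' x\<bar> \<le> C0" by (auto simp: bounded_iff)
  define C where "C = max C0 0"
  have C: "\<bar>F' x\<bar> \<le> C" for x
    using C0[of x] F'0[of x] by (cases "x \<in> K") (auto simp: C_def)
  have d: "((\<lambda>t. F (x + t *\<^sub>R b)) has_real_derivative F' (x + s *\<^sub>R b)) (at s)" for x s
    using deriv[of "x + s *\<^sub>R b"] DERIV_shift[of "\<lambda>t. F (x + t *\<^sub>R b)" "F' (x + s *\<^sub>R b)" 0 s]
    by (simp add: algebra_simps)
  define q where "q n x = (F (x + h n *\<^sub>R b) - F x) / h n" for n x
  have mF [measurable]: "F \<in> borel_measurable borel" "F' \<in> borel_measurable borel"
    using cF cF' by (auto intro: borel_measurable_continuous_onI)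
  have iF: "integrable lborel F" by (rule integrable_compact_support[OF cF K F0])
  have iFt: "integrable lborel (\<lambda>x. F (c + x))" for c
  proof (rule integrable_compact_support)
    show "continuous_on UNIV (\<lambda>x. F (c + x))"
      by (intro continuous_on_compose2[OF cF] continuous_intros) auto
    show "compact ((\<lambda>x. - c + x) ` K)" using K by (rule compact_translation)
    fix x assume "x \<notin> (\<lambda>x. - c + x) ` K"
    then have "c + x \<notin> K" using image_eqI[of x "\<lambda>x. - c + x" "c + x" K] by auto
    then show "F (c + x) = 0" by (rule F0)
  qed
  have q0: "(\<integral>x. q n x \<partial>lborel) = 0" for n
  proof -
    have "(\<integral>x. q n x \<partial>lborel) = ((\<integral>x. F (h n *\<^sub>R b + x) \<partial>lborel) - (\<integral>x. F x \<partial>lborel)) / h n"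
      unfolding q_def using iF iFt[of "h n *\<^sub>R b"] by (simp add: add.commute)
    then show ?thesis by (simp add: lborel_integral_translate[OF mF(1)])
  qed
  have "(\<lambda>n. \<integral>x. q n x \<partial>lborel) \<longlonglongrightarrow> (\<integral>x. F' x \<partial>lborel)"
  proof (rule integral_dominated_convergence)
    \<comment> \<open>By the mean value theorem each quotient is a value of \<open>F'\<close> at a
      point within \<open>norm b\<close> of \<open>x\<close>, as h n \<le> 1. So the quotients are
      bounded by \<open>C\<close> and vanish outside a ball independent of \<open>n\<close>.\<close>
    let ?w = "\<lambda>x. indicator (cball 0 (R + norm b)) x *\<^sub>R C"
    show "integrable lborel ?w"
      by (rule borel_integrable_compact) auto
    show "AE x in lborel. (\<lambda>n. q n x) \<longlonglongrightarrow> F' x"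
    proof (rule AE_I2)
      fix x
      have "((\<lambda>t. (F (x + t *\<^sub>R b) - F x) / t) \<longlongrightarrow> F' x) (at 0)"
        using deriv[of x] by (simp add: DERIV_def)
      moreover have "filterlim h (at 0) sequentially"
        using h0 h by (auto simp: filterlim_at less_le)
      ultimately show "(\<lambda>n. q n x) \<longlonglongrightarrow> F' x"
        unfolding q_def by (rule filterlim_compose)
    qed
    fix n
    show "AE x in lborel. norm (q n x) \<le> ?w x"
    proof (rule AE_I2)
      fix x
      obtain z where z: "z > 0" "z < h n" "F (x + h n *\<^sub>R b) - F (x + 0 *\<^sub>R b) = (h n - 0) * F' (x + z *\<^sub>R b)"
        using MVT2[of 0 "h n" "\<lambda>t. F (x + t *\<^sub>R b)" "\<lambda>t. F' (x + t *\<^sub>R b)"] h d by auto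
      then have 1: "q n x = F' (x + z *\<^sub>R b)" using h[of n] by (simp add: q_def field_simps)
      show "norm (q n x) \<le> ?w x"
      proof (cases "x \<in> cball 0 (R + norm b)")
        case True then show ?thesis using C 1 by auto
      next
        case False
        have "norm x \<le> norm (x + z *\<^sub>R b) + norm (z *\<^sub>R b)"
          by (metis add_diff_cancel_right' norm_triangle_ineq4)
        moreover have "norm (z *\<^sub>R b) \<le> norm b"
          using z h[of n] by (auto intro: mult_left_le_one_le)
        ultimately have "x + z *\<^sub>R b \<notin> K" using False R[of "x + z *\<^sub>R b"] by auto
        then show ?thesis using False 1 F'0 by auto
      qed
    qed
  qed (auto simp: q_def)
  then show ?thesis unfolding q0 using LIMSEQ_unique tendsto_const by blast
qed

lemma integral_prod_Basis:
  fixes f :: "'a::euclidean_space \<Rightarrow> real \<Rightarrow> real"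
  assumes "\<And>b. b \<in> Basis \<Longrightarrow> integrable lborel (f b)"
  shows "(\<integral>x. (\<Prod>b\<in>Basis. f b (x \<bullet> b)) \<partial>(lborel :: 'a measure)) = (\<Prod>b\<in>Basis. \<integral>t. f b t \<partial>lborel)"
proof -
  interpret product_sigma_finite "\<lambda>_::'a. lborel :: real measure" by standard
  have [measurable]: "\<And>b. b \<in> Basis \<Longrightarrow> f b \<in> borel_measurable borel"
    using assms by (auto dest: borel_measurable_integrable)
  let ?T = "\<lambda>g. \<Sum>b\<in>Basis. g b *\<^sub>R b :: 'a"
  have "(\<integral>x. (\<Prod>b\<in>Basis. f b (x \<bullet> b)) \<partial>(lborel :: 'a measure))
      = (\<integral>x. (\<Prod>b\<in>Basis. f b (x \<bullet> b)) \<partial>distr (\<Pi>\<^sub>M b\<in>Basis. lborel) borel ?T)"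
    by (subst lborel_eq) simp
  also have "\<dots> = (\<integral>g. (\<Prod>b\<in>Basis. f b (?T g \<bullet> b)) \<partial>(\<Pi>\<^sub>M b\<in>Basis. lborel))"
    by (rule integral_distr) auto
  also have "\<dots> = (\<integral>g. (\<Prod>b\<in>Basis. f b (g b)) \<partial>(\<Pi>\<^sub>M b\<in>Basis. lborel))"
    by (simp add: inner_sum_left inner_Basis if_distrib sum.delta cong: if_cong)
  also have "\<dots> = (\<Prod>b\<in>Basis. \<integral>t. f b t \<partial>lborel)"
    using assms by (intro product_integral_prod) auto
  finally show ?thesis .
qed

text \<open>The frequency is an integer because the product-to-sum formulas produce differences of
  either sign.\<close>

lemma integral_cos_period:
  assumes "S > 0"
  shows "(\<integral>t. cos (pi / S * real_of_int c * t) * indicator {0..S} t \<partial>lborel) = (if c = 0 then S else 0)"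
proof (cases "c = 0")
  case True
  then show ?thesis using assms by simp
next
  case False
  let ?F = "\<lambda>t. sin (pi / S * real_of_int c * t) / (pi / S * real_of_int c)"
  have "(\<integral>t. cos (pi / S * real_of_int c * t) * indicator {0..S} t \<partial>lborel) = ?F S - ?F 0"
  proof (rule integral_FTC_Icc_real)
    fix t
    show "DERIV ?F t :> cos (pi / S * real_of_int c * t)"
      using False assms by (auto intro!: derivative_eq_intros simp: field_simps)
  qed (use assms in auto)
  also have "\<dots> = 0"
    using assms sin_zero_iff_int2[of "pi * real_of_int c"] by (auto simp: mult.commute)
  finally show ?thesis using False by simp
qed

lemma integrable_cos_Icc:
  "integrable lborel (\<lambda>t::real. cos (c * t) * indicator {a..b} t)"
proof -
  have "integrable lborel (\<lambda>t::real. indicator {a..b} t *\<^sub>R cos (c * t))"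
    by (intro borel_integrable_compact continuous_intros) auto
  then show ?thesis by (simp add: mult.commute)
qed

text \<open>Product-to-sum formulas leave cosines of frequencies a - b and a + b. As both indices
  are at least 1, a + b is nonzero and its integral vanishes.\<close>

lemma
  fixes a b :: nat
  assumes S: "S > 0" and ab: "a \<ge> 1" "b \<ge> 1"
  defines "\<kappa> \<equiv> pi / S"
  shows integral_sin_sin: "(\<integral>t. sin (\<kappa> * a * t) * sin (\<kappa> * b * t) * indicator {0..S} t \<partial>lborel) = (if a = b then S / 2 else 0)" (is ?s)
    and integral_cos_cos: "(\<integral>t. cos (\<kappa> * a * t) * cos (\<kappa> * b * t) * indicator {0..S} t \<partial>lborel) = (if a = b then S / 2 else 0)" (is ?c)
proof -
  let ?J = "\<lambda>c t. cos (\<kappa> * real_of_int c * t) * indicator {0..S} t"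
  have J: "(\<integral>t. ?J c t \<partial>lborel) = (if c = 0 then S else 0)" "integrable lborel (?J c)" for c
    unfolding \<kappa>_def by (rule integral_cos_period[OF S], rule integrable_cos_Icc)
  have eq: "int a - int b = 0 \<longleftrightarrow> a = b" "int a + int b \<noteq> 0" using ab by auto
  have "(\<integral>t. sin (\<kappa> * a * t) * sin (\<kappa> * b * t) * indicator {0..S} t \<partial>lborel)
    = (\<integral>t. (?J (int a - int b) t - ?J (int a + int b) t) / 2 \<partial>lborel)"
    by (intro Bochner_Integration.integral_cong refl)
      (simp add: sin_times_sin algebra_simps diff_divide_distrib)
  also have "\<dots> = ((\<integral>t. ?J (int a - int b) t \<partial>lborel) - (\<integral>t. ?J (int a + int b) t \<partial>lborel)) / 2"
    by (simp only: integral_divide_zero Bochner_Integration.integral_diff[OF J(2) J(2)])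
  finally show ?s unfolding J using eq by auto
  have "(\<integral>t. cos (\<kappa> * a * t) * cos (\<kappa> * b * t) * indicator {0..S} t \<partial>lborel)
    = (\<integral>t. (?J (int a - int b) t + ?J (int a + int b) t) / 2 \<partial>lborel)"
    by (intro Bochner_Integration.integral_cong refl)
      (simp add: cos_times_cos algebra_simps add_divide_distrib)
  also have "\<dots> = ((\<integral>t. ?J (int a - int b) t \<partial>lborel) + (\<integral>t. ?J (int a + int b) t \<partial>lborel)) / 2"
    by (simp only: integral_divide_zero Bochner_Integration.integral_add[OF J(2) J(2)])
  finally show ?c unfolding J using eq by auto
qed

section \<open>Sine modes of the cube and their orthogonality\<close>

definition sine_mode :: "real \<Rightarrow> ('a::euclidean_space \<Rightarrow> nat) \<Rightarrow> 'a \<Rightarrow> real" where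
  "sine_mode \<kappa> m x = (\<Prod>i\<in>Basis. sin (\<kappa> * m i * (x \<bullet> i)))"

text \<open>The partial derivative of the mode in direction \<open>b\<close>. Being again a product
  of functions of one coordinate, it has inner products that factor into one-dimensional
  integrals.\<close>

definition sine_mode_deriv :: "real \<Rightarrow> 'a \<Rightarrow> ('a::euclidean_space \<Rightarrow> nat) \<Rightarrow> 'a \<Rightarrow> real" where
  "sine_mode_deriv \<kappa> b m x =
     (\<Prod>i\<in>Basis. if i = b then \<kappa> * m i * cos (\<kappa> * m i * (x \<bullet> i)) else sin (\<kappa> * m i * (x \<bullet> i)))"

text \<open>Extensional functions, so that distinct indices differ at some basis vector and finite
  sets of them can be counted. Frequencies start at 1 because frequency 0 gives the zero
  function.\<close>

definition mode_indices :: "('a::euclidean_space \<Rightarrow> nat) set" where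
  "mode_indices = Basis \<rightarrow>\<^sub>E {1..}"

definition sine_span :: "real \<Rightarrow> ('a::euclidean_space \<Rightarrow> real) set" where
  "sine_span \<kappa> = {f. \<exists>T a. finite T \<and> T \<subseteq> mode_indices \<and> f = (\<lambda>x. \<Sum>m\<in>T. a m * sine_mode \<kappa> m x)}"

lemma continuous_on_sine_mode: "continuous_on A (sine_mode \<kappa> m)"
  unfolding sine_mode_def[abs_def] by (intro continuous_intros)

lemma continuous_on_sine_mode_deriv: "continuous_on A (sine_mode_deriv \<kappa> b m)"
  unfolding sine_mode_deriv_def[abs_def]
proof (rule continuous_on_prod)
  fix i
  show "continuous_on A (\<lambda>x. if i = b then \<kappa> * m i * cos (\<kappa> * m i * (x \<bullet> i)) else sin (\<kappa> * m i * (x \<bullet> i)))"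
    by (cases "i = b") (auto intro!: continuous_intros)
qed

lemma sine_mode_split:
  assumes "b \<in> Basis"
  shows "sine_mode \<kappa> m x = sin (\<kappa> * m b * (x \<bullet> b)) * (\<Prod>i\<in>Basis - {b}. sin (\<kappa> * m i * (x \<bullet> i)))"
  unfolding sine_mode_def using assms by (simp add: prod.remove)

lemma sine_mode_deriv_split:
  assumes "b \<in> Basis"
  shows "sine_mode_deriv \<kappa> b m x
    = \<kappa> * m b * cos (\<kappa> * m b * (x \<bullet> b)) * (\<Prod>i\<in>Basis - {b}. sin (\<kappa> * m i * (x \<bullet> i)))"
proof -
  have "(\<Prod>i\<in>Basis - {b}. if i = b then \<kappa> * m i * cos (\<kappa> * m i * (x \<bullet> i)) else sin (\<kappa> * m i * (x \<bullet> i)))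
      = (\<Prod>i\<in>Basis - {b}. sin (\<kappa> * m i * (x \<bullet> i)))"
    by (intro prod.cong) auto
  then show ?thesis unfolding sine_mode_deriv_def using assms by (simp add: prod.remove[of Basis b])
qed

text \<open>Along direction \<open>b\<close> only the factor of that coordinate varies, and
  differentiating its cosine returns the sine: this is the second partial derivative of the
  mode.\<close>

lemma sine_mode_line:
  assumes b: "b \<in> Basis"
  shows "((\<lambda>t. sine_mode_deriv \<kappa> b m (x + t *\<^sub>R b)) has_real_derivative
            - (\<kappa> * m b)\<^sup>2 * sine_mode \<kappa> m x) (at 0)"
proof -
  have *: "(\<Prod>i\<in>Basis - {b}. sin (\<kappa> * m i * ((x + t *\<^sub>R b) \<bullet> i)))
      = (\<Prod>i\<in>Basis - {b}. sin (\<kappa> * m i * (x \<bullet> i)))" for t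
    using b by (intro prod.cong refl) (auto simp: inner_add_left inner_Basis)
  show ?thesis
    unfolding sine_mode_deriv_split[OF b] sine_mode_split[OF b] *
    using b by (auto intro!: derivative_eq_intros simp: inner_add_left power2_eq_square)
qed

lemma GDERIV_continuous_on:
  assumes "\<And>x. GDERIV f x :> g x"
  shows "continuous_on A f"
  using assms unfolding gderiv_def
  by (intro continuous_at_imp_continuous_on ballI has_derivative_continuous)

text \<open>The product of \<open>\<phi>\<close> and the derivative of the mode has compact support,
  so its directional derivative has integral zero. The second derivative of the mode reproduces the
  mode.\<close>

lemma integral_by_parts_sine_mode:
  fixes \<phi> :: "'a::euclidean_space \<Rightarrow> real"
  assumes d: "\<And>x. GDERIV \<phi> x :> g x" and cg: "continuous_on UNIV g"
    and K: "compact K" "\<And>x. x \<notin> K \<Longrightarrow> \<phi> x = 0" "\<And>x. x \<notin> K \<Longrightarrow> g x = 0" and b: "b \<in> Basis"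
  shows "(\<integral>x. (g x \<bullet> b) * sine_mode_deriv \<kappa> b m x \<partial>lborel) = (\<kappa> * m b)\<^sup>2 * (\<integral>x. \<phi> x * sine_mode \<kappa> m x \<partial>lborel)"
proof -
  have c\<phi>: "continuous_on UNIV \<phi>"
    using d by (rule GDERIV_continuous_on)
  let ?F = "\<lambda>x. \<phi> x * sine_mode_deriv \<kappa> b m x"
  let ?A = "\<lambda>x. (g x \<bullet> b) * sine_mode_deriv \<kappa> b m x"
  let ?B = "\<lambda>x. \<phi> x * sine_mode \<kappa> m x"
  have c: "continuous_on UNIV ?F" "continuous_on UNIV ?A" "continuous_on UNIV ?B"
    by (intro continuous_intros c\<phi> cg continuous_on_sine_mode continuous_on_sine_mode_deriv)+
  have "(\<integral>x. ?A x - (\<kappa> * m b)\<^sup>2 * ?B x \<partial>lborel) = 0"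
  proof (rule integral_directional_derivative_0[of ?F _ K b])
    fix x
    have "((\<lambda>t. \<phi> (x + t *\<^sub>R b)) has_derivative (\<lambda>h. (h *\<^sub>R b) \<bullet> g (x + 0 *\<^sub>R b))) (at 0)"
    proof (rule has_derivative_compose[of "\<lambda>t. x + t *\<^sub>R b"])
      show "((\<lambda>t. x + t *\<^sub>R b) has_derivative (\<lambda>h. h *\<^sub>R b)) (at 0)"
        by (auto intro!: derivative_eq_intros)
      show "(\<phi> has_derivative (\<lambda>h. h \<bullet> g (x + 0 *\<^sub>R b))) (at (x + 0 *\<^sub>R b))"
        using d unfolding gderiv_def by blast
    qed
    then have "((\<lambda>t. \<phi> (x + t *\<^sub>R b)) has_real_derivative (g x \<bullet> b)) (at 0)"
      unfolding has_field_derivative_def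
      by (rule has_derivative_eq_rhs) (auto simp: fun_eq_iff inner_commute)
    from DERIV_mult[OF this sine_mode_line[OF b, of \<kappa> m x]]
    show "((\<lambda>t. ?F (x + t *\<^sub>R b)) has_real_derivative ?A x - (\<kappa> * m b)\<^sup>2 * ?B x) (at 0)"
      by (simp add: algebra_simps)
  qed (use c K in \<open>auto intro!: continuous_intros\<close>)
  moreover have "integrable lborel ?A" "integrable lborel ?B"
    using c K by (auto intro!: integrable_compact_support[of _ K])
  ultimately show ?thesis by simp
qed

lemma integral_prod_box:
  fixes f :: "'a::euclidean_space \<Rightarrow> real \<Rightarrow> real"
  assumes "\<And>b. b \<in> Basis \<Longrightarrow> continuous_on {0..S} (f b)"
  shows "(\<integral>x. (\<Prod>b\<in>Basis. f b (x \<bullet> b)) * indicator (cbox 0 (S *\<^sub>R One)) x \<partial>(lborel :: 'a measure))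
    = (\<Prod>b\<in>Basis. \<integral>t. f b t * indicator {0..S} t \<partial>lborel)"
proof -
  have "integrable lborel (\<lambda>t. f b t * indicator {0..S} t)" if "b \<in> Basis" for b
    using borel_integrable_compact[OF _ assms[OF that]] by (simp add: mult.commute)
  moreover have "(\<Prod>b\<in>Basis. f b (x \<bullet> b)) * indicator (cbox 0 (S *\<^sub>R One)) x
      = (\<Prod>b\<in>Basis. f b (x \<bullet> b) * indicator {0..S} (x \<bullet> b))" for x :: 'a
  proof (cases "x \<in> cbox 0 (S *\<^sub>R One)")
    case True
    then show ?thesis by (auto simp: mem_box intro!: prod.cong)
  next
    case False
    then obtain i where "i \<in> Basis" "x \<bullet> i \<notin> {0..S}" by (auto simp: mem_box)
    then have "(\<Prod>b\<in>Basis. f b (x \<bullet> b) * indicator {0..S} (x \<bullet> b)) = 0"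
      by (intro prod_zero bexI[of _ i]) auto
    then show ?thesis using False by simp
  qed
  ultimately show ?thesis
    by (simp only:) (rule integral_prod_Basis)
qed

lemma mode_indices_neq:
  assumes "m \<in> mode_indices" "m' \<in> mode_indices" "m \<noteq> m'"
  obtains i where "i \<in> Basis" "m i \<noteq> m' i"
  using assms unfolding mode_indices_def by (metis PiE_ext)

lemma mode_indices_ge_1: "m \<in> mode_indices \<Longrightarrow> i \<in> Basis \<Longrightarrow> m i \<ge> 1"
  unfolding mode_indices_def by auto

lemma sine_mode_orthogonal:
  fixes m m' :: "'a::euclidean_space \<Rightarrow> nat"
  assumes S: "S > 0" and m: "m \<in> mode_indices" "m' \<in> mode_indices"
  shows "(\<integral>x. sine_mode (pi / S) m x * sine_mode (pi / S) m' x * indicator (cbox 0 (S *\<^sub>R One)) x \<partial>(lborel :: 'a measure))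
    = (if m = m' then (S / 2) ^ DIM('a) else 0)"
proof -
  let ?f = "\<lambda>i t. sin (pi / S * m i * t) * sin (pi / S * m' i * t)"
  have "(\<integral>x. sine_mode (pi / S) m x * sine_mode (pi / S) m' x * indicator (cbox 0 (S *\<^sub>R One)) x \<partial>(lborel :: 'a measure))
    = (\<integral>x. (\<Prod>i\<in>Basis. ?f i (x \<bullet> i)) * indicator (cbox 0 (S *\<^sub>R One)) x \<partial>(lborel :: 'a measure))"
    by (simp add: sine_mode_def prod.distrib)
  also have "\<dots> = (\<Prod>i\<in>(Basis::'a set). \<integral>t. ?f i t * indicator {0..S} t \<partial>lborel)"
    by (rule integral_prod_box) (use S in \<open>auto intro!: continuous_intros\<close>)
  also have "\<dots> = (\<Prod>i\<in>(Basis::'a set). if m i = m' i then S / 2 else 0)"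
    using S by (intro prod.cong refl integral_sin_sin mode_indices_ge_1[OF m(1)] mode_indices_ge_1[OF m(2)])
  also have "\<dots> = (if m = m' then (S / 2) ^ DIM('a) else 0)"
    using mode_indices_neq[OF m] by (auto intro!: prod_zero)
  finally show ?thesis .
qed

text \<open>For fixed \<open>b\<close> the derivatives form an orthogonal system of their own, which
  gives Bessel's inequality for each component of a gradient. Their squared norms exceed those of
  the modes by a factor that, summed over \<open>b\<close>, becomes the eigenvalue.\<close>

lemma sine_mode_deriv_orthogonal:
  fixes m m' :: "'a::euclidean_space \<Rightarrow> nat"
  assumes S: "S > 0" and m: "m \<in> mode_indices" "m' \<in> mode_indices" and b: "b \<in> Basis"
  shows "(\<integral>x. sine_mode_deriv (pi / S) b m x * sine_mode_deriv (pi / S) b m' x * indicator (cbox 0 (S *\<^sub>R One)) x \<partial>(lborel :: 'a measure))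
    = (if m = m' then (pi / S * m b)\<^sup>2 * (S / 2) ^ DIM('a) else 0)"
proof -
  let ?f = "\<lambda>i t. if i = b then pi / S * m i * (pi / S * m' i) * (cos (pi / S * m i * t) * cos (pi / S * m' i * t))
     else sin (pi / S * m i * t) * sin (pi / S * m' i * t)"
  have c: "continuous_on A (?f i)" for A i
    using S by (cases "i = b") (auto intro!: continuous_intros)
  have "(\<integral>x. sine_mode_deriv (pi / S) b m x * sine_mode_deriv (pi / S) b m' x * indicator (cbox 0 (S *\<^sub>R One)) x \<partial>(lborel :: 'a measure))
    = (\<integral>x. (\<Prod>i\<in>Basis. ?f i (x \<bullet> i)) * indicator (cbox 0 (S *\<^sub>R One)) x \<partial>(lborel :: 'a measure))"
    unfolding sine_mode_deriv_def prod.distrib[symmetric]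
    by (intro Bochner_Integration.integral_cong refl arg_cong2[of _ _ _ _ "(*)"] prod.cong) auto
  also have "\<dots> = (\<Prod>i\<in>(Basis::'a set). \<integral>t. ?f i t * indicator {0..S} t \<partial>lborel)"
    by (rule integral_prod_box) (rule c)
  also have "\<dots> = (\<Prod>i\<in>(Basis::'a set). (if i = b then pi / S * m i * (pi / S * m' i) else 1) * (if m i = m' i then S / 2 else 0))"
  proof (intro prod.cong refl)
    fix i :: 'a assume "i \<in> Basis"
    then have i: "m i \<ge> 1" "m' i \<ge> 1" using mode_indices_ge_1[OF m(1)] mode_indices_ge_1[OF m(2)] by blast+
    show "(\<integral>t. ?f i t * indicator {0..S} t \<partial>lborel)
      = (if i = b then pi / S * m i * (pi / S * m' i) else 1) * (if m i = m' i then S / 2 else 0)"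
    proof (cases "i = b")
      case True
      then have "(\<integral>t. ?f i t * indicator {0..S} t \<partial>lborel)
        = (\<integral>t. pi / S * m i * (pi / S * m' i) * (cos (pi / S * m i * t) * cos (pi / S * m' i * t) * indicator {0..S} t) \<partial>lborel)"
        by (intro Bochner_Integration.integral_cong refl) (simp add: mult.assoc)
      then show ?thesis using True by (simp only: integral_mult_right_zero integral_cos_cos[OF S i[unfolded True]] simp_thms if_True)
    next
      case False
      then show ?thesis using integral_sin_sin[OF S i] by simp
    qed
  qed
  also have "\<dots> = (if m = m' then (pi / S * m b)\<^sup>2 * (S / 2) ^ DIM('a) else 0)"
    unfolding prod.distrib using mode_indices_neq[OF m] b
    by (auto intro!: prod_zero simp: prod.delta power2_eq_square)
  finally show ?thesis .
qed

text \<open>The coefficients are arbitrary because two choices occur: Fourier coefficients, for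
  Bessel's inequality, and the coefficients of a uniform approximant, to be compared with the
  Fourier sum.\<close>

lemma integral_square_diff_sum:
  fixes f :: "'a \<Rightarrow> real" and h :: "'i \<Rightarrow> 'a \<Rightarrow> real"
  assumes T: "finite T" and "integrable M (\<lambda>x. f x * f x)" "\<And>m. m \<in> T \<Longrightarrow> integrable M (\<lambda>x. f x * h m x)"
    and "\<And>m m'. m \<in> T \<Longrightarrow> m' \<in> T \<Longrightarrow> integrable M (\<lambda>x. h m x * h m' x)"
    and orth: "\<And>m m'. m \<in> T \<Longrightarrow> m' \<in> T \<Longrightarrow> (\<integral>x. h m x * h m' x \<partial>M) = (if m = m' then \<nu> m else 0)"
  shows "(\<integral>x. (f x - (\<Sum>m\<in>T. a m * h m x))\<^sup>2 \<partial>M)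
    = (\<integral>x. f x * f x \<partial>M) - 2 * (\<Sum>m\<in>T. a m * (\<integral>x. f x * h m x \<partial>M)) + (\<Sum>m\<in>T. \<nu> m * (a m)\<^sup>2)"
proof -
  have "(f x - (\<Sum>m\<in>T. a m * h m x))\<^sup>2 = f x * f x - 2 * (\<Sum>m\<in>T. a m * (f x * h m x))
      + (\<Sum>m\<in>T. \<Sum>m'\<in>T. a m * a m' * (h m x * h m' x))" for x
  proof -
    have "(\<Sum>m\<in>T. a m * h m x)\<^sup>2 = (\<Sum>m\<in>T. \<Sum>m'\<in>T. a m * a m' * (h m x * h m' x))"
      by (simp add: power2_eq_square sum_product mult_ac)
    moreover have "(\<Sum>m\<in>T. a m * (f x * h m x)) = f x * (\<Sum>m\<in>T. a m * h m x)"
      by (simp add: sum_distrib_left mult_ac)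
    ultimately show ?thesis by (simp add: power2_diff power2_eq_square algebra_simps)
  qed
  then have "(\<integral>x. (f x - (\<Sum>m\<in>T. a m * h m x))\<^sup>2 \<partial>M)
    = (\<integral>x. f x * f x \<partial>M) - 2 * (\<Sum>m\<in>T. a m * (\<integral>x. f x * h m x \<partial>M))
      + (\<Sum>m\<in>T. \<Sum>m'\<in>T. a m * a m' * (\<integral>x. h m x * h m' x \<partial>M))"
    using assms(1-4) by simp
  also have "(\<Sum>m\<in>T. \<Sum>m'\<in>T. a m * a m' * (\<integral>x. h m x * h m' x \<partial>M)) = (\<Sum>m\<in>T. \<Sum>m'\<in>T. if m = m' then a m * a m' * \<nu> m else 0)"
    by (intro sum.cong refl) (simp add: orth)
  also have "\<dots> = (\<Sum>m\<in>T. \<nu> m * (a m)\<^sup>2)"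
    using T by (intro sum.cong refl) (simp add: sum.delta power2_eq_square)
  finally show ?thesis .
qed

section \<open>Completeness of the sine modes\<close>

lemma sine_spanI: "m \<in> mode_indices \<Longrightarrow> sine_mode \<kappa> m \<in> sine_span \<kappa>"
  unfolding sine_span_def by (intro CollectI exI[of _ "{m}"] exI[of _ "\<lambda>_. 1"]) auto

lemma sine_span_0: "(\<lambda>_. 0) \<in> sine_span \<kappa>"
  unfolding sine_span_def by (intro CollectI exI[of _ "{}"]) auto

lemma sine_span_cmult: "f \<in> sine_span \<kappa> \<Longrightarrow> (\<lambda>x. c * f x) \<in> sine_span \<kappa>"
proof -
  assume "f \<in> sine_span \<kappa>"
  then obtain T a where "finite T" "T \<subseteq> mode_indices" "f = (\<lambda>x. \<Sum>m\<in>T. a m * sine_mode \<kappa> m x)"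
    unfolding sine_span_def by auto
  then show ?thesis
    unfolding sine_span_def
    by (intro CollectI exI[of _ T] exI[of _ "\<lambda>m. c * a m"]) (auto simp: sum_distrib_left mult.assoc)
qed

lemma sine_span_add:
  assumes "f \<in> sine_span \<kappa>" "g \<in> sine_span \<kappa>"
  shows "(\<lambda>x. f x + g x) \<in> sine_span \<kappa>"
proof -
  obtain T a where T: "finite T" "T \<subseteq> mode_indices" "f = (\<lambda>x. \<Sum>m\<in>T. a m * sine_mode \<kappa> m x)"
    using assms unfolding sine_span_def by auto
  obtain T' a' where T': "finite T'" "T' \<subseteq> mode_indices" "g = (\<lambda>x. \<Sum>m\<in>T'. a' m * sine_mode \<kappa> m x)"
    using assms unfolding sine_span_def by auto
  let ?a = "\<lambda>m. (if m \<in> T then a m else 0) + (if m \<in> T' then a' m else 0)"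
  have "(\<lambda>x. f x + g x) = (\<lambda>x. \<Sum>m\<in>T \<union> T'. ?a m * sine_mode \<kappa> m x)"
  proof
    fix x
    have "f x = (\<Sum>m\<in>T \<union> T'. (if m \<in> T then a m else 0) * sine_mode \<kappa> m x)"
      unfolding T(3) using T T' by (intro sum.mono_neutral_cong_left) auto
    moreover have "g x = (\<Sum>m\<in>T \<union> T'. (if m \<in> T' then a' m else 0) * sine_mode \<kappa> m x)"
      unfolding T'(3) using T T' by (intro sum.mono_neutral_cong_left) auto
    ultimately show "f x + g x = (\<Sum>m\<in>T \<union> T'. ?a m * sine_mode \<kappa> m x)"
      by (simp add: sum.distrib distrib_right)
  qed
  then show ?thesis
    unfolding sine_span_def using T T' by (intro CollectI exI[of _ "T \<union> T'"] exI[of _ ?a]) auto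
qed

lemma sine_span_sum:
  assumes "finite T" "\<And>i. i \<in> T \<Longrightarrow> f i \<in> sine_span \<kappa>"
  shows "(\<lambda>x. \<Sum>i\<in>T. f i x) \<in> sine_span \<kappa>"
  using assms by (induction T rule: finite_induct) (auto intro: sine_span_0 sine_span_add)

text \<open>By the product-to-sum formula, multiplication by cos (\<kappa> x_b) moves
  \<open>m b\<close> to its two neighbours. If \<open>m b = 1\<close>, the lower neighbour has
  frequency 0 and is the zero function, so the span is not left.\<close>

lemma sine_span_mult_cos:
  assumes f: "f \<in> sine_span \<kappa>" and b: "b \<in> Basis"
  shows "(\<lambda>x. cos (\<kappa> * (x \<bullet> b)) * f x) \<in> sine_span \<kappa>"
proof -
  have mode: "(\<lambda>x. cos (\<kappa> * (x \<bullet> b)) * sine_mode \<kappa> m x) \<in> sine_span \<kappa>" if m: "m \<in> mode_indices" for m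
  proof -
    let ?u = "m(b := m b + 1)" and ?d = "m(b := m b - 1)"
    have m1: "m b \<ge> 1" using m b by (rule mode_indices_ge_1)
    have sp: "sine_mode \<kappa> (m(b := j)) x = sin (\<kappa> * j * (x \<bullet> b)) * (\<Prod>i\<in>Basis - {b}. sin (\<kappa> * m i * (x \<bullet> i)))" for j x
    proof -
      have "(\<Prod>i\<in>Basis - {b}. sin (\<kappa> * (m(b := j)) i * (x \<bullet> i))) = (\<Prod>i\<in>Basis - {b}. sin (\<kappa> * m i * (x \<bullet> i)))"
        by (intro prod.cong) auto
      then show ?thesis by (simp add: sine_mode_split[OF b])
    qed
    have eq: "cos (\<kappa> * (x \<bullet> b)) * sine_mode \<kappa> m x = 1/2 * (sine_mode \<kappa> ?u x + sine_mode \<kappa> ?d x)" for x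
    proof -
      have "2 * (sin (\<kappa> * m b * (x \<bullet> b)) * cos (\<kappa> * (x \<bullet> b)))
          = sin (\<kappa> * real (m b + 1) * (x \<bullet> b)) + sin (\<kappa> * real (m b - 1) * (x \<bullet> b))"
        using m1 by (subst sin_times_cos) (simp add: of_nat_diff algebra_simps)
      note this[symmetric]
      moreover have "cos (\<kappa> * (x \<bullet> b)) * sine_mode \<kappa> m x = 1/2 * (2 * (sin (\<kappa> * m b * (x \<bullet> b)) * cos (\<kappa> * (x \<bullet> b)))
          * (\<Prod>i\<in>Basis - {b}. sin (\<kappa> * m i * (x \<bullet> i))))"
        unfolding sine_mode_split[OF b, of \<kappa> m x] by simp
      ultimately show ?thesis
        unfolding sp by (simp only: distrib_right[symmetric])
    qed
    have u: "sine_mode \<kappa> ?u \<in> sine_span \<kappa>"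
      using m b by (intro sine_spanI) (auto simp: mode_indices_def PiE_iff extensional_def)
    have d: "sine_mode \<kappa> ?d \<in> sine_span \<kappa>"
    proof (cases "m b = 1")
      case True
      then have "sine_mode \<kappa> ?d = (\<lambda>_. 0)" by (simp add: fun_eq_iff sp)
      then show ?thesis by (simp add: sine_span_0)
    next
      case False
      then have "?d \<in> mode_indices"
        using m b m1 by (auto simp: mode_indices_def PiE_iff extensional_def)
      then show ?thesis by (rule sine_spanI)
    qed
    show ?thesis unfolding eq by (intro sine_span_cmult sine_span_add u d)
  qed
  obtain T a where T: "finite T" "T \<subseteq> mode_indices" "f = (\<lambda>x. \<Sum>m\<in>T. a m * sine_mode \<kappa> m x)"
    using f unfolding sine_span_def by auto
  have "(\<lambda>x. cos (\<kappa> * (x \<bullet> b)) * f x) = (\<lambda>x. \<Sum>m\<in>T. a m * (cos (\<kappa> * (x \<bullet> b)) * sine_mode \<kappa> m x))"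
    by (simp add: T(3) sum_distrib_left mult_ac)
  also have "\<dots> \<in> sine_span \<kappa>"
    using T by (intro sine_span_sum sine_span_cmult mode) auto
  finally show ?thesis .
qed

text \<open>
  Stone--Weierstrass for the algebra of multipliers of \<open>sine_span\<close>, which contains the functions
  \<open>cos (\<kappa> x\<^sub>b)\<close>, applied to the quotient of \<open>\<phi>\<close> by the lowest mode.
\<close>

lemma sine_span_dense:
  fixes \<phi> :: "'a::euclidean_space \<Rightarrow> real"
  assumes S: "S > 0" and c: "continuous_on UNIV \<phi>" and K: "compact K" "K \<subseteq> box 0 (S *\<^sub>R One)"
    and 0: "\<And>x. x \<notin> K \<Longrightarrow> \<phi> x = 0" and e: "\<epsilon> > 0"
  obtains p where "p \<in> sine_span (pi / S)" "\<And>x. x \<in> cbox 0 (S *\<^sub>R One) \<Longrightarrow> \<bar>\<phi> x - p x\<bar> \<le> \<epsilon>"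
proof -
  define \<kappa> where "\<kappa> = pi / S"
  let ?Q = "cbox 0 (S *\<^sub>R One) :: 'a set"
  \<comment> \<open>The span contains no nonzero constants and is not closed under products, so
    Stone-Weierstrass cannot be applied to it directly; its continuous multipliers do form an
    algebra with constants.\<close>
  define R where "R = {f. continuous_on ?Q f \<and> (\<forall>p\<in>sine_span \<kappa>. (\<lambda>x. f x * p x) \<in> sine_span \<kappa>)}"
  define m1 :: "'a \<Rightarrow> nat" where "m1 = restrict (\<lambda>_. 1) Basis"
  have m1: "m1 \<in> mode_indices" by (auto simp: m1_def mode_indices_def)
  have e1: "sine_mode \<kappa> m1 x = (\<Prod>i\<in>Basis. sin (\<kappa> * (x \<bullet> i)))" for x
    by (simp add: sine_mode_def m1_def)
  have pos: "sine_mode \<kappa> m1 x > 0" if "x \<in> box 0 (S *\<^sub>R One)" for x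
    unfolding e1
  proof (rule prod_pos)
    fix i :: 'a assume i: "i \<in> Basis"
    then have "0 < x \<bullet> i" "x \<bullet> i < S" using that by (auto simp: mem_box)
    then have "0 < \<kappa> * (x \<bullet> i)" "\<kappa> * (x \<bullet> i) < pi" using S by (auto simp: \<kappa>_def field_simps)
    then show "sin (\<kappa> * (x \<bullet> i)) > 0" by (rule sin_gt_zero)
  qed
  interpret function_ring_on R ?Q
  proof
    show "compact ?Q" by simp
    show "continuous_on ?Q f" if "f \<in> R" for f using that by (simp add: R_def)
    show "(\<lambda>x. f x + g x) \<in> R" if "f \<in> R" "g \<in> R" for f g
      using that by (auto simp: R_def distrib_right intro!: continuous_intros sine_span_add)
    show "(\<lambda>x. f x * g x) \<in> R" if "f \<in> R" "g \<in> R" for f g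
      using that by (auto simp: R_def mult.assoc intro!: continuous_intros)
    show "(\<lambda>_. c) \<in> R" for c
      by (auto simp: R_def intro!: continuous_intros sine_span_cmult)
    fix x y assume xy: "x \<in> ?Q" "y \<in> ?Q" "x \<noteq> y"
    then obtain b where b: "b \<in> Basis" "x \<bullet> b \<noteq> y \<bullet> b" by (metis euclidean_eqI)
    have "(\<lambda>x. cos (\<kappa> * (x \<bullet> b))) \<in> R"
      using b by (auto simp: R_def intro!: continuous_intros sine_span_mult_cos)
    \<comment> \<open>On the cube \<kappa> x_b stays in [0, pi], where cosine is injective.\<close>
    moreover have "cos (\<kappa> * (x \<bullet> b)) \<noteq> cos (\<kappa> * (y \<bullet> b))"
    proof
      have r: "0 \<le> \<kappa> * (z \<bullet> b)" "\<kappa> * (z \<bullet> b) \<le> pi" if "z \<in> ?Q" for z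
      proof -
        have "0 \<le> z \<bullet> b" "z \<bullet> b \<le> S" using that b by (auto simp: mem_box)
        then show "0 \<le> \<kappa> * (z \<bullet> b)" "\<kappa> * (z \<bullet> b) \<le> pi" using S by (auto simp: \<kappa>_def field_simps)
      qed
      assume "cos (\<kappa> * (x \<bullet> b)) = cos (\<kappa> * (y \<bullet> b))"
      then have "\<kappa> * (x \<bullet> b) = \<kappa> * (y \<bullet> b)" using r xy cos_inj_pi by blast
      then show False using b S by (simp add: \<kappa>_def)
    qed
    ultimately show "\<exists>f\<in>R. f x \<noteq> f y" by (intro bexI[of _ "\<lambda>x. cos (\<kappa> * (x \<bullet> b))"])
  qed
  \<comment> \<open>The denominator is positive in the open cube, and the quotient is zero off
    \<open>K\<close>, also on the faces, where the denominator vanishes. The open cube and the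
    complement of \<open>K\<close> are open and cover the space, so continuity is checked on
    each.\<close>
  let ?\<psi> = "\<lambda>x. \<phi> x / sine_mode \<kappa> m1 x"
  have "continuous_on (box 0 (S *\<^sub>R One) \<union> - K) ?\<psi>"
  proof (rule continuous_on_open_Un)
    show "continuous_on (box 0 (S *\<^sub>R One)) ?\<psi>"
      using pos by (intro continuous_intros continuous_on_subset[OF c] continuous_on_sine_mode) force+
    show "continuous_on (- K) ?\<psi>"
      by (rule continuous_on_eq[OF continuous_on_const[of _ 0]]) (simp add: 0)
  qed (use K in \<open>auto simp: compact_imp_closed open_Compl\<close>)
  moreover have "box 0 (S *\<^sub>R One) \<union> - K = UNIV" using K by auto
  ultimately have "continuous_on ?Q ?\<psi>" by (metis continuous_on_subset subset_UNIV)
  from Stone_Weierstrass_basic[OF this e]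
  obtain g where g: "g \<in> R" "\<And>x. x \<in> ?Q \<Longrightarrow> \<bar>?\<psi> x - g x\<bar> < \<epsilon>" by blast
  show ?thesis
  proof
    show "(\<lambda>x. g x * sine_mode \<kappa> m1 x) \<in> sine_span (pi / S)"
      using g(1) sine_spanI[OF m1, of \<kappa>] by (auto simp: R_def \<kappa>_def)
    fix x assume x: "x \<in> ?Q"
    have "\<phi> x = ?\<psi> x * sine_mode \<kappa> m1 x"
      using pos[of x] 0[of x] K(2) by (cases "x \<in> K") (auto simp: less_le)
    then have "\<bar>\<phi> x - g x * sine_mode \<kappa> m1 x\<bar> = \<bar>?\<psi> x - g x\<bar> * \<bar>sine_mode \<kappa> m1 x\<bar>"
      by (simp add: abs_mult[symmetric] left_diff_distrib)
    also have "\<dots> \<le> \<epsilon> * 1"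
    proof (rule mult_mono)
      show "\<bar>sine_mode \<kappa> m1 x\<bar> \<le> 1"
        unfolding e1 abs_prod by (intro prod_le_1) auto
    qed (use g(2)[OF x] e in auto)
    finally show "\<bar>\<phi> x - g x * sine_mode \<kappa> m1 x\<bar> \<le> \<epsilon>" by simp
  qed
qed

section \<open>Counting modes, and the spectral inequality of the cube\<close>

definition modes_below :: "real \<Rightarrow> real \<Rightarrow> ('a::euclidean_space \<Rightarrow> nat) set" where
  "modes_below S L = {m \<in> mode_indices. (pi / S)\<^sup>2 * (\<Sum>i\<in>Basis. (real (m i))\<^sup>2) < L}"

lemma modes_below_sum:
  assumes "S > 0" "L > 0" "m \<in> modes_below S L"
  shows "(\<Sum>i\<in>Basis. (real (m i))\<^sup>2) < (S * sqrt L / pi)\<^sup>2"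
  using assms by (auto simp: modes_below_def power_mult_distrib power_divide field_simps)

lemma finite_modes_below:
  assumes "S > 0" "L > 0"
  shows "finite (modes_below S L :: ('a::euclidean_space \<Rightarrow> nat) set)"
proof (rule finite_subset)
  let ?r = "S * sqrt L / pi"
  show "finite (Basis \<rightarrow>\<^sub>E {..nat \<lceil>?r\<rceil>} :: ('a \<Rightarrow> nat) set)"
    by (intro finite_PiE) auto
  show "modes_below S L \<subseteq> (Basis \<rightarrow>\<^sub>E {..nat \<lceil>?r\<rceil>} :: ('a \<Rightarrow> nat) set)"
  proof
    fix m :: "'a \<Rightarrow> nat" assume m: "m \<in> modes_below S L"
    have "m i \<le> nat \<lceil>?r\<rceil>" if i: "i \<in> Basis" for i
    proof -
      have "(real (m i))\<^sup>2 \<le> (\<Sum>i\<in>Basis. (real (m i))\<^sup>2)"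
        using i by (intro member_le_sum) auto
      also have "\<dots> < ?r\<^sup>2" using assms m by (rule modes_below_sum)
      finally have "real (m i) < ?r" using assms by (auto intro: power_less_imp_less_base)
      then show ?thesis by linarith
    qed
    then show "m \<in> Basis \<rightarrow>\<^sub>E {..nat \<lceil>?r\<rceil>}"
      using m by (auto simp: modes_below_def mode_indices_def PiE_iff)
  qed
qed

lemma norm_power2_eq_sum:
  fixes x :: "'a::euclidean_space"
  shows "(norm x)\<^sup>2 = (\<Sum>i\<in>Basis. (x \<bullet> i)\<^sup>2)"
  unfolding power2_norm_eq_inner euclidean_inner[of x x] by (simp add: power2_eq_square)

text \<open>
  The unit cells next to a lattice point \<open>m\<close> and its mirror images in the coordinate hyperplanes
  lie in the ball of radius \<open>S \<surd>L / \<pi>\<close>; there are \<open>2\<^sup>n\<close> of them for each \<open>m\<close>.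
\<close>

lemma card_modes_below:
  assumes S: "S > 0" "L > 0"
  shows "2 ^ DIM('a) * real (card (modes_below S L :: ('a::euclidean_space \<Rightarrow> nat) set))
    \<le> unit_ball_vol (real DIM('a)) * (S * sqrt L / pi) ^ DIM('a)"
proof -
  let ?M = "modes_below S L :: ('a \<Rightarrow> nat) set" and ?r = "S * sqrt L / pi"
  \<comment> \<open>The Boolean \<open>s i\<close> chooses the interval (m_i - 1, m_i) or its mirror
    image (-m_i, 1 - m_i): always the cell on the origin's side of the lattice point, which keeps it
    in the ball.\<close>
  define lo where "lo = (\<lambda>(s, m). \<Sum>i\<in>Basis. (if s i then real (m i) - 1 else - real (m i)) *\<^sub>R i :: 'a)"
  define hi where "hi = (\<lambda>(s, m). \<Sum>i\<in>Basis. (if s i then real (m i) else 1 - real (m i)) *\<^sub>R i :: 'a)"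
  let ?I = "(Basis \<rightarrow>\<^sub>E UNIV :: ('a \<Rightarrow> bool) set) \<times> ?M"
  have li: "lo (s, m) \<bullet> i = (if s i then real (m i) - 1 else - real (m i))"
       "hi (s, m) \<bullet> i = (if s i then real (m i) else 1 - real (m i))"
    if "i \<in> Basis" for s m i
    using that by (simp_all add: lo_def hi_def)
  have r0: "?r \<ge> 0" using S by simp
  have fin: "finite ?I" by (intro finite_cartesian_product finite_PiE finite_modes_below S) auto
  \<comment> \<open>A point of an open cell reveals the signs and, as its i-th absolute coordinate
    lies strictly between m_i - 1 and m_i, the index. This yields disjointness; the upper bound
    yields containment in the ball.\<close>
  have cell: "(if s i then x \<bullet> i > 0 else x \<bullet> i < 0) \<and> real (m i) - 1 < \<bar>x \<bullet> i\<bar> \<and> \<bar>x \<bullet> i\<bar> < real (m i)"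
    if "m \<in> ?M" "x \<in> box (lo (s, m)) (hi (s, m))" "i \<in> Basis" for s m x i
  proof -
    have "real (m i) \<ge> 1" using that mode_indices_ge_1[of m i] by (auto simp: modes_below_def)
    moreover have "lo (s, m) \<bullet> i < x \<bullet> i" "x \<bullet> i < hi (s, m) \<bullet> i" using that by (auto simp: mem_box)
    ultimately show ?thesis using li[OF that(3), of s m] by (auto split: if_splits)
  qed
  have disj: "disjoint_family_on (\<lambda>c. box (lo c) (hi c)) ?I"
    unfolding disjoint_family_on_def
  proof (intro ballI impI)
    fix c c' assume c: "c \<in> ?I" "c' \<in> ?I" "c \<noteq> c'"
    obtain s m s' m' where sm: "c = (s, m)" "c' = (s', m')" by (cases c, cases c')
    show "box (lo c) (hi c) \<inter> box (lo c') (hi c') = {}"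
    proof (rule ccontr)
      assume "box (lo c) (hi c) \<inter> box (lo c') (hi c') \<noteq> {}"
      then obtain x where x: "x \<in> box (lo (s, m)) (hi (s, m))" "x \<in> box (lo (s', m')) (hi (s', m'))"
        using sm by auto
      have m: "m \<in> ?M" "m' \<in> ?M" using c sm by auto
      have eq: "s i = s' i \<and> m i = m' i" if "i \<in> Basis" for i
        using cell[OF m(1) x(1) that] cell[OF m(2) x(2) that] by (auto split: if_splits)
      have P: "s \<in> Basis \<rightarrow>\<^sub>E UNIV" "s' \<in> Basis \<rightarrow>\<^sub>E UNIV" "m \<in> Basis \<rightarrow>\<^sub>E {1..}" "m' \<in> Basis \<rightarrow>\<^sub>E {1..}"
        using c sm m unfolding modes_below_def mode_indices_def by blast+
      have "s = s'" by (rule PiE_ext[OF P(1,2)]) (use eq in blast)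
      moreover have "m = m'" by (rule PiE_ext[OF P(3,4)]) (use eq in blast)
      ultimately show False using c sm by simp
    qed
  qed
  have sub: "(\<Union>c\<in>?I. box (lo c) (hi c)) \<subseteq> ball 0 ?r"
  proof (safe)
    fix s m x assume m: "m \<in> ?M" and x: "x \<in> box (lo (s, m)) (hi (s, m))"
    have "(norm x)\<^sup>2 = (\<Sum>i\<in>Basis. (x \<bullet> i)\<^sup>2)" by (rule norm_power2_eq_sum)
    also have "\<dots> \<le> (\<Sum>i\<in>Basis. (real (m i))\<^sup>2)"
    proof (rule sum_mono)
      fix i :: 'a assume i: "i \<in> Basis"
      have "\<bar>x \<bullet> i\<bar> \<le> real (m i)" using cell[OF m x i] by linarith
      then show "(x \<bullet> i)\<^sup>2 \<le> (real (m i))\<^sup>2" by (metis abs_le_square_iff abs_of_nat)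
    qed
    also have "\<dots> < ?r\<^sup>2" by (rule modes_below_sum[OF S m])
    finally have "norm x < ?r" using r0 by (rule power_less_imp_less_base)
    then show "x \<in> ball 0 ?r" by simp
  qed
  have "ennreal (2 ^ DIM('a) * real (card ?M)) = (\<Sum>c\<in>?I. emeasure lborel (box (lo c) (hi c)))"
  proof -
    have "emeasure lborel (box (lo c) (hi c)) = 1" for c
    proof -
      obtain s m where c: "c = (s, m)" by (cases c)
      have "emeasure lborel (box (lo c) (hi c)) = (\<Prod>i\<in>Basis. (hi c - lo c) \<bullet> i)"
        unfolding c by (rule emeasure_lborel_box) (simp add: li)
      also have "(\<Prod>i\<in>Basis. (hi c - lo c) \<bullet> i) = 1"
        unfolding c by (rule prod.neutral) (simp add: li inner_diff_left)
      finally show ?thesis by simp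
    qed
    moreover have "card ?I = 2 ^ DIM('a) * card ?M"
      by (simp add: card_cartesian_product card_PiE)
    ultimately show ?thesis by (simp add: ennreal_of_nat_eq_real_of_nat)
  qed
  also have "\<dots> = emeasure lborel (\<Union>c\<in>?I. box (lo c) (hi c))"
    by (rule sum_emeasure) (use fin disj in auto)
  also have "\<dots> \<le> emeasure lborel (ball (0::'a) ?r)"
    by (rule emeasure_mono[OF sub]) auto
  also have "\<dots> = ennreal (unit_ball_vol (real DIM('a)) * ?r ^ DIM('a))"
    using r0 by (simp add: emeasure_ball)
  finally show ?thesis using r0 by (subst (asm) ennreal_le_iff) auto
qed

text \<open>Formally, L times the squared norm of \<open>\<phi>\<close> minus the Dirichlet integral
  is a sum of L - \<mu>_m times squared normalised coefficients, and modes with \<mu>_m \<ge> L only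
  lower it. Two one-sided facts suffice: Bessel for the gradient, completeness for
  \<open>\<phi>\<close>. The sum over low modes stays because the functions to come have low
  coefficients that are small rather than zero.\<close>

lemma spectral_inequality:
  fixes \<phi> :: "'a::euclidean_space \<Rightarrow> real"
  assumes S: "S > 0" and L: "L > 0" and d: "\<And>x. GDERIV \<phi> x :> g x" and cg: "continuous_on UNIV g"
    and K: "compact K" "K \<subseteq> box 0 (S *\<^sub>R One)" "\<And>x. x \<notin> K \<Longrightarrow> \<phi> x = 0" "\<And>x. x \<notin> K \<Longrightarrow> g x = 0"
  shows "L * (\<integral>x. (\<phi> x)\<^sup>2 \<partial>lborel)
      - (\<Sum>m\<in>modes_below S L. (L - (pi / S)\<^sup>2 * (\<Sum>i\<in>Basis. (real (m i))\<^sup>2))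
           * (\<integral>x. \<phi> x * sine_mode (pi / S) m x \<partial>lborel)\<^sup>2) / (S / 2) ^ DIM('a)
    \<le> (\<integral>x. (norm (g x))\<^sup>2 \<partial>lborel)"
proof -
  define \<kappa> where "\<kappa> = pi / S"
  define \<nu> where "\<nu> = (S / 2) ^ DIM('a)"
  define \<mu> where "\<mu> m = \<kappa>\<^sup>2 * (\<Sum>i\<in>Basis. (real (m i))\<^sup>2)" for m :: "'a \<Rightarrow> nat"
  define c where "c m = (\<integral>x. \<phi> x * sine_mode \<kappa> m x \<partial>lborel) / \<nu>" for m
  let ?I = "modes_below S L :: ('a \<Rightarrow> nat) set"
  let ?Q = "cbox 0 (S *\<^sub>R One) :: 'a set"
  let ?M = "restrict_space lborel ?Q"
  have \<nu>: "\<nu> > 0" using S by (simp add: \<nu>_def)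
  have fI: "finite ?I" by (rule finite_modes_below[OF S L])
  have c\<phi>: "continuous_on UNIV \<phi>"
    using d by (rule GDERIV_continuous_on)
  have KQ: "K \<subseteq> ?Q" using K(2) box_subset_cbox by blast
  have iM: "integrable ?M F" if "continuous_on UNIV F" for F :: "'a \<Rightarrow> real"
    using borel_integrable_compact[of ?Q F] continuous_on_subset[OF that, of ?Q]
    by (subst integrable_restrict_space) auto
  have eqM: "(\<integral>x. F x \<partial>?M) = (\<integral>x. F x \<partial>lborel)" if "\<And>x. x \<notin> K \<Longrightarrow> F x = 0" for F :: "'a \<Rightarrow> real"
  proof -
    have "(\<lambda>x. indicator ?Q x *\<^sub>R F x) = F" using that KQ by (auto simp: fun_eq_iff indicator_def)
    then show ?thesis by (subst integral_restrict_space) auto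
  qed
  have eqQ: "(\<integral>x. F x \<partial>?M) = (\<integral>x. F x * indicator ?Q x \<partial>lborel)" for F :: "'a \<Rightarrow> real"
    by (subst integral_restrict_space) (auto simp: mult.commute)
  have cc: "continuous_on UNIV (sine_mode \<kappa> m)" "continuous_on UNIV (sine_mode_deriv \<kappa> b m)" for b m
    by (rule continuous_on_sine_mode continuous_on_sine_mode_deriv)+
  have coef: "(\<integral>x. \<phi> x * sine_mode \<kappa> m x \<partial>lborel) = \<nu> * c m" for m
    using \<nu> by (simp add: c_def)
  \<comment> \<open>Integration by parts makes \<open>c m\<close> also the Fourier coefficient of
    the component of \<open>g\<close> along \<open>b\<close> in the derivative system: inner product
    and squared norm acquire the same factor (\<kappa> m_b)^2. So this is Bessel's inequality for
    that component.\<close>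
  have A: "(\<Sum>m\<in>T. \<nu> * (\<kappa> * m b)\<^sup>2 * (c m)\<^sup>2) \<le> (\<integral>x. (g x \<bullet> b)\<^sup>2 \<partial>lborel)"
    if T: "finite T" "T \<subseteq> mode_indices" and b: "b \<in> Basis" for T b
  proof -
    have "0 \<le> (\<integral>x. (g x \<bullet> b - (\<Sum>m\<in>T. c m * sine_mode_deriv \<kappa> b m x))\<^sup>2 \<partial>?M)"
      by (rule integral_nonneg_AE) simp
    also have "\<dots> = (\<integral>x. (g x \<bullet> b) * (g x \<bullet> b) \<partial>?M)
        - 2 * (\<Sum>m\<in>T. c m * (\<integral>x. (g x \<bullet> b) * sine_mode_deriv \<kappa> b m x \<partial>?M))
        + (\<Sum>m\<in>T. ((\<kappa> * m b)\<^sup>2 * \<nu>) * (c m)\<^sup>2)"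
    proof (rule integral_square_diff_sum)
      fix m m' assume m: "m \<in> T" "m' \<in> T"
      then show "(\<integral>x. sine_mode_deriv \<kappa> b m x * sine_mode_deriv \<kappa> b m' x \<partial>?M) = (if m = m' then (\<kappa> * m b)\<^sup>2 * \<nu> else 0)"
        unfolding eqQ \<kappa>_def \<nu>_def using T b by (intro sine_mode_deriv_orthogonal S) auto
    qed (use T cg cc in \<open>auto intro!: iM continuous_intros\<close>)
    also have "(\<integral>x. (g x \<bullet> b) * (g x \<bullet> b) \<partial>?M) = (\<integral>x. (g x \<bullet> b)\<^sup>2 \<partial>lborel)"
      using K by (subst eqM) (auto simp: power2_eq_square)
    also have "(\<Sum>m\<in>T. c m * (\<integral>x. (g x \<bullet> b) * sine_mode_deriv \<kappa> b m x \<partial>?M)) = (\<Sum>m\<in>T. \<nu> * (\<kappa> * m b)\<^sup>2 * (c m)\<^sup>2)"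
    proof (intro sum.cong refl)
      fix m
      have "(\<integral>x. (g x \<bullet> b) * sine_mode_deriv \<kappa> b m x \<partial>?M) = (\<kappa> * m b)\<^sup>2 * (\<nu> * c m)"
        using K by (subst eqM) (auto simp: integral_by_parts_sine_mode[OF d cg K(1,3,4) b] coef)
      then show "c m * (\<integral>x. (g x \<bullet> b) * sine_mode_deriv \<kappa> b m x \<partial>?M) = \<nu> * (\<kappa> * m b)\<^sup>2 * (c m)\<^sup>2"
        by (simp add: power2_eq_square)
    qed
    also have "(\<Sum>m\<in>T. (\<kappa> * m b)\<^sup>2 * \<nu> * (c m)\<^sup>2) = (\<Sum>m\<in>T. \<nu> * (\<kappa> * m b)\<^sup>2 * (c m)\<^sup>2)"
      by (simp add: mult_ac)
    finally show ?thesis by simp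
  qed
  have A': "(\<Sum>m\<in>T. \<nu> * \<mu> m * (c m)\<^sup>2) \<le> (\<integral>x. (norm (g x))\<^sup>2 \<partial>lborel)"
    if T: "finite T" "T \<subseteq> mode_indices" for T
  proof -
    have "(\<Sum>m\<in>T. \<nu> * \<mu> m * (c m)\<^sup>2) = (\<Sum>b\<in>Basis. \<Sum>m\<in>T. \<nu> * (\<kappa> * m b)\<^sup>2 * (c m)\<^sup>2)"
      by (subst sum.swap) (simp add: \<mu>_def sum_distrib_left sum_distrib_right power_mult_distrib mult.assoc)
    also have "\<dots> \<le> (\<Sum>b\<in>Basis. \<integral>x. (g x \<bullet> b)\<^sup>2 \<partial>lborel)"
      by (intro sum_mono A T)
    also have "\<dots> = (\<integral>x. (\<Sum>b\<in>Basis. (g x \<bullet> b)\<^sup>2) \<partial>lborel)"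
      using K cg by (intro Bochner_Integration.integral_sum[symmetric] integrable_compact_support[of _ K])
        (auto intro!: continuous_intros)
    also have "(\<lambda>x. \<Sum>b\<in>Basis. (g x \<bullet> b)\<^sup>2) = (\<lambda>x. (norm (g x))\<^sup>2)"
      by (simp add: norm_power2_eq_sum)
    finally show ?thesis .
  qed
  define v where "v = measure ?M (space ?M)"
  have v: "v \<ge> 0" by (simp add: v_def)
  have fin: "finite_measure ?M"
    by (intro finite_measureI) (simp add: emeasure_restrict_space emeasure_lborel_cbox_eq)
  \<comment> \<open>Among combinations over \<open>T\<close> the Fourier sum is closest to
    \<open>\<phi>\<close> in mean square, so it is at least as good as the uniform approximant
    \<open>p\<close> and misses at most \<epsilon>^2 v. \<open>T\<close> is made to contain all low
    modes, so that the rest of it has eigenvalues at least \<open>L\<close> and can be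
    discarded.\<close>
  have B: "\<exists>T. finite T \<and> T \<subseteq> mode_indices \<and> ?I \<subseteq> T \<and>
      (\<integral>x. (\<phi> x)\<^sup>2 \<partial>lborel) \<le> (\<Sum>m\<in>T. \<nu> * (c m)\<^sup>2) + \<epsilon>\<^sup>2 * v" if e: "\<epsilon> > 0" for \<epsilon>
  proof -
    obtain p where p: "p \<in> sine_span \<kappa>" "\<And>x. x \<in> ?Q \<Longrightarrow> \<bar>\<phi> x - p x\<bar> \<le> \<epsilon>"
      using sine_span_dense[OF S c\<phi> K(1,2,3) e] unfolding \<kappa>_def by blast
    from p(1) obtain T0 a0 where T0: "finite T0" "T0 \<subseteq> mode_indices"
      and pe: "p = (\<lambda>x. \<Sum>m\<in>T0. a0 m * sine_mode \<kappa> m x)"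
      unfolding sine_span_def by auto
    define T where "T = T0 \<union> ?I"
    define a where "a m = (if m \<in> T0 then a0 m else 0)" for m
    have T: "finite T" "T \<subseteq> mode_indices" using T0 fI by (auto simp: T_def modes_below_def)
    have pe': "p x = (\<Sum>m\<in>T. a m * sine_mode \<kappa> m x)" for x
      unfolding pe a_def using T T0 by (intro sum.mono_neutral_cong_left) (auto simp: T_def)
    have "(\<integral>x. (\<phi> x - (\<Sum>m\<in>T. a m * sine_mode \<kappa> m x))\<^sup>2 \<partial>?M)
      = (\<integral>x. \<phi> x * \<phi> x \<partial>?M) - 2 * (\<Sum>m\<in>T. a m * (\<integral>x. \<phi> x * sine_mode \<kappa> m x \<partial>?M)) + (\<Sum>m\<in>T. \<nu> * (a m)\<^sup>2)"
    proof (rule integral_square_diff_sum)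
      fix m m' assume "m \<in> T" "m' \<in> T"
      then show "(\<integral>x. sine_mode \<kappa> m x * sine_mode \<kappa> m' x \<partial>?M) = (if m = m' then \<nu> else 0)"
        unfolding eqQ \<kappa>_def \<nu>_def using T by (intro sine_mode_orthogonal S) auto
    qed (use T c\<phi> cc in \<open>auto intro!: iM continuous_intros\<close>)
    also have "(\<integral>x. \<phi> x * \<phi> x \<partial>?M) = (\<integral>x. (\<phi> x)\<^sup>2 \<partial>lborel)"
      using K by (subst eqM) (auto simp: power2_eq_square)
    also have "(\<Sum>m\<in>T. a m * (\<integral>x. \<phi> x * sine_mode \<kappa> m x \<partial>?M)) = (\<Sum>m\<in>T. a m * (\<nu> * c m))"
      using K by (subst eqM) (auto simp: coef)
    finally have 1: "(\<integral>x. (\<phi> x - (\<Sum>m\<in>T. a m * sine_mode \<kappa> m x))\<^sup>2 \<partial>?M)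
      = (\<integral>x. (\<phi> x)\<^sup>2 \<partial>lborel) - 2 * (\<Sum>m\<in>T. a m * (\<nu> * c m)) + (\<Sum>m\<in>T. \<nu> * (a m)\<^sup>2)" .
    have "0 \<le> (\<Sum>m\<in>T. \<nu> * (a m - c m)\<^sup>2)" using \<nu> by (intro sum_nonneg) auto
    also have "\<dots> = (\<Sum>m\<in>T. \<nu> * (c m)\<^sup>2) - 2 * (\<Sum>m\<in>T. a m * (\<nu> * c m)) + (\<Sum>m\<in>T. \<nu> * (a m)\<^sup>2)"
      by (simp add: sum_distrib_left sum_subtractf[symmetric] sum.distrib[symmetric] power2_eq_square algebra_simps)
    finally have 2: "(\<integral>x. (\<phi> x)\<^sup>2 \<partial>lborel) \<le> (\<Sum>m\<in>T. \<nu> * (c m)\<^sup>2) + (\<integral>x. (\<phi> x - (\<Sum>m\<in>T. a m * sine_mode \<kappa> m x))\<^sup>2 \<partial>?M)"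
      unfolding 1 by simp
    have "(\<integral>x. (\<phi> x - (\<Sum>m\<in>T. a m * sine_mode \<kappa> m x))\<^sup>2 \<partial>?M) \<le> (\<integral>x. \<epsilon>\<^sup>2 \<partial>?M)"
    proof (rule integral_mono)
      fix x assume "x \<in> space ?M"
      then have "x \<in> ?Q" by (simp add: space_restrict_space)
      from p(2)[OF this] show "(\<phi> x - (\<Sum>m\<in>T. a m * sine_mode \<kappa> m x))\<^sup>2 \<le> \<epsilon>\<^sup>2"
        unfolding pe'[symmetric] using e by (intro abs_le_square_iff[THEN iffD1]) auto
    qed (use c\<phi> cc fin in \<open>auto intro!: iM continuous_intros finite_measure.integrable_const\<close>)
    also have "\<dots> = \<epsilon>\<^sup>2 * v" by (simp add: v_def mult.commute)
    finally show ?thesis using 2 T by (intro exI[of _ T]) (auto simp: T_def)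
  qed
  have "L * (\<integral>x. (\<phi> x)\<^sup>2 \<partial>lborel) - (\<Sum>m\<in>?I. (L - \<mu> m) * (\<nu> * (c m)\<^sup>2)) \<le> (\<integral>x. (norm (g x))\<^sup>2 \<partial>lborel)"
  proof (rule field_le_epsilon)
    fix e :: real assume e: "e > 0"
    \<comment> \<open>Solves \<epsilon>^2 (L v + 1) = e, which bounds the error L \<epsilon>^2 v by
      e; the summand 1 keeps the denominator positive.\<close>
    define \<epsilon> where "\<epsilon> = sqrt (e / (L * v + 1))"
    have Lv: "L * v \<ge> 0" using L v by simp
    then have pos: "\<epsilon> > 0" using e by (simp add: \<epsilon>_def)
    obtain T where T: "finite T" "T \<subseteq> mode_indices" "?I \<subseteq> T"
      and *: "(\<integral>x. (\<phi> x)\<^sup>2 \<partial>lborel) \<le> (\<Sum>m\<in>T. \<nu> * (c m)\<^sup>2) + \<epsilon>\<^sup>2 * v"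
      using B[OF pos] by blast
    have "\<epsilon>\<^sup>2 * (L * v + 1) = e" using e Lv by (simp add: \<epsilon>_def)
    then have small: "L * (\<epsilon>\<^sup>2 * v) \<le> e"
    proof -
      have "e = \<epsilon>\<^sup>2 + L * (\<epsilon>\<^sup>2 * v)"
        unfolding \<open>\<epsilon>\<^sup>2 * (L * v + 1) = e\<close>[symmetric] by (simp add: algebra_simps)
      then show ?thesis using zero_le_power2[of \<epsilon>] by linarith
    qed
    have "(\<Sum>m\<in>T. (L - \<mu> m) * (\<nu> * (c m)\<^sup>2)) \<le> (\<Sum>m\<in>?I. (L - \<mu> m) * (\<nu> * (c m)\<^sup>2))"
    proof -
      have "(\<Sum>m\<in>T - ?I. (L - \<mu> m) * (\<nu> * (c m)\<^sup>2)) \<le> 0"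
        using T \<nu> by (intro sum_nonpos mult_nonpos_nonneg) (auto simp: modes_below_def \<mu>_def \<kappa>_def not_less subset_eq)
      then show ?thesis using sum.subset_diff[OF T(3) T(1), of "\<lambda>m. (L - \<mu> m) * (\<nu> * (c m)\<^sup>2)"] by linarith
    qed
    moreover have "(\<Sum>m\<in>T. (L - \<mu> m) * (\<nu> * (c m)\<^sup>2)) = L * (\<Sum>m\<in>T. \<nu> * (c m)\<^sup>2) - (\<Sum>m\<in>T. \<nu> * \<mu> m * (c m)\<^sup>2)"
      by (simp add: sum_distrib_left sum_subtractf[symmetric] algebra_simps)
    moreover have "L * (\<integral>x. (\<phi> x)\<^sup>2 \<partial>lborel) \<le> L * (\<Sum>m\<in>T. \<nu> * (c m)\<^sup>2) + L * (\<epsilon>\<^sup>2 * v)"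
      using mult_left_mono[OF *, of L] L by (simp add: distrib_left)
    ultimately show "L * (\<integral>x. (\<phi> x)\<^sup>2 \<partial>lborel) - (\<Sum>m\<in>?I. (L - \<mu> m) * (\<nu> * (c m)\<^sup>2)) \<le> (\<integral>x. (norm (g x))\<^sup>2 \<partial>lborel) + e"
      using A'[OF T(1,2)] small by linarith
  qed
  moreover have "(\<Sum>m\<in>?I. (L - \<mu> m) * (\<nu> * (c m)\<^sup>2)) = (\<Sum>m\<in>?I. (L - \<mu> m) * (\<integral>x. \<phi> x * sine_mode \<kappa> m x \<partial>lborel)\<^sup>2) / \<nu>"
    unfolding coef sum_divide_distrib using \<nu> by (intro sum.cong refl) (simp add: power2_eq_square)
  ultimately show ?thesis by (simp add: \<mu>_def \<kappa>_def \<nu>_def)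
qed

section \<open>Eigenfunctions as trial functions\<close>

lemma L2_on_inner_integrable:
  assumes "L2_on \<Omega> f" "L2_on \<Omega> g"
  shows "integrable (lebesgue_on \<Omega>) (\<lambda>x. f x \<bullet> g x)"
proof (rule Bochner_Integration.integrable_bound)
  show "integrable (lebesgue_on \<Omega>) (\<lambda>x. (norm (f x))\<^sup>2 + (norm (g x))\<^sup>2)"
    using assms by (simp add: L2_on_def)
  show "(\<lambda>x. f x \<bullet> g x) \<in> borel_measurable (lebesgue_on \<Omega>)"
    using assms by (intro borel_measurable_inner) (simp_all add: L2_on_def)
  have "\<bar>a \<bullet> b\<bar> \<le> (norm a)\<^sup>2 + (norm b)\<^sup>2" for a b :: 'b
  proof -
    have "\<bar>a \<bullet> b\<bar> \<le> norm a * norm b" by (rule Cauchy_Schwarz_ineq2)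
    moreover have "2 * (norm a * norm b) \<le> (norm a)\<^sup>2 + (norm b)\<^sup>2"
      using sum_squares_bound[of "norm a" "norm b"] by simp
    moreover have "0 \<le> norm a * norm b" by simp
    ultimately show ?thesis by linarith
  qed
  then show "AE x in lebesgue_on \<Omega>. norm (f x \<bullet> g x) \<le> norm ((norm (f x))\<^sup>2 + (norm (g x))\<^sup>2)"
    by (intro AE_I2) simp
qed

lemma L2_on_scaleR: "L2_on \<Omega> f \<Longrightarrow> L2_on \<Omega> (\<lambda>x. c *\<^sub>R f x)"
  by (auto simp: L2_on_def power_mult_distrib)

lemma L2_on_add:
  assumes "L2_on \<Omega> f" "L2_on \<Omega> g"
  shows "L2_on \<Omega> (\<lambda>x. f x + g x)"
proof -
  have "(norm (f x + g x))\<^sup>2 = (norm (f x))\<^sup>2 + 2 * (f x \<bullet> g x) + (norm (g x))\<^sup>2" for x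
    by (simp add: power2_norm_eq_inner inner_add_left inner_add_right inner_commute)
  then show ?thesis
    using assms L2_on_inner_integrable[OF assms] by (auto simp: L2_on_def)
qed

lemma L2_on_diff:
  assumes "L2_on \<Omega> f" "L2_on \<Omega> g"
  shows "L2_on \<Omega> (\<lambda>x. f x - g x)"
  using L2_on_add[OF assms(1) L2_on_scaleR[OF assms(2), of "-1"]] by simp

lemma L2_on_sum:
  assumes "finite J" "\<And>j. j \<in> J \<Longrightarrow> L2_on \<Omega> (f j)"
  shows "L2_on \<Omega> (\<lambda>x. \<Sum>j\<in>J. f j x)"
  using assms
proof (induction J rule: finite_induct)
  case empty
  then show ?case by (simp add: L2_on_def)
next
  case (insert j J)
  then show ?case by (simp add: L2_on_add)
qed

lemma integral_inner_combination:
  fixes u :: "'i \<Rightarrow> 'a::euclidean_space \<Rightarrow> 'b::euclidean_space" and v :: "'j \<Rightarrow> 'a \<Rightarrow> 'b"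
  assumes "finite I" "finite J" "\<And>j. j \<in> I \<Longrightarrow> L2_on \<Omega> (u j)" "\<And>j. j \<in> J \<Longrightarrow> L2_on \<Omega> (v j)"
  shows "(\<integral>x. (\<Sum>i\<in>I. c i *\<^sub>R u i x) \<bullet> (\<Sum>j\<in>J. d j *\<^sub>R v j x) \<partial>lebesgue_on \<Omega>)
    = (\<Sum>i\<in>I. \<Sum>j\<in>J. c i * d j * (\<integral>x. u i x \<bullet> v j x \<partial>lebesgue_on \<Omega>))"
proof -
  have "(\<Sum>i\<in>I. c i *\<^sub>R u i x) \<bullet> (\<Sum>j\<in>J. d j *\<^sub>R v j x) = (\<Sum>i\<in>I. \<Sum>j\<in>J. c i * d j * (u i x \<bullet> v j x))" for x
    by (simp add: inner_sum_left inner_sum_right sum_distrib_left mult.assoc) (subst sum.swap, simp add: mult_ac)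
  then show ?thesis
    using assms by (simp add: L2_on_inner_integrable)
qed

lemma L2_on_Cauchy_Schwarz:
  fixes f g :: "'a::euclidean_space \<Rightarrow> 'b::euclidean_space"
  assumes f: "L2_on \<Omega> f" and g: "L2_on \<Omega> g"
  shows "(\<integral>x. f x \<bullet> g x \<partial>lebesgue_on \<Omega>)\<^sup>2
    \<le> (\<integral>x. (norm (f x))\<^sup>2 \<partial>lebesgue_on \<Omega>) * (\<integral>x. (norm (g x))\<^sup>2 \<partial>lebesgue_on \<Omega>)"
proof -
  define A B C where "A = (\<integral>x. (norm (f x))\<^sup>2 \<partial>lebesgue_on \<Omega>)"
    and "B = (\<integral>x. (norm (g x))\<^sup>2 \<partial>lebesgue_on \<Omega>)" and "C = (\<integral>x. f x \<bullet> g x \<partial>lebesgue_on \<Omega>)"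
  have q: "0 \<le> s\<^sup>2 * A + 2 * s * t * C + t\<^sup>2 * B" for s t
  proof -
    have "0 \<le> (\<integral>x. (norm (s *\<^sub>R f x + t *\<^sub>R g x))\<^sup>2 \<partial>lebesgue_on \<Omega>)"
      by (rule integral_nonneg_AE) simp
    also have "(\<lambda>x. (norm (s *\<^sub>R f x + t *\<^sub>R g x))\<^sup>2)
      = (\<lambda>x. s\<^sup>2 * (norm (f x))\<^sup>2 + 2 * s * t * (f x \<bullet> g x) + t\<^sup>2 * (norm (g x))\<^sup>2)"
      unfolding power2_norm_eq_inner
      by (simp add: fun_eq_iff inner_add_left inner_add_right inner_commute power2_eq_square algebra_simps)
    also have "(\<integral>x. s\<^sup>2 * (norm (f x))\<^sup>2 + 2 * s * t * (f x \<bullet> g x) + t\<^sup>2 * (norm (g x))\<^sup>2 \<partial>lebesgue_on \<Omega>)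
      = s\<^sup>2 * A + 2 * s * t * C + t\<^sup>2 * B"
      using f g L2_on_inner_integrable[OF f g] by (simp add: L2_on_def A_def B_def C_def)
    finally show ?thesis .
  qed
  have AB: "A \<ge> 0" "B \<ge> 0" by (auto simp: A_def B_def)
  \<comment> \<open>The vectors (B, -C) and (-C, A) turn the quadratic form into B and A times AB -
    C^2, so one positive factor suffices. If A = B = 0, the vectors (1, 1) and (1, -1) force C =
    0.\<close>
  have 1: "0 \<le> B * (A * B - C\<^sup>2)" using q[of B "- C"] by (simp add: power2_eq_square algebra_simps)
  have 2: "0 \<le> A * (A * B - C\<^sup>2)" using q[of "- C" A] by (simp add: power2_eq_square algebra_simps)
  have "C\<^sup>2 \<le> A * B"
  proof (cases "A = 0 \<and> B = 0")
    case True
    then show ?thesis using q[of 1 1] q[of 1 "-1"] by simp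
  next
    case False
    then have "A > 0 \<or> B > 0" using AB by auto
    then show ?thesis using 1 2 by (auto simp: zero_le_mult_iff)
  qed
  then show ?thesis by (simp add: A_def B_def C_def)
qed

text \<open>Cauchy-Schwarz. Only the product of the limits has to vanish, which covers an error term
  paired with another error term as well as one paired with a fixed function.\<close>

lemma L2_on_inner_tendsto_0:
  fixes X Y :: "nat \<Rightarrow> 'a::euclidean_space \<Rightarrow> 'b::euclidean_space"
  assumes "\<And>i. L2_on \<Omega> (X i)" "\<And>i. L2_on \<Omega> (Y i)"
    and "(\<lambda>i. \<integral>x. (norm (X i x))\<^sup>2 \<partial>lebesgue_on \<Omega>) \<longlonglongrightarrow> a"
    and "(\<lambda>i. \<integral>x. (norm (Y i x))\<^sup>2 \<partial>lebesgue_on \<Omega>) \<longlonglongrightarrow> b" and "a * b = 0"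
  shows "(\<lambda>i. \<integral>x. X i x \<bullet> Y i x \<partial>lebesgue_on \<Omega>) \<longlonglongrightarrow> 0"
proof -
  have "(\<lambda>i. (\<integral>x. (norm (X i x))\<^sup>2 \<partial>lebesgue_on \<Omega>) * (\<integral>x. (norm (Y i x))\<^sup>2 \<partial>lebesgue_on \<Omega>)) \<longlonglongrightarrow> 0"
    using tendsto_mult[OF assms(3,4)] assms(5) by simp
  then have "(\<lambda>i. (\<integral>x. X i x \<bullet> Y i x \<partial>lebesgue_on \<Omega>)\<^sup>2) \<longlonglongrightarrow> 0"
    by (rule tendsto_sandwich[OF _ _ tendsto_const, rotated 2])
      (auto intro!: always_eventually L2_on_Cauchy_Schwarz assms)
  then show ?thesis by (simp add: tendsto_null_power)
qed

lemma L2_on_inner_tendsto: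
  fixes X Y :: "nat \<Rightarrow> 'a::euclidean_space \<Rightarrow> 'b::euclidean_space"
  assumes L2: "\<And>i. L2_on \<Omega> (X i)" "\<And>i. L2_on \<Omega> (Y i)" "L2_on \<Omega> u" "L2_on \<Omega> v"
    and X: "(\<lambda>i. \<integral>x. (norm (X i x - u x))\<^sup>2 \<partial>lebesgue_on \<Omega>) \<longlonglongrightarrow> 0"
    and Y: "(\<lambda>i. \<integral>x. (norm (Y i x - v x))\<^sup>2 \<partial>lebesgue_on \<Omega>) \<longlonglongrightarrow> 0"
  shows "(\<lambda>i. \<integral>x. X i x \<bullet> Y i x \<partial>lebesgue_on \<Omega>) \<longlonglongrightarrow> (\<integral>x. u x \<bullet> v x \<partial>lebesgue_on \<Omega>)"
proof -
  have d: "L2_on \<Omega> (\<lambda>x. X i x - u x)" "L2_on \<Omega> (\<lambda>x. Y i x - v x)" for i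
    using L2 by (auto intro: L2_on_diff)
  have "(\<integral>x. X i x \<bullet> Y i x \<partial>lebesgue_on \<Omega>) = (\<integral>x. (X i x - u x) \<bullet> (Y i x - v x) \<partial>lebesgue_on \<Omega>)
      + (\<integral>x. (X i x - u x) \<bullet> v x \<partial>lebesgue_on \<Omega>) + (\<integral>x. u x \<bullet> (Y i x - v x) \<partial>lebesgue_on \<Omega>)
      + (\<integral>x. u x \<bullet> v x \<partial>lebesgue_on \<Omega>)" for i
  proof -
    have "(\<integral>x. X i x \<bullet> Y i x \<partial>lebesgue_on \<Omega>) = (\<integral>x. (X i x - u x) \<bullet> (Y i x - v x)
      + (X i x - u x) \<bullet> v x + u x \<bullet> (Y i x - v x) + u x \<bullet> v x \<partial>lebesgue_on \<Omega>)"
      by (simp add: inner_diff_left inner_diff_right)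
    then show ?thesis
      using L2_on_inner_integrable[OF d(1) d(2)] L2_on_inner_integrable[OF d(1) L2(4)]
        L2_on_inner_integrable[OF L2(3) d(2)] L2_on_inner_integrable[OF L2(3,4)]
      by (subst (asm) Bochner_Integration.integral_add; (subst (asm) Bochner_Integration.integral_add)?; (subst (asm) Bochner_Integration.integral_add)?; auto)
  qed
  moreover have "(\<lambda>i. \<integral>x. (X i x - u x) \<bullet> (Y i x - v x) \<partial>lebesgue_on \<Omega>) \<longlonglongrightarrow> 0"
    using d X Y by (rule L2_on_inner_tendsto_0) simp
  moreover have "(\<lambda>i. \<integral>x. (X i x - u x) \<bullet> v x \<partial>lebesgue_on \<Omega>) \<longlonglongrightarrow> 0"
    using d(1) L2(4) X tendsto_const by (rule L2_on_inner_tendsto_0) simp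
  moreover have "(\<lambda>i. \<integral>x. u x \<bullet> (Y i x - v x) \<partial>lebesgue_on \<Omega>) \<longlonglongrightarrow> 0"
    using L2(3) d(2) tendsto_const Y by (rule L2_on_inner_tendsto_0) simp
  ultimately show ?thesis
    using tendsto_add[OF tendsto_add[OF tendsto_add]] tendsto_const
    by (simp only:) (rule tendsto_eq_rhs[OF tendsto_add[OF tendsto_add[OF tendsto_add]]], auto)
qed

section \<open>Test functions, the weak equation and the first k eigenfunctions\<close>

lemma GDERIV_unique_vector:
  assumes "GDERIV f x :> D" "GDERIV f x :> D'"
  shows "D = D'"
proof -
  have "(\<lambda>h. h \<bullet> D) = (\<lambda>h. h \<bullet> D')"
    using assms unfolding gderiv_def by (rule has_derivative_unique)
  then show ?thesis by (simp add: fun_eq_iff vector_eq_ldot)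
qed

text \<open>Of the smoothness, continuous differentiability is kept. Off the support the function
  vanishes on an open set, so its gradient is zero there.\<close>

lemma test_functionE:
  assumes "\<phi> \<in> test_functions \<Omega>"
  obtains K where "compact K" "K \<subseteq> \<Omega>" "\<And>x. x \<notin> K \<Longrightarrow> \<phi> x = 0" "\<And>x. x \<notin> K \<Longrightarrow> gradient \<phi> x = 0"
    "\<And>x. GDERIV \<phi> x :> gradient \<phi> x" "continuous_on UNIV (gradient \<phi>)" "continuous_on UNIV \<phi>"
proof -
  define K where "K = closure {x. \<phi> x \<noteq> 0}"
  have C: "C_k 1 \<phi>" and K: "compact K" "K \<subseteq> \<Omega>" using assms by (auto simp: test_functions_def K_def)
  obtain g where g: "\<And>x. GDERIV \<phi> x :> g x" "\<And>i. i \<in> Basis \<Longrightarrow> continuous_on UNIV (\<lambda>x. g x \<bullet> i)"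
    using C by auto
  have eq: "gradient \<phi> = g"
    unfolding gradient_def fun_eq_iff using g(1) GDERIV_unique_vector by blast
  have 0: "\<phi> x = 0" if "x \<notin> K" for x using that closure_subset[of "{x. \<phi> x \<noteq> 0}"] unfolding K_def by auto
  have g0: "g x = 0" if "x \<notin> K" for x
  proof -
    have "((\<lambda>_. 0::real) has_derivative (\<lambda>_. 0)) (at x)" by simp
    then have "(\<phi> has_derivative (\<lambda>_. 0)) (at x)"
      by (rule has_derivative_transform_within_open[of _ _ _ _ "- K"]) (use that 0 K compact_imp_closed in auto)
    then have "GDERIV \<phi> x :> 0" by (simp add: gderiv_def)
    then show ?thesis using g(1) GDERIV_unique_vector by blast
  qed
  show thesis
  proof (rule that[of K])
    show "continuous_on UNIV (gradient \<phi>)"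
      unfolding eq by (subst continuous_on_componentwise) (use g(2) in blast)
    show "continuous_on UNIV \<phi>" using g(1) by (rule GDERIV_continuous_on)
  qed (use K 0 g0 g eq in auto)
qed

text \<open>Bridge from the integrals over \<open>lebesgue_on \<Omega>\<close> in the eigenvalue
  definitions to integrals over \<open>lborel\<close>, where isometries and sine modes are
  handled.\<close>

lemma integral_lebesgue_on_support:
  fixes F :: "'a::euclidean_space \<Rightarrow> real"
  assumes "\<Omega> \<in> sets lebesgue" "continuous_on UNIV F" "\<And>x. x \<notin> \<Omega> \<Longrightarrow> F x = 0"
  shows "(\<integral>x. F x \<partial>lebesgue_on \<Omega>) = (\<integral>x. F x \<partial>lborel)"
    and "integrable (lebesgue_on \<Omega>) F \<longleftrightarrow> integrable lborel F"
proof -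
  have F: "F \<in> borel_measurable lborel" using assms(2) by (simp add: borel_measurable_continuous_onI)
  have "(\<lambda>x. indicator \<Omega> x *\<^sub>R F x) = F" using assms(3) by (auto simp: fun_eq_iff indicator_def)
  then show "(\<integral>x. F x \<partial>lebesgue_on \<Omega>) = (\<integral>x. F x \<partial>lborel)"
    and "integrable (lebesgue_on \<Omega>) F \<longleftrightarrow> integrable lborel F"
    using assms(1) integral_completion[OF F] integrable_completion[OF F]
    by (auto simp: integral_restrict_space integrable_restrict_space)
qed

lemma L2_on_continuous_support:
  fixes f :: "'a::euclidean_space \<Rightarrow> 'b::euclidean_space"
  assumes \<Omega>: "\<Omega> \<in> sets lebesgue" and f: "continuous_on UNIV f" and K: "compact K" "K \<subseteq> \<Omega>" "\<And>x. x \<notin> K \<Longrightarrow> f x = 0"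
  shows "L2_on \<Omega> f"
  unfolding L2_on_def
proof
  show "f \<in> borel_measurable (lebesgue_on \<Omega>)"
    using continuous_on_subset[OF f] \<Omega> by (intro continuous_imp_measurable_on_sets_lebesgue) auto
  have c: "continuous_on UNIV (\<lambda>x. (norm (f x))\<^sup>2)" by (intro continuous_intros f)
  then have "integrable lborel (\<lambda>x. (norm (f x))\<^sup>2)"
    using K by (intro integrable_compact_support[of _ K]) auto
  then show "integrable (lebesgue_on \<Omega>) (\<lambda>x. (norm (f x))\<^sup>2)"
    using K by (subst integral_lebesgue_on_support(2)[OF \<Omega> c]) auto
qed

lemma test_function_L2_on:
  assumes "\<Omega> \<in> sets lebesgue" "\<phi> \<in> test_functions \<Omega>"
  shows "L2_on \<Omega> \<phi>" "L2_on \<Omega> (gradient \<phi>)"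
  using assms(2) by (auto elim!: test_functionE intro: L2_on_continuous_support[OF assms(1)])

lemma H10_gradientE:
  assumes "H10_gradient \<Omega> u g" "\<Omega> \<in> sets lebesgue"
  obtains \<phi> where "\<And>j::nat. \<phi> j \<in> test_functions \<Omega>"
    "\<And>j. L2_on \<Omega> (\<phi> j)" "\<And>j. L2_on \<Omega> (gradient (\<phi> j))"
    "(\<lambda>j. \<integral>x. (norm (\<phi> j x - u x))\<^sup>2 \<partial>lebesgue_on \<Omega>) \<longlonglongrightarrow> 0"
    "(\<lambda>j. \<integral>x. (norm (gradient (\<phi> j) x - g x))\<^sup>2 \<partial>lebesgue_on \<Omega>) \<longlonglongrightarrow> 0"
proof -
  obtain \<phi> where \<phi>: "\<And>j::nat. \<phi> j \<in> test_functions \<Omega>"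
    "(\<lambda>j. \<integral>x. (\<phi> j x - u x)\<^sup>2 \<partial>lebesgue_on \<Omega>) \<longlonglongrightarrow> 0"
    "(\<lambda>j. \<integral>x. (norm (gradient (\<phi> j) x - g x))\<^sup>2 \<partial>lebesgue_on \<Omega>) \<longlonglongrightarrow> 0"
    using assms(1) unfolding H10_gradient_def by blast
  show thesis
    by (rule that[of \<phi>]) (use \<phi> test_function_L2_on[OF assms(2)] in simp_all)
qed

text \<open>Both sides are continuous in the H^1 norm, so the weak equation passes from test
  functions to their limits, in particular to other eigenfunctions.\<close>

lemma dirichlet_weak_form:
  assumes \<Omega>: "\<Omega> \<in> sets lebesgue" and g: "L2_on \<Omega> u" "L2_on \<Omega> g"
    and weak: "\<And>\<phi>. \<phi> \<in> test_functions \<Omega> \<Longrightarrow>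
      (\<integral>x. g x \<bullet> gradient \<phi> x \<partial>lebesgue_on \<Omega>) = \<mu> * (\<integral>x. u x * \<phi> x \<partial>lebesgue_on \<Omega>)"
    and v: "H10_gradient \<Omega> v h"
  shows "(\<integral>x. g x \<bullet> h x \<partial>lebesgue_on \<Omega>) = \<mu> * (\<integral>x. u x * v x \<partial>lebesgue_on \<Omega>)"
proof -
  obtain \<phi> where \<phi>: "\<And>j::nat. \<phi> j \<in> test_functions \<Omega>"
    "\<And>j. L2_on \<Omega> (\<phi> j)" "\<And>j. L2_on \<Omega> (gradient (\<phi> j))"
    "(\<lambda>j. \<integral>x. (norm (\<phi> j x - v x))\<^sup>2 \<partial>lebesgue_on \<Omega>) \<longlonglongrightarrow> 0"
    "(\<lambda>j. \<integral>x. (norm (gradient (\<phi> j) x - h x))\<^sup>2 \<partial>lebesgue_on \<Omega>) \<longlonglongrightarrow> 0"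
    using H10_gradientE[OF v \<Omega>] by blast
  have vh: "L2_on \<Omega> v" "L2_on \<Omega> h" using v by (auto simp: H10_gradient_def)
  have "(\<lambda>j. \<integral>x. g x \<bullet> gradient (\<phi> j) x \<partial>lebesgue_on \<Omega>) \<longlonglongrightarrow> (\<integral>x. g x \<bullet> h x \<partial>lebesgue_on \<Omega>)"
    by (rule L2_on_inner_tendsto) (use g \<phi> vh in simp_all)
  moreover have "(\<lambda>j. \<integral>x. u x \<bullet> \<phi> j x \<partial>lebesgue_on \<Omega>) \<longlonglongrightarrow> (\<integral>x. u x \<bullet> v x \<partial>lebesgue_on \<Omega>)"
    by (rule L2_on_inner_tendsto) (use g \<phi> vh in simp_all)
  then have "(\<lambda>j. \<mu> * (\<integral>x. u x * \<phi> j x \<partial>lebesgue_on \<Omega>)) \<longlonglongrightarrow> \<mu> * (\<integral>x. u x * v x \<partial>lebesgue_on \<Omega>)"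
    by (intro tendsto_intros) (simp add: inner_real_def)
  ultimately show ?thesis
    unfolding weak[OF \<phi>(1)] using LIMSEQ_unique by blast
qed

text \<open>The functions are basis elements of eigenspaces and need not be orthonormal. The
  Rayleigh bound is therefore an inequality between two Gram forms, and linear independence is
  definiteness of the second one.\<close>

lemma dirichlet_trial_functions:
  fixes \<Omega> :: "'a::euclidean_space set" and k :: nat
  assumes \<Omega>: "\<Omega> \<in> sets lebesgue" and ev: "dirichlet_eigenvalues \<Omega> ev"
  defines "J \<equiv> {1..k}"
  obtains u g where "\<And>j. j \<in> J \<Longrightarrow> H10_gradient \<Omega> (u j) (g j)"
    "\<And>c. (\<Sum>i\<in>J. \<Sum>j\<in>J. c i * c j * (\<integral>x. g i x \<bullet> g j x \<partial>lebesgue_on \<Omega>))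
       \<le> ev k * (\<Sum>i\<in>J. \<Sum>j\<in>J. c i * c j * (\<integral>x. u i x * u j x \<partial>lebesgue_on \<Omega>))"
    "\<And>c j. (\<Sum>i\<in>J. \<Sum>j\<in>J. c i * c j * (\<integral>x. u i x * u j x \<partial>lebesgue_on \<Omega>)) \<le> 0 \<Longrightarrow> j \<in> J \<Longrightarrow> c j = 0"
proof -
  define E where "E \<mu> = {j. j \<ge> 1 \<and> ev j = \<mu>}" for \<mu>
  have fE: "finite (E \<mu>)" and mult: "dirichlet_multiplicity \<Omega> \<mu> (card (E \<mu>))" for \<mu>
    using ev by (auto simp: dirichlet_eigenvalues_def E_def)
  have mono: "ev i \<le> ev k" if "i \<in> J" for i
    using ev that by (auto simp: dirichlet_eigenvalues_def J_def mono_on_def)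
  have fJ: "finite J" by (simp add: J_def)
  have JE: "j \<in> E (ev j)" if "j \<in> J" for j using that by (simp add: E_def J_def)
  obtain w where w: "\<And>\<mu> i. i < card (E \<mu>) \<Longrightarrow> w \<mu> i \<in> dirichlet_eigenspace \<Omega> \<mu>"
    and indep: "\<And>\<mu> c. (AE x in lebesgue_on \<Omega>. (\<Sum>i<card (E \<mu>). c i * w \<mu> i x) = 0) \<Longrightarrow> \<forall>i<card (E \<mu>). c i = 0"
    using mult unfolding dirichlet_multiplicity_def by metis
  have "\<exists>h. bij_betw h (E \<mu>) {..<card (E \<mu>)}" for \<mu>
    using ex_bij_betw_finite_nat[OF fE] by (simp add: atLeast0LessThan)
  then obtain h where h: "\<And>\<mu>. bij_betw (h \<mu>) (E \<mu>) {..<card (E \<mu>)}" by metis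
  \<comment> \<open>The bijection \<open>h\<close> numbers the indices that share an eigenvalue, so
    that they receive different basis elements of the common eigenspace.\<close>
  define u where "u j = w (ev j) (h (ev j) j)" for j
  have u: "u j \<in> dirichlet_eigenspace \<Omega> (ev j)" if "j \<in> J" for j
    unfolding u_def using h[of "ev j"] JE[OF that] by (intro w) (auto simp: bij_betw_def)
  then obtain g where g: "\<And>j. j \<in> J \<Longrightarrow> H10_gradient \<Omega> (u j) (g j)"
    "\<And>j \<phi>. j \<in> J \<Longrightarrow> \<phi> \<in> test_functions \<Omega> \<Longrightarrow>
      (\<integral>x. g j x \<bullet> gradient \<phi> x \<partial>lebesgue_on \<Omega>) = ev j * (\<integral>x. u j x * \<phi> x \<partial>lebesgue_on \<Omega>)"
    unfolding dirichlet_eigenspace_def mem_Collect_eq by metis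
  have L2: "L2_on \<Omega> (u j)" "L2_on \<Omega> (g j)" if "j \<in> J" for j
    using g(1)[OF that] by (auto simp: H10_gradient_def)
  define U where "U i j = (\<integral>x. u i x * u j x \<partial>lebesgue_on \<Omega>)" for i j
  have G: "(\<integral>x. g i x \<bullet> g j x \<partial>lebesgue_on \<Omega>) = ev i * U i j" if "i \<in> J" "j \<in> J" for i j
    unfolding U_def
    by (rule dirichlet_weak_form[OF \<Omega> L2(1)[OF that(1)] L2(2)[OF that(1)] g(2)[OF that(1)] g(1)[OF that(2)]])
  \<comment> \<open>Each eigenfunction serves as trial function in the other's equation; the
    symmetric Dirichlet integral is then evaluated with both eigenvalues.\<close>
  have orth: "U i j = 0" if "i \<in> J" "j \<in> J" "ev i \<noteq> ev j" for i j
  proof -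
    have "ev i * U i j = ev j * U j i"
      using G[OF that(1,2)] G[OF that(2,1)] by (simp add: inner_commute)
    moreover have "U j i = U i j" by (simp add: U_def mult.commute)
    ultimately show ?thesis using that by auto
  qed
  have gram: "(\<integral>x. (\<Sum>i\<in>I. c i * u i x) * (\<Sum>j\<in>I'. d j * u j x) \<partial>lebesgue_on \<Omega>) = (\<Sum>i\<in>I. \<Sum>j\<in>I'. c i * d j * U i j)"
    if "I \<subseteq> J" "I' \<subseteq> J" for I I' c d
    using integral_inner_combination[of I I' \<Omega> u u c d] that L2 finite_subset[OF _ fJ]
    by (auto simp: U_def inner_real_def subset_eq)
  have nn: "0 \<le> (\<Sum>i\<in>J. \<Sum>j\<in>J. d i * d j * U i j)" for d
    unfolding gram[OF subset_refl subset_refl, symmetric] by (rule integral_nonneg_AE) simp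
  show thesis
  proof (rule that[of u g])
    fix c :: "nat \<Rightarrow> real"
    \<comment> \<open>\<open>U\<close> couples only indices of equal eigenvalue, where the two
      square roots multiply to ev k - ev i. The weighted form is thus the Gram form at
      \<open>d\<close>, hence nonnegative.\<close>
    define d where "d i = c i * sqrt (ev k - ev i)" for i
    have "c i * c j * (ev k - ev i) * U i j = d i * d j * U i j" if "i \<in> J" "j \<in> J" for i j
    proof (cases "ev i = ev j")
      case True
      then show ?thesis using mono[OF that(2)] by (simp add: d_def)
    qed (simp add: orth that)
    then have "(\<Sum>i\<in>J. \<Sum>j\<in>J. c i * c j * (ev k - ev i) * U i j) = (\<Sum>i\<in>J. \<Sum>j\<in>J. d i * d j * U i j)"
      by (intro sum.cong refl) blast
    then have "(\<Sum>i\<in>J. \<Sum>j\<in>J. c i * c j * (ev k - ev i) * U i j) \<ge> 0"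
      using nn[of d] by linarith
    moreover have "(\<Sum>i\<in>J. \<Sum>j\<in>J. c i * c j * (ev k - ev i) * U i j)
      = ev k * (\<Sum>i\<in>J. \<Sum>j\<in>J. c i * c j * U i j) - (\<Sum>i\<in>J. \<Sum>j\<in>J. c i * c j * (ev i * U i j))"
      by (simp add: sum_distrib_left sum_subtractf[symmetric] algebra_simps)
    ultimately show "(\<Sum>i\<in>J. \<Sum>j\<in>J. c i * c j * (\<integral>x. g i x \<bullet> g j x \<partial>lebesgue_on \<Omega>))
       \<le> ev k * (\<Sum>i\<in>J. \<Sum>j\<in>J. c i * c j * (\<integral>x. u i x * u j x \<partial>lebesgue_on \<Omega>))"
      unfolding U_def[symmetric] by (simp add: G)
  next
    fix c :: "nat \<Rightarrow> real" and j
    assume "(\<Sum>i\<in>J. \<Sum>j\<in>J. c i * c j * (\<integral>x. u i x * u j x \<partial>lebesgue_on \<Omega>)) \<le> 0" and j: "j \<in> J"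
    then have le0: "(\<Sum>i\<in>J. \<Sum>j\<in>J. c i * c j * U i j) \<le> 0" by (simp add: U_def)
    define \<mu> where "\<mu> = ev j"
    define I where "I = {i \<in> J. ev i = \<mu>}"
    have IJ: "I \<subseteq> J" by (auto simp: I_def)
    \<comment> \<open>If the full combination \<open>f\<close> vanishes almost everywhere, so does
      its part \<open>f\<mu>\<close> from one eigenvalue: by orthogonality the integral of the
      square of \<open>f\<mu>\<close> equals that of the product with \<open>f\<close>.\<close>
    define f where "f x = (\<Sum>i\<in>J. c i * u i x)" for x
    define f\<mu> where "f\<mu> x = (\<Sum>i\<in>I. c i * u i x)" for x
    have L2c: "L2_on \<Omega> (\<lambda>x. \<Sum>i\<in>I'. c i * u i x)" if "I' \<subseteq> J" for I'
      using that L2(1) finite_subset[OF that fJ] L2_on_scaleR[of \<Omega> "u _" "c _"]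
      by (intro L2_on_sum) auto
    have sq0: "AE x in lebesgue_on \<Omega>. q x = 0"
      if q: "L2_on \<Omega> q" "(\<integral>x. q x * q x \<partial>lebesgue_on \<Omega>) \<le> 0" for q :: "'a \<Rightarrow> real"
    proof -
      have i: "integrable (lebesgue_on \<Omega>) (\<lambda>x. q x * q x)"
        using L2_on_inner_integrable[OF q(1) q(1)] by (simp add: inner_real_def)
      have "(\<integral>x. q x * q x \<partial>lebesgue_on \<Omega>) = 0"
        by (intro antisym q(2) integral_nonneg_AE AE_I2 zero_le_square)
      then have "AE x in lebesgue_on \<Omega>. q x * q x = 0"
        using integral_nonneg_eq_0_iff_AE[OF i] by simp
      then show ?thesis by simp
    qed
    have f0: "AE x in lebesgue_on \<Omega>. f x = 0"
      using le0 L2c[of J] unfolding f_def gram[OF subset_refl subset_refl, symmetric] by (intro sq0) auto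
    have "(\<integral>x. f\<mu> x * f\<mu> x \<partial>lebesgue_on \<Omega>) = (\<Sum>i\<in>I. \<Sum>j\<in>I. c i * c j * U i j)"
      unfolding f\<mu>_def by (rule gram[OF IJ IJ])
    also have "\<dots> = (\<Sum>i\<in>I. \<Sum>j\<in>J. c i * c j * U i j)"
    proof (rule sum.cong[OF refl], rule sum.mono_neutral_left[OF fJ IJ], rule ballI)
      fix i j assume "i \<in> I" "j \<in> J - I"
      then have "U i j = 0" by (intro orth) (auto simp: I_def)
      then show "c i * c j * U i j = 0" by simp
    qed
    also have "\<dots> = (\<integral>x. f\<mu> x * f x \<partial>lebesgue_on \<Omega>)"
      unfolding f\<mu>_def f_def by (rule gram[OF IJ subset_refl, symmetric])
    also have "\<dots> = (\<integral>x. 0 \<partial>lebesgue_on \<Omega>)"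
    proof (rule integral_cong_AE)
      show "(\<lambda>x. f\<mu> x * f x) \<in> borel_measurable (lebesgue_on \<Omega>)"
        using L2c[OF IJ] L2c[OF subset_refl] unfolding f_def f\<mu>_def
        by (intro borel_measurable_times) (auto simp: L2_on_def)
      show "AE x in lebesgue_on \<Omega>. f\<mu> x * f x = 0" using f0 by eventually_elim simp
    qed simp
    finally have "(\<integral>x. f\<mu> x * f\<mu> x \<partial>lebesgue_on \<Omega>) = 0" by simp
    then have f\<mu>0: "AE x in lebesgue_on \<Omega>. f\<mu> x = 0"
      using L2c[OF IJ] unfolding f\<mu>_def by (intro sq0) auto
    \<comment> \<open>The coefficients in the numbering of the whole eigenbasis. The default 0 is
      for basis elements whose index exceeds \<open>k\<close>, when the cut at \<open>k\<close>
      falls inside an eigenspace.\<close>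
    define c' where "c' i = (let l = inv_into (E \<mu>) (h \<mu>) i in if l \<in> J then c l else 0)" for i
    have "(\<Sum>i<card (E \<mu>). c' i * w \<mu> i x) = f\<mu> x" for x
    proof -
      have "(\<Sum>i<card (E \<mu>). c' i * w \<mu> i x) = (\<Sum>l\<in>E \<mu>. c' (h \<mu> l) * w \<mu> (h \<mu> l) x)"
        by (rule sum.reindex_bij_betw[OF h, symmetric])
      also have "\<dots> = (\<Sum>l\<in>E \<mu>. (if l \<in> J then c l else 0) * u l x)"
      proof (intro sum.cong refl)
        fix l assume l: "l \<in> E \<mu>"
        then have "inv_into (E \<mu>) (h \<mu>) (h \<mu> l) = l" using h[of \<mu>] by (auto simp: bij_betw_def)
        then show "c' (h \<mu> l) * w \<mu> (h \<mu> l) x = (if l \<in> J then c l else 0) * u l x"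
          using l by (simp add: c'_def u_def E_def)
      qed
      also have "\<dots> = f\<mu> x"
        unfolding f\<mu>_def using fE[of \<mu>]
        by (intro sum.mono_neutral_cong_right) (auto simp: I_def E_def J_def)
      finally show ?thesis .
    qed
    then have "\<forall>i<card (E \<mu>). c' i = 0" using f\<mu>0 by (intro indep) simp
    moreover have "j \<in> E \<mu>" using JE[OF j] by (simp add: \<mu>_def)
    ultimately have "c' (h \<mu> j) = 0" "inv_into (E \<mu>) (h \<mu>) (h \<mu> j) = j"
      using h[of \<mu>] by (auto simp: bij_betw_def)
    then show "c j = 0" using j by (simp add: c'_def)
  qed (rule g)
qed

section \<open>Transplantation to the copies\<close>

lemma homogeneous_system_nontrivial:
  fixes A :: "'j \<Rightarrow> 'i \<Rightarrow> real"
  assumes "finite J" "finite I" "card J < card I"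
  shows "\<exists>c. (\<exists>i\<in>I. c i \<noteq> 0) \<and> (\<forall>j\<in>J. (\<Sum>i\<in>I. c i * A j i) = 0)"
  using assms
proof (induction J arbitrary: A I rule: finite_induct)
  case empty
  then have "I \<noteq> {}" by auto
  then show ?case by (intro exI[of _ "\<lambda>_. 1"]) auto
next
  case (insert j J)
  show ?case
  proof (cases "\<forall>i\<in>I. A j i = 0")
    case True
    obtain c where "\<exists>i\<in>I. c i \<noteq> 0" "\<forall>j\<in>J. (\<Sum>i\<in>I. c i * A j i) = 0"
      using insert.IH[of I A] insert.prems insert.hyps by auto
    then show ?thesis using True by (intro exI[of _ c]) auto
  next
    case False
    \<comment> \<open>Gaussian elimination: equation \<open>j\<close> is used to remove the unknown
      at \<open>p\<close>, and \<open>t\<close> is the value of that unknown recovered by back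
      substitution.\<close>
    then obtain p where p: "p \<in> I" "A j p \<noteq> 0" by auto
    let ?I = "I - {p}"
    let ?A = "\<lambda>j' i. A j' i - A j i / A j p * A j' p"
    obtain c where c: "\<exists>i\<in>?I. c i \<noteq> 0" "\<forall>j'\<in>J. (\<Sum>i\<in>?I. c i * ?A j' i) = 0"
    proof -
      have "card J < card ?I" using insert.prems insert.hyps p by simp
      then show ?thesis using insert.IH[of ?I ?A] insert.prems that by blast
    qed
    define t where "t = - (\<Sum>i\<in>?I. c i * (A j i / A j p))"
    have *: "(\<Sum>i\<in>I. (c(p := t)) i * A j' i) = (\<Sum>i\<in>?I. c i * ?A j' i)" for j'
    proof -
      have "(\<Sum>i\<in>I. (c(p := t)) i * A j' i) = t * A j' p + (\<Sum>i\<in>?I. c i * A j' i)"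
        using insert.prems p by (subst sum.remove[of I p]) (auto intro!: sum.cong)
      then show ?thesis
        by (simp add: t_def algebra_simps sum_subtractf sum_distrib_left)
    qed
    have "(\<Sum>i\<in>?I. c i * ?A j i) = 0" using p by (simp add: field_simps)
    then have "\<forall>j'\<in>insert j J. (\<Sum>i\<in>I. (c(p := t)) i * A j' i) = 0"
      unfolding * using c by auto
    moreover have "\<exists>i\<in>I. (c(p := t)) i \<noteq> 0" using c by auto
    ultimately show ?thesis by blast
  qed
qed

text \<open>\<open>f w - f 0\<close> is the linear part of \<open>f\<close> at \<open>w\<close>. The
  derivative of the inverse is the orthogonal map \<open>T\<close> inverse to that linear part, so
  its adjoint is the linear part itself.\<close>

lemma isometry_GDERIV:
  fixes f :: "'a::euclidean_space \<Rightarrow> 'a"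
  assumes f: "\<And>x y. dist (f x) (f y) = dist x y" and \<phi>: "GDERIV \<phi> (inv f x) :> w"
  shows "GDERIV (\<lambda>x. \<phi> (inv f x)) x :> f w - f 0"
proof -
  let ?h = "inv f" and ?R = "\<lambda>v. f v - f 0"
  define T where "T = (\<lambda>v. ?h v - ?h 0)"
  have R: "orthogonal_transformation ?R" by (rule isometry_orthogonal[OF f])
  have T: "orthogonal_transformation T" unfolding T_def by (rule isometry_orthogonal[OF isometry_inv[OF f]])
  have fh: "f (?h v) = v" for v using isometry_bij[OF f] by (simp add: bij_is_surj surj_f_inv_f)
  have RT: "?R (T d) = d" for d
  proof -
    have "?R (T d) = ?R (?h d) - ?R (?h 0)"
      unfolding T_def using linear_diff[OF orthogonal_transformation_linear[OF R]] by blast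
    then show ?thesis by (simp add: fh)
  qed
  have adj: "T d \<bullet> w = d \<bullet> ?R w" for d
    using R RT[of d] unfolding orthogonal_transformation_def by metis
  have "bounded_linear T"
    using orthogonal_transformation_linear[OF T] by (rule linear_conv_bounded_linear[THEN iffD1])
  then have "((\<lambda>v. T v + ?h 0) has_derivative T) (at x)"
    by (auto intro!: derivative_eq_intros bounded_linear_imp_has_derivative)
  moreover have "(\<lambda>v. T v + ?h 0) = ?h" by (simp add: T_def)
  ultimately have "(?h has_derivative T) (at x)" by simp
  from has_derivative_compose[OF this \<phi>[unfolded gderiv_def]]
  show ?thesis unfolding gderiv_def adj .
qed

lemma GDERIV_sum:
  assumes "\<And>i. i \<in> I \<Longrightarrow> GDERIV (f i) x :> g i"
  shows "GDERIV (\<lambda>x. \<Sum>i\<in>I. f i x) x :> (\<Sum>i\<in>I. g i)"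
  using assms unfolding gderiv_def inner_sum_right by (intro has_derivative_sum) auto

lemma GDERIV_scaleR_const: "GDERIV f x :> g \<Longrightarrow> GDERIV (\<lambda>x. c *\<^sub>R f x) x :> c *\<^sub>R g"
  unfolding gderiv_def using has_derivative_scaleR_right[of f "\<lambda>h. h \<bullet> g" "at x" c] by simp

lemma L2_on_bounded_continuous:
  fixes h :: "'a::euclidean_space \<Rightarrow> real"
  assumes \<Omega>: "\<Omega> \<in> lmeasurable" and h: "continuous_on UNIV h" "\<And>x. \<bar>h x\<bar> \<le> 1"
  shows "L2_on \<Omega> h"
  unfolding L2_on_def
proof
  have S: "\<Omega> \<in> sets lebesgue" using \<Omega> by (rule fmeasurableD)
  show m: "h \<in> borel_measurable (lebesgue_on \<Omega>)"
    using continuous_on_subset[OF h(1)] S by (intro continuous_imp_measurable_on_sets_lebesgue) auto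
  have fin: "finite_measure (lebesgue_on \<Omega>)" using \<Omega> by (rule finite_measure_lebesgue_on)
  show "integrable (lebesgue_on \<Omega>) (\<lambda>x. (norm (h x))\<^sup>2)"
  proof (rule Bochner_Integration.integrable_bound)
    show "integrable (lebesgue_on \<Omega>) (\<lambda>_. 1 :: real)" using fin by (rule finite_measure.integrable_const)
    show "(\<lambda>x. (norm (h x))\<^sup>2) \<in> borel_measurable (lebesgue_on \<Omega>)" using m by simp
    have "(h x)\<^sup>2 \<le> 1" for x using abs_square_le_1[of "h x"] h(2)[of x] by simp
    then show "AE x in lebesgue_on \<Omega>. norm ((norm (h x))\<^sup>2) \<le> norm (1::real)" by simp
  qed
qed

lemma abs_sine_mode_le_1: "\<bar>sine_mode \<kappa> m x\<bar> \<le> 1"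
  unfolding sine_mode_def abs_prod by (intro prod_le_1) auto

text \<open>Used pointwise: at each point at most one copy contributes, so no cross terms
  arise.\<close>

lemma norm_sum_disjoint_supports:
  fixes v :: "'i \<Rightarrow> 'b::real_inner"
  assumes "finite F" "\<And>A B. A \<in> F \<Longrightarrow> B \<in> F \<Longrightarrow> A \<noteq> B \<Longrightarrow> v A = 0 \<or> v B = 0"
  shows "(norm (\<Sum>A\<in>F. v A))\<^sup>2 = (\<Sum>A\<in>F. (norm (v A))\<^sup>2)"
proof (rule norm_sum_Pythagorean[OF assms(1)])
  show "pairwise (\<lambda>i j. orthogonal (v i) (v j)) F"
    unfolding pairwise_def orthogonal_def using assms(2) by fastforce
qed

text \<open>
  Transplanting \<open>k\<close> eigenfunctions to each of the copies gives \<open>card F * k\<close> trial functions in the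
  cube. If they outnumbered the modes below \<open>L\<close>, a nontrivial combination would be
  orthogonal to all these modes, and its Rayleigh quotient would be both at least \<open>L\<close> and at
  most \<open>ev k\<close>.
\<close>

lemma card_copies_le_card_modes:
  fixes \<Omega> :: "'a::euclidean_space set" and f :: "'i \<Rightarrow> 'a \<Rightarrow> 'a"
  assumes \<Omega>: "open \<Omega>" "bounded \<Omega>" and ev: "dirichlet_eigenvalues \<Omega> ev"
    and S: "S > 0" and L: "L > ev k" "L > 0" and F: "finite F"
    and f: "\<And>A x y. A \<in> F \<Longrightarrow> dist (f A x) (f A y) = dist x y"
    and sub: "\<And>A. A \<in> F \<Longrightarrow> f A ` \<Omega> \<subseteq> box 0 (S *\<^sub>R One)"
    and disj: "\<And>A B. A \<in> F \<Longrightarrow> B \<in> F \<Longrightarrow> A \<noteq> B \<Longrightarrow> f A ` \<Omega> \<inter> f B ` \<Omega> = {}"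
  shows "card F * k \<le> card (modes_below S L :: ('a \<Rightarrow> nat) set)"
proof (rule ccontr)
  assume less: "\<not> ?thesis"
  define J where "J = {1..k}"
  define e where "e m = sine_mode (pi / S) m" for m :: "'a \<Rightarrow> nat"
  let ?N = "modes_below S L :: ('a \<Rightarrow> nat) set"
  have lm: "\<Omega> \<in> lmeasurable" using \<Omega> by (simp add: lmeasurable_open)
  then have ms: "\<Omega> \<in> sets lebesgue" by (rule fmeasurableD)
  obtain u g where ug: "\<And>j. j \<in> J \<Longrightarrow> H10_gradient \<Omega> (u j) (g j)"
    and Ray: "\<And>c. (\<Sum>i\<in>J. \<Sum>j\<in>J. c i * c j * (\<integral>x. g i x \<bullet> g j x \<partial>lebesgue_on \<Omega>))
       \<le> ev k * (\<Sum>i\<in>J. \<Sum>j\<in>J. c i * c j * (\<integral>x. u i x * u j x \<partial>lebesgue_on \<Omega>))"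
    and indep: "\<And>c j. (\<Sum>i\<in>J. \<Sum>j\<in>J. c i * c j * (\<integral>x. u i x * u j x \<partial>lebesgue_on \<Omega>)) \<le> 0 \<Longrightarrow> j \<in> J \<Longrightarrow> c j = 0"
    using dirichlet_trial_functions[OF ms ev, of k] unfolding J_def by blast
  have ug2: "L2_on \<Omega> (u j)" "L2_on \<Omega> (g j)" if "j \<in> J" for j
    using ug[OF that] by (auto simp: H10_gradient_def)
  define P where "P j \<phi> \<longleftrightarrow> (\<forall>i::nat. \<phi> i \<in> test_functions \<Omega> \<and> L2_on \<Omega> (\<phi> i) \<and> L2_on \<Omega> (gradient (\<phi> i))) \<and>
      (\<lambda>i. \<integral>x. (norm (\<phi> i x - u j x))\<^sup>2 \<partial>lebesgue_on \<Omega>) \<longlonglongrightarrow> 0 \<and>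
      (\<lambda>i. \<integral>x. (norm (gradient (\<phi> i) x - g j x))\<^sup>2 \<partial>lebesgue_on \<Omega>) \<longlonglongrightarrow> 0" for j \<phi>
  have "\<forall>j\<in>J. \<exists>\<phi>. P j \<phi>"
  proof
    fix j assume "j \<in> J"
    then show "\<exists>\<phi>. P j \<phi>" unfolding P_def by (rule H10_gradientE[OF ug ms]) blast
  qed
  then obtain \<phi> where "\<And>j. j \<in> J \<Longrightarrow> P j (\<phi> j)" by (auto dest!: bchoice)
  then have \<phi>: "\<phi> j i \<in> test_functions \<Omega>" "L2_on \<Omega> (\<phi> j i)" "L2_on \<Omega> (gradient (\<phi> j i))"
    and \<phi>lim: "(\<lambda>i. \<integral>x. (norm (\<phi> j i x - u j x))\<^sup>2 \<partial>lebesgue_on \<Omega>) \<longlonglongrightarrow> 0"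
      "(\<lambda>i. \<integral>x. (norm (gradient (\<phi> j i) x - g j x))\<^sup>2 \<partial>lebesgue_on \<Omega>) \<longlonglongrightarrow> 0" if "j \<in> J" for j i
    using that unfolding P_def by blast+
  have fJ: "finite J" by (simp add: J_def)
  \<comment> \<open>The inner product of mode \<open>m\<close> with \<open>u j\<close> transplanted
    to copy \<open>A\<close>, pulled back to \<open>\<Omega>\<close>. Orthogonality is thus imposed
    on the eigenfunctions, not on their approximants.\<close>
  define \<A> where "\<A> m = (\<lambda>(A, j). \<integral>x. u j x * e m (f A x) \<partial>lebesgue_on \<Omega>)" for m
  have "\<exists>c. (\<exists>i\<in>F \<times> J. c i \<noteq> 0) \<and> (\<forall>m\<in>?N. (\<Sum>i\<in>F \<times> J. c i * \<A> m i) = 0)"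
  proof (rule homogeneous_system_nontrivial)
    show "finite ?N" by (rule finite_modes_below[OF S L(2)])
    show "finite (F \<times> J)" using F fJ by simp
    show "card ?N < card (F \<times> J)" using less by (simp add: card_cartesian_product J_def)
  qed
  then obtain c where c0: "\<exists>i\<in>F \<times> J. c i \<noteq> 0" and c: "\<And>m. m \<in> ?N \<Longrightarrow> (\<Sum>i\<in>F \<times> J. c i * \<A> m i) = 0"
    by blast
  have cf: "continuous_on X (f A)" if "A \<in> F" for A X using f[OF that] by (rule isometry_continuous)
  define h where "h A = inv (f A)" for A
  have h: "dist (h A x) (h A y) = dist x y" if "A \<in> F" for A x y
    unfolding h_def using f[OF that] by (rule isometry_inv)
  have ch: "continuous_on X (h A)" if "A \<in> F" for A X using h[OF that] by (rule isometry_continuous)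
  have fh: "f A (h A x) = x" if "A \<in> F" for A x
    unfolding h_def using isometry_bij[OF f[OF that]] by (simp add: bij_is_surj surj_f_inv_f)
  \<comment> \<open>One compact set serves all \<open>j\<close> at approximation step
    \<open>i\<close>, so its images in the copies are disjoint supports.\<close>
  have "\<forall>i. \<exists>K. compact K \<and> K \<subseteq> \<Omega> \<and> (\<forall>j\<in>J. \<forall>x. x \<notin> K \<longrightarrow> \<phi> j i x = 0 \<and> gradient (\<phi> j i) x = 0)"
  proof
    fix i
    have "\<forall>j\<in>J. \<exists>K. compact K \<and> K \<subseteq> \<Omega> \<and> (\<forall>x. x \<notin> K \<longrightarrow> \<phi> j i x = 0 \<and> gradient (\<phi> j i) x = 0)"
    proof
      fix j assume "j \<in> J"
      from \<phi>(1)[OF this, of i]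
      show "\<exists>K. compact K \<and> K \<subseteq> \<Omega> \<and> (\<forall>x. x \<notin> K \<longrightarrow> \<phi> j i x = 0 \<and> gradient (\<phi> j i) x = 0)"
        by (rule test_functionE) blast
    qed
    then obtain K where "\<forall>j\<in>J. compact (K j) \<and> K j \<subseteq> \<Omega> \<and> (\<forall>x. x \<notin> K j \<longrightarrow> \<phi> j i x = 0 \<and> gradient (\<phi> j i) x = 0)"
      by (auto dest!: bchoice)
    then show "\<exists>K. compact K \<and> K \<subseteq> \<Omega> \<and> (\<forall>j\<in>J. \<forall>x. x \<notin> K \<longrightarrow> \<phi> j i x = 0 \<and> gradient (\<phi> j i) x = 0)"
      using fJ by (intro exI[of _ "\<Union>j\<in>J. K j"] conjI compact_UN) auto
  qed
  from choice[OF this] obtain K where "\<forall>i. compact (K i) \<and> K i \<subseteq> \<Omega> \<and>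
      (\<forall>j\<in>J. \<forall>x. x \<notin> K i \<longrightarrow> \<phi> j i x = 0 \<and> gradient (\<phi> j i) x = 0)" ..
  then have K: "compact (K i)" "K i \<subseteq> \<Omega>"
    and K0: "j \<in> J \<Longrightarrow> x \<notin> K i \<Longrightarrow> \<phi> j i x = 0" "j \<in> J \<Longrightarrow> x \<notin> K i \<Longrightarrow> gradient (\<phi> j i) x = 0" for i j x
    by blast+
  have \<phi>d: "GDERIV (\<phi> j i) x :> gradient (\<phi> j i) x" and \<phi>c: "continuous_on UNIV (gradient (\<phi> j i))"
    if "j \<in> J" for j i x
    using \<phi>(1)[OF that, of i] by (auto elim: test_functionE)
  \<comment> \<open>\<open>a\<close> and \<open>b\<close> are the combination meant for copy
    \<open>A\<close> and its gradient, still on \<open>\<Omega>\<close>; \<open>\<psi>\<close> and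
    \<open>\<Gamma>\<close> are their transplants, \<open>\<Phi>\<close> and \<open>G\<close> the
    sums over all copies.\<close>
  define a where "a A i x = (\<Sum>j\<in>J. c (A, j) *\<^sub>R \<phi> j i x)" for A i x
  define b where "b A i x = (\<Sum>j\<in>J. c (A, j) *\<^sub>R gradient (\<phi> j i) x)" for A i x
  have a0: "a A i x = 0" and b0: "b A i x = 0" if "x \<notin> K i" for A i x
    using K0 that by (auto simp: a_def b_def intro!: sum.neutral)
  have ad: "GDERIV (a A i) x :> b A i x" for A i x
    unfolding a_def b_def by (intro GDERIV_sum GDERIV_scaleR_const \<phi>d)
  then have ac: "continuous_on X (a A i)" for A i X by (rule GDERIV_continuous_on)
  have bc: "continuous_on UNIV (b A i)" for A i
    unfolding b_def by (intro continuous_intros \<phi>c)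
  define \<psi> where "\<psi> A i x = a A i (h A x)" for A i x
  define \<Gamma> where "\<Gamma> A i x = f A (b A i (h A x)) - f A 0" for A i x
  define \<Phi> where "\<Phi> i x = (\<Sum>A\<in>F. \<psi> A i x)" for i x
  define G where "G i x = (\<Sum>A\<in>F. \<Gamma> A i x)" for i x
  have \<psi>c: "continuous_on UNIV (\<psi> A i)" if "A \<in> F" for A i
    unfolding \<psi>_def[abs_def] by (rule continuous_on_compose2[OF ac[of UNIV] ch[OF that]]) simp
  have \<Gamma>c: "continuous_on UNIV (\<Gamma> A i)" if "A \<in> F" for A i
    unfolding \<Gamma>_def[abs_def]
    by (intro continuous_intros continuous_on_compose2[OF cf[OF that, of UNIV]] continuous_on_compose2[OF bc ch[OF that]]) auto
  have \<psi>0: "\<psi> A i x = 0" and \<Gamma>0: "\<Gamma> A i x = 0" if "A \<in> F" "x \<notin> f A ` K i" for A i x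
  proof -
    have "h A x \<notin> K i" using that fh[OF that(1), of x] by (metis image_eqI)
    then show "\<psi> A i x = 0" "\<Gamma> A i x = 0" by (simp_all add: \<psi>_def \<Gamma>_def a0 b0)
  qed
  have K1: "compact (f A ` K i)" if "A \<in> F" for A i
    using cf[OF that] K(1) by (rule compact_continuous_image)
  have \<Gamma>n: "norm (\<Gamma> A i x) = norm (b A i (h A x))" if "A \<in> F" for A i x
    unfolding \<Gamma>_def using orthogonal_transformation_norm[OF isometry_orthogonal[OF f[OF that]]] by simp
  have dis0: "x \<notin> f A ` K i \<or> x \<notin> f B ` K i" if "A \<in> F" "B \<in> F" "A \<noteq> B" for A B x i
    using disj[OF that] K(2)[of i] by blast
  have \<Phi>sq: "(\<Phi> i x)\<^sup>2 = (\<Sum>A\<in>F. (\<psi> A i x)\<^sup>2)" for i x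
  proof -
    have "(norm (\<Sum>A\<in>F. \<psi> A i x))\<^sup>2 = (\<Sum>A\<in>F. (norm (\<psi> A i x))\<^sup>2)"
    proof (rule norm_sum_disjoint_supports[OF F])
      fix A B assume "A \<in> F" "B \<in> F" "A \<noteq> B"
      then show "\<psi> A i x = 0 \<or> \<psi> B i x = 0"
        using dis0[of A B x i] \<psi>0[of A x i] \<psi>0[of B x i] by blast
    qed
    then show ?thesis by (simp add: \<Phi>_def)
  qed
  have Gsq: "(norm (G i x))\<^sup>2 = (\<Sum>A\<in>F. (norm (b A i (h A x)))\<^sup>2)" for i x
  proof -
    have "(norm (G i x))\<^sup>2 = (\<Sum>A\<in>F. (norm (\<Gamma> A i x))\<^sup>2)"
      unfolding G_def
    proof (rule norm_sum_disjoint_supports[OF F])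
      fix A B assume "A \<in> F" "B \<in> F" "A \<noteq> B"
      then show "\<Gamma> A i x = 0 \<or> \<Gamma> B i x = 0"
        using dis0[of A B x i] \<Gamma>0[of A x i] \<Gamma>0[of B x i] by blast
    qed
    then show ?thesis by (simp add: \<Gamma>n)
  qed
  have transplant: "(\<integral>x. q (h A x) \<partial>lborel) = (\<integral>x. q x \<partial>lebesgue_on \<Omega>)" "integrable lborel (\<lambda>x. q (h A x))"
    if A: "A \<in> F" and q: "continuous_on UNIV q" "\<And>x. x \<notin> K i \<Longrightarrow> q x = 0" for A i and q :: "'a \<Rightarrow> real"
  proof -
    have "(\<integral>x. q (h A x) \<partial>lborel) = (\<integral>x. q x \<partial>lborel)"
      using h[OF A] q(1) by (intro isometry_integral borel_measurable_continuous_onI)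
    also have "\<dots> = (\<integral>x. q x \<partial>lebesgue_on \<Omega>)"
      using K(2)[of i] q by (intro integral_lebesgue_on_support(1)[symmetric] ms) auto
    finally show "(\<integral>x. q (h A x) \<partial>lborel) = (\<integral>x. q x \<partial>lebesgue_on \<Omega>)" .
    show "integrable lborel (\<lambda>x. q (h A x))"
    proof (rule integrable_compact_support[OF _ K1[OF A, of i]])
      show "continuous_on UNIV (\<lambda>x. q (h A x))"
        by (rule continuous_on_compose2[OF q(1) ch[OF A]]) simp
      fix x assume "x \<notin> f A ` K i"
      then have "h A x \<notin> K i" using fh[OF A, of x] by (metis image_eqI)
      then show "q (h A x) = 0" by (rule q(2))
    qed
  qed
  have I1: "(\<integral>x. (\<Phi> i x)\<^sup>2 \<partial>lborel)
    = (\<Sum>A\<in>F. \<Sum>j\<in>J. \<Sum>l\<in>J. c (A, j) * c (A, l) * (\<integral>x. \<phi> j i x \<bullet> \<phi> l i x \<partial>lebesgue_on \<Omega>))" for i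
  proof -
    have q: "continuous_on UNIV (\<lambda>x. (a A i x)\<^sup>2)" "\<And>x. x \<notin> K i \<Longrightarrow> (a A i x)\<^sup>2 = 0" for A
      by (auto intro!: continuous_intros ac simp: a0)
    have "(\<integral>x. (\<Phi> i x)\<^sup>2 \<partial>lborel) = (\<Sum>A\<in>F. \<integral>x. (\<psi> A i x)\<^sup>2 \<partial>lborel)"
      unfolding \<Phi>sq \<psi>_def by (intro Bochner_Integration.integral_sum transplant(2)[OF _ q])
    also have "\<dots> = (\<Sum>A\<in>F. \<integral>x. (a A i x)\<^sup>2 \<partial>lebesgue_on \<Omega>)"
      unfolding \<psi>_def by (intro sum.cong refl transplant(1)[OF _ q])
    also have "\<dots> = (\<Sum>A\<in>F. \<Sum>j\<in>J. \<Sum>l\<in>J. c (A, j) * c (A, l) * (\<integral>x. \<phi> j i x \<bullet> \<phi> l i x \<partial>lebesgue_on \<Omega>))"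
    proof (rule sum.cong[OF refl])
      fix A
      have "(a A i x)\<^sup>2 = (\<Sum>j\<in>J. c (A, j) *\<^sub>R \<phi> j i x) \<bullet> (\<Sum>j\<in>J. c (A, j) *\<^sub>R \<phi> j i x)" for x
        by (simp add: a_def power2_eq_square)
      then show "(\<integral>x. (a A i x)\<^sup>2 \<partial>lebesgue_on \<Omega>)
          = (\<Sum>j\<in>J. \<Sum>l\<in>J. c (A, j) * c (A, l) * (\<integral>x. \<phi> j i x \<bullet> \<phi> l i x \<partial>lebesgue_on \<Omega>))"
        by (simp only:) (intro integral_inner_combination fJ \<phi>)
    qed
    finally show ?thesis .
  qed
  have I2: "(\<integral>x. (norm (G i x))\<^sup>2 \<partial>lborel)
    = (\<Sum>A\<in>F. \<Sum>j\<in>J. \<Sum>l\<in>J. c (A, j) * c (A, l) * (\<integral>x. gradient (\<phi> j i) x \<bullet> gradient (\<phi> l i) x \<partial>lebesgue_on \<Omega>))" for i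
  proof -
    have q: "continuous_on UNIV (\<lambda>x. (norm (b A i x))\<^sup>2)" "\<And>x. x \<notin> K i \<Longrightarrow> (norm (b A i x))\<^sup>2 = 0" for A
      by (auto intro!: continuous_intros bc simp: b0)
    have "(\<integral>x. (norm (G i x))\<^sup>2 \<partial>lborel) = (\<Sum>A\<in>F. \<integral>x. (norm (b A i (h A x)))\<^sup>2 \<partial>lborel)"
      unfolding Gsq by (intro Bochner_Integration.integral_sum transplant(2)[OF _ q])
    also have "\<dots> = (\<Sum>A\<in>F. \<integral>x. (norm (b A i x))\<^sup>2 \<partial>lebesgue_on \<Omega>)"
      by (intro sum.cong refl transplant(1)[OF _ q])
    also have "\<dots> = (\<Sum>A\<in>F. \<Sum>j\<in>J. \<Sum>l\<in>J. c (A, j) * c (A, l) * (\<integral>x. gradient (\<phi> j i) x \<bullet> gradient (\<phi> l i) x \<partial>lebesgue_on \<Omega>))"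
      unfolding b_def power2_norm_eq_inner
      by (rule sum.cong[OF refl], rule integral_inner_combination) (use fJ \<phi> in auto)
    finally show ?thesis .
  qed
  have ce: "continuous_on X (e m)" for X m unfolding e_def by (rule continuous_on_sine_mode)
  have cef: "continuous_on UNIV (\<lambda>x. e m (f A x))" if "A \<in> F" for m A
    by (rule continuous_on_compose2[OF ce[of UNIV] cf[OF that]]) simp
  have L2e: "L2_on \<Omega> (\<lambda>x. e m (f A x))" if "A \<in> F" for m A
    by (rule L2_on_bounded_continuous[OF lm cef[OF that]]) (simp add: e_def abs_sine_mode_le_1)
  have I3: "(\<integral>x. \<Phi> i x * e m x \<partial>lborel)
    = (\<Sum>A\<in>F. \<Sum>j\<in>J. c (A, j) * (\<integral>x. \<phi> j i x \<bullet> e m (f A x) \<partial>lebesgue_on \<Omega>))" for i m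
  proof -
    have q: "continuous_on UNIV (\<lambda>x. a A i x * e m (f A x))" "\<And>x. x \<notin> K i \<Longrightarrow> a A i x * e m (f A x) = 0"
      if "A \<in> F" for A
      using cef[OF that] by (auto intro!: continuous_intros ac simp: a0)
    have "(\<integral>x. \<Phi> i x * e m x \<partial>lborel) = (\<integral>x. (\<Sum>A\<in>F. a A i (h A x) * e m (f A (h A x))) \<partial>lborel)"
      by (simp add: \<Phi>_def \<psi>_def sum_distrib_right fh)
    also have "\<dots> = (\<Sum>A\<in>F. \<integral>x. a A i (h A x) * e m (f A (h A x)) \<partial>lborel)"
      by (intro Bochner_Integration.integral_sum transplant(2)[OF _ q])
    also have "\<dots> = (\<Sum>A\<in>F. \<integral>x. a A i x * e m (f A x) \<partial>lebesgue_on \<Omega>)"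
      by (intro sum.cong refl transplant(1)[OF _ q])
    also have "\<dots> = (\<Sum>A\<in>F. \<Sum>j\<in>J. c (A, j) * (\<integral>x. \<phi> j i x \<bullet> e m (f A x) \<partial>lebesgue_on \<Omega>))"
    proof (intro sum.cong refl)
      fix A assume A: "A \<in> F"
      have "(\<integral>x. (\<Sum>j\<in>J. c (A, j) *\<^sub>R \<phi> j i x) \<bullet> (\<Sum>l\<in>{A}. 1 *\<^sub>R e m (f l x)) \<partial>lebesgue_on \<Omega>)
        = (\<Sum>j\<in>J. \<Sum>l\<in>{A}. c (A, j) * 1 * (\<integral>x. \<phi> j i x \<bullet> e m (f l x) \<partial>lebesgue_on \<Omega>))"
        by (rule integral_inner_combination) (use \<phi> A L2e fJ in auto)
      then show "(\<integral>x. a A i x * e m (f A x) \<partial>lebesgue_on \<Omega>)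
          = (\<Sum>j\<in>J. c (A, j) * (\<integral>x. \<phi> j i x \<bullet> e m (f A x) \<partial>lebesgue_on \<Omega>))"
        by (simp add: a_def)
    qed
    finally show ?thesis .
  qed
  \<comment> \<open>Limits of the integrals over each copy; transplantation preserves them, so the
    isometries no longer appear.\<close>
  define QU where "QU A = (\<Sum>j\<in>J. \<Sum>l\<in>J. c (A, j) * c (A, l) * (\<integral>x. u j x \<bullet> u l x \<partial>lebesgue_on \<Omega>))" for A
  define QG where "QG A = (\<Sum>j\<in>J. \<Sum>l\<in>J. c (A, j) * c (A, l) * (\<integral>x. g j x \<bullet> g l x \<partial>lebesgue_on \<Omega>))" for A
  have T1: "(\<lambda>i. \<integral>x. (\<Phi> i x)\<^sup>2 \<partial>lborel) \<longlonglongrightarrow> (\<Sum>A\<in>F. QU A)"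
    unfolding I1 QU_def by (intro tendsto_intros L2_on_inner_tendsto \<phi> \<phi>lim ug2)
  have T2: "(\<lambda>i. \<integral>x. (norm (G i x))\<^sup>2 \<partial>lborel) \<longlonglongrightarrow> (\<Sum>A\<in>F. QG A)"
    unfolding I2 QG_def by (intro tendsto_intros L2_on_inner_tendsto \<phi> \<phi>lim ug2)
  \<comment> \<open>The low coefficients of the approximants converge to those of the transplanted
    eigenfunctions, whose combination has coefficient zero by the choice of
    \<open>c\<close>.\<close>
  have T3: "(\<lambda>i. \<integral>x. \<Phi> i x * e m x \<partial>lborel) \<longlonglongrightarrow> 0" if m: "m \<in> ?N" for m
  proof -
    have "(\<lambda>i. \<integral>x. \<Phi> i x * e m x \<partial>lborel) \<longlonglongrightarrow> (\<Sum>A\<in>F. \<Sum>j\<in>J. c (A, j) * (\<integral>x. u j x \<bullet> e m (f A x) \<partial>lebesgue_on \<Omega>))"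
      unfolding I3 by (intro tendsto_intros L2_on_inner_tendsto \<phi> \<phi>lim ug2 L2e) auto
    also have "(\<Sum>A\<in>F. \<Sum>j\<in>J. c (A, j) * (\<integral>x. u j x \<bullet> e m (f A x) \<partial>lebesgue_on \<Omega>)) = 0"
      using c[OF m] by (simp add: \<A>_def sum.cartesian_product case_prod_unfold)
    finally show ?thesis .
  qed
  let ?\<mu> = "\<lambda>m. (pi / S)\<^sup>2 * (\<Sum>i\<in>Basis. (real (m i))\<^sup>2) :: real"
  have ineq: "L * (\<integral>x. (\<Phi> i x)\<^sup>2 \<partial>lborel)
      - (\<Sum>m\<in>?N. (L - ?\<mu> m) * (\<integral>x. \<Phi> i x * e m x \<partial>lborel)\<^sup>2) / (S / 2) ^ DIM('a)
    \<le> (\<integral>x. (norm (G i x))\<^sup>2 \<partial>lborel)" for i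
    unfolding e_def
  proof (rule spectral_inequality[OF S L(2)])
    let ?K = "\<Union>A\<in>F. f A ` K i"
    show "compact ?K" using F K1 by (intro compact_UN) auto
    show "?K \<subseteq> box 0 (S *\<^sub>R One)" using sub K(2)[of i] by blast
    show "\<Phi> i x = 0" "G i x = 0" if "x \<notin> ?K" for x
      using that unfolding \<Phi>_def G_def by (auto intro!: sum.neutral \<psi>0 \<Gamma>0)
    show "continuous_on UNIV (G i)" unfolding G_def[abs_def] by (intro continuous_intros \<Gamma>c)
    show "GDERIV (\<Phi> i) x :> G i x" for x
      unfolding \<Phi>_def[abs_def] G_def
    proof (rule GDERIV_sum)
      fix A assume "A \<in> F"
      show "GDERIV (\<psi> A i) x :> \<Gamma> A i x"
        unfolding \<psi>_def[abs_def] \<Gamma>_def h_def by (rule isometry_GDERIV[OF f[OF \<open>A \<in> F\<close>] ad])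
    qed
  qed
  have "(\<lambda>i. L * (\<integral>x. (\<Phi> i x)\<^sup>2 \<partial>lborel)
      - (\<Sum>m\<in>?N. (L - ?\<mu> m) * (\<integral>x. \<Phi> i x * e m x \<partial>lborel)\<^sup>2) / (S / 2) ^ DIM('a))
    \<longlonglongrightarrow> L * (\<Sum>A\<in>F. QU A) - (\<Sum>m\<in>?N. (L - ?\<mu> m) * 0\<^sup>2) / (S / 2) ^ DIM('a)"
    by (intro tendsto_intros T1 T3) (use S in auto)
  from LIMSEQ_le[OF this T2]
  have "L * (\<Sum>A\<in>F. QU A) - (\<Sum>m\<in>?N. (L - ?\<mu> m) * 0\<^sup>2) / (S / 2) ^ DIM('a) \<le> (\<Sum>A\<in>F. QG A)"
    using ineq by blast
  then have 1: "L * (\<Sum>A\<in>F. QU A) \<le> (\<Sum>A\<in>F. QG A)" by simp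
  have "(\<Sum>A\<in>F. QG A) \<le> (\<Sum>A\<in>F. ev k * QU A)"
    unfolding QG_def QU_def inner_real_def by (intro sum_mono Ray)
  \<comment> \<open>As L > ev k, the total Gram form cannot be positive. Its summands are
    nonnegative, so each is zero, and definiteness forces c = 0.\<close>
  then have 2: "(L - ev k) * (\<Sum>A\<in>F. QU A) \<le> 0"
    using 1 by (simp add: sum_distrib_left algebra_simps)
  have QU0: "0 \<le> QU A" for A
    unfolding QU_def
    by (subst integral_inner_combination[symmetric]) (auto intro!: fJ ug2 integral_nonneg_AE)
  have "(\<Sum>A\<in>F. QU A) \<le> 0" using 2 L(1) by (simp add: mult_le_0_iff)
  then have "QU A \<le> 0" if "A \<in> F" for A
    using that F QU0 by (meson member_le_sum order_trans)
  then have "c (A, j) = 0" if "A \<in> F" "j \<in> J" for A j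
    using indep[of "\<lambda>j. c (A, j)" j] that by (simp add: QU_def)
  then show False using c0 by auto
qed

section \<open>From mode counts to the eigenvalue bound\<close>

lemma dirichlet_eigenvalue_nonneg:
  fixes \<Omega> :: "'a::euclidean_space set"
  assumes "\<Omega> \<in> sets lebesgue" "dirichlet_eigenvalues \<Omega> ev" "k \<ge> 1"
  shows "ev k \<ge> 0"
proof (rule dirichlet_trial_functions[OF assms(1,2), of k])
  fix u :: "nat \<Rightarrow> 'a \<Rightarrow> real" and g :: "nat \<Rightarrow> 'a \<Rightarrow> 'a"
  assume Ray: "\<And>c. (\<Sum>i\<in>{1..k}. \<Sum>j\<in>{1..k}. c i * c j * (\<integral>x. g i x \<bullet> g j x \<partial>lebesgue_on \<Omega>))
       \<le> ev k * (\<Sum>i\<in>{1..k}. \<Sum>j\<in>{1..k}. c i * c j * (\<integral>x. u i x * u j x \<partial>lebesgue_on \<Omega>))"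
    and indep: "\<And>c j. (\<Sum>i\<in>{1..k}. \<Sum>j\<in>{1..k}. c i * c j * (\<integral>x. u i x * u j x \<partial>lebesgue_on \<Omega>)) \<le> 0
      \<Longrightarrow> j \<in> {1..k} \<Longrightarrow> c j = 0"
  \<comment> \<open>Selects the \<open>k\<close>-th function alone: its nonnegative Dirichlet
    integral is at most \<open>ev k\<close> times its positive squared norm.\<close>
  define c where "c j = (if j = k then 1 else 0 :: real)" for j
  have eq: "(\<Sum>i\<in>{1..k}. \<Sum>j\<in>{1..k}. c i * c j * q i j) = q k k" for q :: "nat \<Rightarrow> nat \<Rightarrow> real"
    using assms(3) by (simp add: c_def if_distrib[of "\<lambda>x. x * _"] if_distrib[of "\<lambda>x. _ * x"] sum.delta cong: if_cong)
  have "0 \<le> (\<integral>x. g k x \<bullet> g k x \<partial>lebesgue_on \<Omega>)" by (rule integral_nonneg_AE) simp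
  also have "\<dots> \<le> ev k * (\<integral>x. u k x * u k x \<partial>lebesgue_on \<Omega>)"
    using Ray[of c] unfolding eq .
  finally have "0 \<le> ev k * (\<integral>x. u k x * u k x \<partial>lebesgue_on \<Omega>)" .
  moreover have "(\<integral>x. u k x * u k x \<partial>lebesgue_on \<Omega>) > 0"
    using indep[of c k] assms(3) unfolding eq by (auto simp: c_def not_le[symmetric])
  ultimately show "ev k \<ge> 0" by (simp add: zero_le_mult_iff)
qed

text \<open>The number of copies and the bound on the number of modes both scale like s^n; the
  collar enters only through ((s + 2D)/s)^n, which tends to 1. The 2 in \<open>2 * pi\<close> comes
  from the 2^n mirror images in the mode count.\<close>

lemma packing_eigenvalue_bound:
  fixes \<Omega> :: "'a::euclidean_space set"
  assumes \<Omega>: "open \<Omega>" "\<Omega> \<noteq> {}" "bounded \<Omega>" and ev: "dirichlet_eigenvalues \<Omega> ev"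
    and L: "L > ev k" "L > 0"
  shows "packing_constant \<Omega> * real k
    \<le> measure lebesgue \<Omega> * (unit_ball_vol (real DIM('a)) * (sqrt L / (2 * pi)) ^ DIM('a))"
proof (rule dense_le)
  fix y assume "y < packing_constant \<Omega> * real k"
  define V where "V = measure lebesgue \<Omega>"
  define X where "X = V * (unit_ball_vol (real DIM('a)) * (sqrt L / (2 * pi)) ^ DIM('a))"
  have X0: "X \<ge> 0" using L by (simp add: X_def V_def)
  show "y \<le> measure lebesgue \<Omega> * (unit_ball_vol (real DIM('a)) * (sqrt L / (2 * pi)) ^ DIM('a))"
    unfolding V_def[symmetric] X_def[symmetric]
  proof (cases "y \<le> 0")
    case True
    then show "y \<le> X" using X0 by simp
  next
    case False
    then have k: "real k > 0"
      using \<open>y < packing_constant \<Omega> * real k\<close> by (cases "k = 0") auto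
    define \<eta> where "\<eta> = y / real k"
    have \<eta>: "0 < \<eta>" "\<eta> < packing_constant \<Omega>"
      using False k \<open>y < packing_constant \<Omega> * real k\<close> by (auto simp: \<eta>_def field_simps)
    obtain B where B: "\<And>x. x \<in> \<Omega> \<Longrightarrow> norm x \<le> B" using \<Omega>(3) by (auto simp: bounded_iff)
    define D where "D = 2 * B + 1"
    have D: "dist x y < D" if "x \<in> \<Omega>" "y \<in> \<Omega>" for x y
      using B[OF that(1)] B[OF that(2)] norm_triangle_ineq4[of x y] by (simp add: dist_norm D_def)
    have "D > 0" using \<Omega>(2) D zero_le_dist by (metis all_not_in_conv order_le_less_trans)
    have main: "y \<le> X * ((s + 2 * D) / s) ^ DIM('a)" if s: "s > 0" for s
    proof -
      define S where "S = s + 2 * D"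
      have S: "S > 0" using s \<open>D > 0\<close> by (simp add: S_def)
      obtain F z where F: "finite F" "\<And>A. A \<in> F \<Longrightarrow> congruent_copy \<Omega> A" "pairwise disjnt F"
        and box: "\<And>A. A \<in> F \<Longrightarrow> A \<subseteq> box z (z + S *\<^sub>R One)"
        and many: "\<eta> * s ^ DIM('a) \<le> real (card F) * V"
        using packing_constant_cube[OF \<Omega>(1,3) D \<eta> s] unfolding V_def S_def by blast
      have "\<forall>A\<in>F. \<exists>f. (\<forall>x y. dist (f x) (f y) = dist x y) \<and> A = f ` \<Omega>"
        using F(2) unfolding congruent_copy_def by blast
      from bchoice[OF this] obtain f
        where "\<forall>A\<in>F. (\<forall>x y. dist (f A x) (f A y) = dist x y) \<and> A = f A ` \<Omega>" ..
      then have f: "dist (f A x) (f A y) = dist x y" "f A ` \<Omega> = A" if "A \<in> F" for A x y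
        using that by auto
      have im: "(\<lambda>x. f A x - z) ` \<Omega> = (\<lambda>x. x - z) ` A" if "A \<in> F" for A
        by (subst (2) f(2)[OF that, symmetric]) (simp only: image_image)
      have "card F * k \<le> card (modes_below S L :: ('a \<Rightarrow> nat) set)"
      proof (rule card_copies_le_card_modes[OF \<Omega>(1,3) ev S L F(1), where f = "\<lambda>A x. f A x - z"])
        show "dist (f A x - z) (f A y - z) = dist x y" if "A \<in> F" for A x y
          using f(1)[OF that] by (simp add: dist_norm)
        show "(\<lambda>x. f A x - z) ` \<Omega> \<subseteq> box 0 (S *\<^sub>R One)" if "A \<in> F" for A
          unfolding im[OF that] using box[OF that] by (fastforce simp: mem_box inner_diff_left inner_add_left)
        show "(\<lambda>x. f A x - z) ` \<Omega> \<inter> (\<lambda>x. f B x - z) ` \<Omega> = {}" if "A \<in> F" "B \<in> F" "A \<noteq> B" for A B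
          unfolding im[OF that(1)] im[OF that(2)] using pairwiseD[OF F(3) that] by (auto simp: disjnt_def)
      qed
      then have "real (card F) * real k \<le> real (card (modes_below S L :: ('a \<Rightarrow> nat) set))"
        by (metis of_nat_le_iff of_nat_mult)
      then have "2 ^ DIM('a) * (real (card F) * real k) \<le> 2 ^ DIM('a) * real (card (modes_below S L :: ('a \<Rightarrow> nat) set))"
        by (rule mult_left_mono) simp
      also have "\<dots> \<le> unit_ball_vol (real DIM('a)) * (S * sqrt L / pi) ^ DIM('a)"
        by (rule card_modes_below[OF S L(2)])
      finally have cnt: "real (card F) * real k \<le> unit_ball_vol (real DIM('a)) * (S * (sqrt L / (2 * pi))) ^ DIM('a)"
        by (simp add: power_mult_distrib power_divide field_simps)
      have "y * s ^ DIM('a) = \<eta> * s ^ DIM('a) * real k" using k by (simp add: \<eta>_def)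
      also have "\<dots> \<le> real (card F) * V * real k" using many by (intro mult_right_mono) auto
      also have "\<dots> = real (card F) * real k * V" by simp
      also have "\<dots> \<le> unit_ball_vol (real DIM('a)) * (S * (sqrt L / (2 * pi))) ^ DIM('a) * V"
        using cnt by (intro mult_right_mono) (auto simp: V_def)
      also have "\<dots> = X * S ^ DIM('a)" by (simp only: X_def power_mult_distrib mult_ac)
      finally show ?thesis using s by (simp add: S_def power_divide field_simps)
    qed
    have "((\<lambda>s. X * ((s + 2 * D) / s) ^ DIM('a)) \<longlongrightarrow> X * 1 ^ DIM('a)) at_top"
      by (intro tendsto_intros) real_asymp
    then show "y \<le> X"
      using main by (intro tendsto_lowerbound[of _ X at_top]) (auto intro: eventually_mono[OF eventually_gt_at_top[of 0]])
  qed
qed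

theorem theorem1:
  fixes \<Omega> :: "'a::euclidean_space set" and ev :: "nat \<Rightarrow> real" and k :: nat
  assumes "open \<Omega>" and "connected \<Omega>" and "\<Omega> \<noteq> {}"
    and "bounded \<Omega>" and "lipschitz_boundary \<Omega>"
    and "dirichlet_eigenvalues \<Omega> ev"
    and "k \<ge> 1"
  defines "n \<equiv> real DIM('a)"
  defines "V \<equiv> measure lebesgue \<Omega>"
  defines "\<delta> \<equiv> packing_constant \<Omega>"
  defines "\<omega> \<equiv> measure lebesgue (ball (0::'a) 1)"
  defines "C \<equiv> (2 * pi)\<^sup>2 / \<omega> powr (2 / n)"
  shows "ev k \<ge> C * (\<delta> * (real k / V)) powr (2 / n)"
proof (rule dense_ge)
  \<comment> \<open>The counting argument needs a strict gap above \<open>ev k\<close>; a bound by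
    every such \<open>L\<close> is a bound by \<open>ev k\<close>.\<close>
  fix L assume L: "L > ev k"
  have "\<Omega> \<in> sets lebesgue" using assms(1) by (simp add: borel_open)
  then have L0: "L > 0" using dirichlet_eigenvalue_nonneg assms(6,7) L by (metis order_le_less_trans)
  have \<omega>: "\<omega> = unit_ball_vol n"
    by (simp add: \<omega>_def n_def content_ball)
  have n: "n > 0" by (simp add: n_def)
  have \<omega>0: "\<omega> > 0" using n by (simp add: \<omega>)
  define t where "t = sqrt L / (2 * pi)"
  have t: "t > 0" using L0 by (simp add: t_def)
  have V0: "V \<ge> 0" and \<delta>0: "\<delta> \<ge> 0" by (simp_all add: V_def \<delta>_def packing_constant_def)
  have "\<delta> * real k \<le> V * (\<omega> * t ^ DIM('a))"
    unfolding \<omega> n_def V_def \<delta>_def t_def by (rule packing_eigenvalue_bound) (use assms L L0 in auto)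
  \<comment> \<open>In the case V = 0 the quotient is 0 by the convention for division by
    zero.\<close>
  then have "\<delta> * (real k / V) \<le> \<omega> * t ^ DIM('a)"
    using V0 \<omega>0 t by (cases "V = 0") (auto simp: field_simps)
  then have "(\<delta> * (real k / V)) powr (2 / n) \<le> (\<omega> * t ^ DIM('a)) powr (2 / n)"
    using n \<delta>0 V0 by (intro powr_mono2) auto
  also have "\<dots> = \<omega> powr (2 / n) * t\<^sup>2"
  proof -
    have "t ^ DIM('a) = t powr n" using t by (simp add: powr_realpow n_def)
    then have "(t ^ DIM('a)) powr (2 / n) = t powr 2" using n by (simp add: powr_powr)
    also have "\<dots> = t\<^sup>2" using t by simp
    finally show ?thesis using \<omega>0 t by (simp add: powr_mult)
  qed
  finally have "C * (\<delta> * (real k / V)) powr (2 / n) \<le> C * (\<omega> powr (2 / n) * t\<^sup>2)"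
    by (intro mult_left_mono) (auto simp: C_def)
  also have "\<dots> = L"
    using \<omega>0 L0 by (simp add: C_def t_def power_divide)
  finally show "C * (\<delta> * (real k / V)) powr (2 / n) \<le> L" .
qed

end
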